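(* Let $K$ be a field and let $\mathcal{T}$ be a $K$-linear essentially small triangulated category with a good metric $\mathfrak{B}=\{\mathfrak{B}_n\}_{n\in\mathbb{N}}$. Let $(\mathcal{T}^{\leq0},\mathcal{T}^{\geq0})$ be a $t$-structure on $\mathcal{T}$ with heart $\mathcal{T}^0$, and let $\mathcal{X}$ be a torsion class of $\mathcal{T}^0$. If $(\mathcal{T}^{\leq0},\mathcal{T}^{\geq0})$ is extendable with respect to $\mathfrak{B}$, then $$\mathfrak{G}(\mu^{\mathrm{L}}_{\mathcal{X}}\mathcal{T}^{\leq0})=\mu^{\mathrm{L}}_{\mathfrak{G}(\mathcal{X})}\mathfrak{G}(\mathcal{T}^{\leq0}),\qquad \mathfrak{G}(\mu^{\mathrm{L}}_{\mathcal{X}}\mathcal{T}^{\geq0})=\mu^{\mathrm{L}}_{\mathfrak{G}(\mathcal{X})}\mathfrak{G}(\mathcal{T}^{\geq0}).$$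
   Context: Let $\Sigma$ be the shift of $\mathcal{T}$. For full subcategories $\mathcal{U},\mathcal{V}$ of a triangulated category, $\mathcal{U}*\mathcal{V}$ is the full subcategory of objects $Z$ admitting a triangle $U\to Z\to V\to\Sigma U$ with $U\in\mathcal{U}$, $V\in\mathcal{V}$. For $\mathcal{U}$ and a full subcategory $\mathcal{A}$ of the ambient category, $\mathcal{U}^{\perp_{\mathcal{A}}}=\{A\in\mathcal{A}\mid \mathrm{Hom}(U,A)=0\ \forall U\in\mathcal{U}\}$. Subcategories are considered up to isomorphism of objects. $t$-structure: a pair $(\mathcal{T}^{\leq0},\mathcal{T}^{\geq0})$ of full subcategories such that, with $\mathcal{T}^{\leq n}=\Sigma^{-n}\mathcal{T}^{\leq0}$ and $\mathcal{T}^{\geq n}=\Sigma^{-n}\mathcal{T}^{\geq0}$, one has $\mathcal{T}^{\leq-1}\subseteq\mathcal{T}^{\leq0}$, $\mathcal{T}^{\geq0}\subseteq\mathcal{T}^{\geq-1}$, $\mathrm{Hom}(\mathcal{T}^{\leq-1},\mathcal{T}^{\geq0})=0$ and $\mathcal{T}=\mathcal{T}^{\leq-1}*\mathcal{T}^{\geq0}$. Its heart is the abelian category $\mathcal{T}^0=\mathcal{T}^{\leq0}\cap\mathcal{T}^{\geq0}$. Torsion class: a full subcategory $\mathcal{X}$ of an abelian category $\mathcal{A}$ such that every $a\in\mathcal{A}$ has an exact sequence $0\to x\to a\to y\to0$ with $x\in\mathcal{X}$, $y\in\mathcal{X}^{\perp_{\mathcal{A}}}$. Good metric: a sequence $\mathfrak{B}=\{\mathfrak{B}_n\}_{n\in\mathbb{N}}$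 of full subcategories with $0\in\mathfrak{B}_n$, $\mathfrak{B}_n*\mathfrak{B}_n=\mathfrak{B}_n$ and $\Sigma^{-1}\mathfrak{B}_{n+1}\cup\mathfrak{B}_{n+1}\cup\Sigma\mathfrak{B}_{n+1}\subseteq\mathfrak{B}_n$ for all $n$. The $t$-structure is extendable with respect to $\mathfrak{B}$ if $\mathfrak{B}_n\subseteq\mathcal{T}^{\leq0}$ for some $n\in\mathbb{N}$. Completion: a sequence $X_0\xrightarrow{f_1}X_1\xrightarrow{f_2}\cdots$ in $\mathcal{T}$ is Cauchy if for each $i\geq1$ there is $n_i\geq1$ with $\mathrm{Cone}(f_j)\in\mathfrak{B}_i$ for all $j\geq n_i$. Let $\text{Mod-}\mathcal{T}$ be the category of additive contravariant functors from $\mathcal{T}$ to abelian groups and $Y:\mathcal{T}\to\text{Mod-}\mathcal{T}$, $T\mapsto\mathrm{Hom}_{\mathcal{T}}(-,T)$, the Yoneda embedding. For a full subcategory $\mathcal{U}\subseteq\mathcal{T}$, $\mathfrak{L}(\mathcal{U})$ is the full subcategory of $F\in\text{Mod-}\mathcal{T}$ with $F\simeq\operatorname{colim}_n Y(X_n)$ for a Cauchy sequence $\{X_\bullet\}$ in $\mathcal{T}$ with all $X_n\in\mathcal{U}$; $\mathfrak{C}(\mathcal{T})$ is the full subcategory of $F$ such that for every $j\in\mathbb{Z}$ there is $i\in\mathbb{N}$ with $\mathrm{Hom}(Y(\Sigma^jB),F)=0$ for all $B\in\mathfrak{B}_i$; and $\mathfrak{G}(\mathcal{U})=\mathfrak{L}(\mathcal{U})\cap\mathfrak{C}(\mathcal{T})$.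 The category $\mathfrak{G}(\mathcal{T})$ is triangulated with shift $(\Sigma F)(T)=F(\Sigma^{-1}T)$; its triangles are the sequences isomorphic to colimits of Yoneda images of Cauchy sequences of triangles $\{A_\bullet\}\to\{B_\bullet\}\to\{C_\bullet\}\to\Sigma\{A_\bullet\}$ in $\mathcal{T}$, lying in $\mathfrak{G}(\mathcal{T})$. When $(\mathcal{T}^{\leq0},\mathcal{T}^{\geq0})$ is extendable, $(\mathfrak{G}(\mathcal{T}^{\leq0}),\mathfrak{G}(\mathcal{T}^{\geq0}))$ is a $t$-structure on $\mathfrak{G}(\mathcal{T})$ with heart $Y(\mathcal{T}^0)$. HRS-tilts: $\mu^{\mathrm{L}}_{\mathcal{X}}\mathcal{T}^{\leq0}=\mathcal{T}^{\leq-1}*\mathcal{X}$ and $\mu^{\mathrm{L}}_{\mathcal{X}}\mathcal{T}^{\geq0}=\Sigma(\mathcal{X}^{\perp_{\mathcal{T}^0}})*\mathcal{T}^{\geq0}$ in $\mathcal{T}$; and $\mu^{\mathrm{L}}_{\mathfrak{G}(\mathcal{X})}\mathfrak{G}(\mathcal{T}^{\leq0})=\mathfrak{G}(\mathcal{T}^{\leq-1})*\mathfrak{G}(\mathcal{X})$ and $\mu^{\mathrm{L}}_{\mathfrak{G}(\mathcal{X})}\mathfrak{G}(\mathcal{T}^{\geq0})=\Sigma(\mathfrak{G}(\mathcal{X})^{\perp_{Y(\mathcal{T}^0)}})*\mathfrak{G}(\mathcal{T}^{\geq0})$ in $\mathfrak{G}(\mathcal{T})$. *)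

theory Defs
  imports "HOL-Algebra.Module" "HOL-Algebra.AbelCoset" "HOL-Library.FuncSet"
begin

section \<open>Categories enriched in abelian groups, with shift and triangles\<close>

text \<open>
  Morphism sets for different pairs of objects are not required to be disjoint, so every
  operation on morphisms carries the objects involved: \<open>Comp C X Y Z g f\<close> is the composite
  of \<open>f : X \<rightarrow> Y\<close> followed by \<open>g : Y \<rightarrow> Z\<close>, and \<open>ShM C X Y f : \<Sigma>X \<rightarrow> \<Sigma>Y\<close> is the shift of
  \<open>f : X \<rightarrow> Y\<close>. An element \<open>(X, Y, Z, u, v, w)\<close> of \<open>Tri C\<close> is the triangle
  \<open>X \<rightarrow> Y \<rightarrow> Z \<rightarrow> \<Sigma>X\<close> with maps \<open>u\<close>, \<open>v\<close>, \<open>w\<close>. As usual in HOL-Algebra, an abelian group is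
  the additive part of a ring record; the type parameter \<open>'x\<close> leaves room for the scalar
  multiplication of a module.
\<close>

record ('o, 'm, 'x) tricat =
  Ob :: "'o set"
  Hom :: "'o \<Rightarrow> 'o \<Rightarrow> ('m, 'x) ring_scheme"
  Comp :: "'o \<Rightarrow> 'o \<Rightarrow> 'o \<Rightarrow> 'm \<Rightarrow> 'm \<Rightarrow> 'm"
  Idm :: "'o \<Rightarrow> 'm"
  Sh :: "'o \<Rightarrow> 'o"
  ShM :: "'o \<Rightarrow> 'o \<Rightarrow> 'm \<Rightarrow> 'm"
  Tri :: "('o \<times> 'o \<times> 'o \<times> 'm \<times> 'm \<times> 'm) set"

type_synonym ('o, 'm, 'k) lin_tricat = "('o, 'm, ('k, 'm, unit) module_ext) tricat"

abbreviation Mor :: "('o, 'm, 'x) tricat \<Rightarrow> 'o \<Rightarrow> 'o \<Rightarrow> 'm set"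
  where "Mor C X Y \<equiv> carrier (Hom C X Y)"

definition hom_zero :: "('m, 'x) ring_scheme \<Rightarrow> bool"
  where "hom_zero H \<longleftrightarrow> carrier H = {\<zero>\<^bsub>H\<^esub>}"

definition is_iso :: "('o, 'm, 'x) tricat \<Rightarrow> 'o \<Rightarrow> 'o \<Rightarrow> 'm \<Rightarrow> bool"
  where "is_iso C X Y f \<longleftrightarrow> f \<in> Mor C X Y \<and>
    (\<exists>g\<in>Mor C Y X. Comp C X Y X g f = Idm C X \<and> Comp C Y X Y f g = Idm C Y)"

definition isomorphic :: "('o, 'm, 'x) tricat \<Rightarrow> 'o \<Rightarrow> 'o \<Rightarrow> bool"
  where "isomorphic C X Y \<longleftrightarrow> (\<exists>f. is_iso C X Y f)"

definition zero_ob :: "('o, 'm, 'x) tricat \<Rightarrow> 'o \<Rightarrow> bool"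
  where "zero_ob C Z \<longleftrightarrow> Z \<in> Ob C \<and> (\<forall>X\<in>Ob C. hom_zero (Hom C X Z) \<and> hom_zero (Hom C Z X))"

definition is_biproduct ::
    "('o, 'm, 'x) tricat \<Rightarrow> 'o \<Rightarrow> 'o \<Rightarrow> 'o \<Rightarrow> 'm \<Rightarrow> 'm \<Rightarrow> 'm \<Rightarrow> 'm \<Rightarrow> bool"
  where "is_biproduct C X Y P i1 i2 p1 p2 \<longleftrightarrow>
    P \<in> Ob C \<and> i1 \<in> Mor C X P \<and> i2 \<in> Mor C Y P \<and> p1 \<in> Mor C P X \<and> p2 \<in> Mor C P Y \<and>
    Comp C X P X p1 i1 = Idm C X \<and> Comp C Y P Y p2 i2 = Idm C Y \<and>
    Comp C Y P X p1 i2 = \<zero>\<^bsub>Hom C Y X\<^esub> \<and> Comp C X P Y p2 i1 = \<zero>\<^bsub>Hom C X Y\<^esub> \<and>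
    Comp C P X P i1 p1 \<oplus>\<^bsub>Hom C P P\<^esub> Comp C P Y P i2 p2 = Idm C P"

definition tri_morphism ::
    "('o, 'm, 'x) tricat \<Rightarrow> 'o \<times> 'o \<times> 'o \<times> 'm \<times> 'm \<times> 'm \<Rightarrow> 'o \<times> 'o \<times> 'o \<times> 'm \<times> 'm \<times> 'm
      \<Rightarrow> 'm \<Rightarrow> 'm \<Rightarrow> 'm \<Rightarrow> bool"
  where "tri_morphism C t t' a b c \<longleftrightarrow>
    (case t of (X, Y, Z, u, v, w) \<Rightarrow> case t' of (X', Y', Z', u', v', w') \<Rightarrow>
      a \<in> Mor C X X' \<and> b \<in> Mor C Y Y' \<and> c \<in> Mor C Z Z' \<and>
      Comp C X Y Y' b u = Comp C X X' Y' u' a \<and>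
      Comp C Y Z Z' c v = Comp C Y Y' Z' v' b \<and>
      Comp C Z (Sh C X) (Sh C X') (ShM C X X' a) w = Comp C Z Z' (Sh C X') w' c)"

locale additive_category =
  fixes C :: "('o, 'm, 'x) tricat"
  assumes hom_group: "\<lbrakk>X \<in> Ob C; Y \<in> Ob C\<rbrakk> \<Longrightarrow> abelian_group (Hom C X Y)"
    and id_in: "X \<in> Ob C \<Longrightarrow> Idm C X \<in> Mor C X X"
    and comp_in: "\<lbrakk>X \<in> Ob C; Y \<in> Ob C; Z \<in> Ob C; f \<in> Mor C X Y; g \<in> Mor C Y Z\<rbrakk>
      \<Longrightarrow> Comp C X Y Z g f \<in> Mor C X Z"
    and comp_id_right: "\<lbrakk>X \<in> Ob C; Y \<in> Ob C; f \<in> Mor C X Y\<rbrakk> \<Longrightarrow> Comp C X X Y f (Idm C X) = f"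
    and comp_id_left: "\<lbrakk>X \<in> Ob C; Y \<in> Ob C; f \<in> Mor C X Y\<rbrakk> \<Longrightarrow> Comp C X Y Y (Idm C Y) f = f"
    and comp_assoc: "\<lbrakk>W \<in> Ob C; X \<in> Ob C; Y \<in> Ob C; Z \<in> Ob C;
        f \<in> Mor C W X; g \<in> Mor C X Y; h \<in> Mor C Y Z\<rbrakk>
      \<Longrightarrow> Comp C W X Z (Comp C X Y Z h g) f = Comp C W Y Z h (Comp C W X Y g f)"
    and comp_add_left: "\<lbrakk>X \<in> Ob C; Y \<in> Ob C; Z \<in> Ob C;
        f \<in> Mor C X Y; g \<in> Mor C Y Z; g' \<in> Mor C Y Z\<rbrakk>
      \<Longrightarrow> Comp C X Y Z (g \<oplus>\<^bsub>Hom C Y Z\<^esub> g') f = Comp C X Y Z g f \<oplus>\<^bsub>Hom C X Z\<^esub> Comp C X Y Z g' f"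
    and comp_add_right: "\<lbrakk>X \<in> Ob C; Y \<in> Ob C; Z \<in> Ob C;
        f \<in> Mor C X Y; f' \<in> Mor C X Y; g \<in> Mor C Y Z\<rbrakk>
      \<Longrightarrow> Comp C X Y Z g (f \<oplus>\<^bsub>Hom C X Y\<^esub> f') = Comp C X Y Z g f \<oplus>\<^bsub>Hom C X Z\<^esub> Comp C X Y Z g f'"
    and ex_zero_ob: "\<exists>Z. zero_ob C Z"
    and ex_biproduct: "\<lbrakk>X \<in> Ob C; Y \<in> Ob C\<rbrakk> \<Longrightarrow> \<exists>P i1 i2 p1 p2. is_biproduct C X Y P i1 i2 p1 p2"

text \<open>The shift is an automorphism (not merely an autoequivalence) of the category.\<close>

locale category_with_shift = additive_category C for C :: "('o, 'm, 'x) tricat" +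
  assumes sh_bij: "bij_betw (Sh C) (Ob C) (Ob C)"
    and shm_bij: "\<lbrakk>X \<in> Ob C; Y \<in> Ob C\<rbrakk>
      \<Longrightarrow> bij_betw (ShM C X Y) (Mor C X Y) (Mor C (Sh C X) (Sh C Y))"
    and shm_id: "X \<in> Ob C \<Longrightarrow> ShM C X X (Idm C X) = Idm C (Sh C X)"
    and shm_comp: "\<lbrakk>X \<in> Ob C; Y \<in> Ob C; Z \<in> Ob C; f \<in> Mor C X Y; g \<in> Mor C Y Z\<rbrakk>
      \<Longrightarrow> ShM C X Z (Comp C X Y Z g f) = Comp C (Sh C X) (Sh C Y) (Sh C Z) (ShM C Y Z g) (ShM C X Y f)"
    and shm_add: "\<lbrakk>X \<in> Ob C; Y \<in> Ob C; f \<in> Mor C X Y; g \<in> Mor C X Y\<rbrakk>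
      \<Longrightarrow> ShM C X Y (f \<oplus>\<^bsub>Hom C X Y\<^esub> g) = ShM C X Y f \<oplus>\<^bsub>Hom C (Sh C X) (Sh C Y)\<^esub> ShM C X Y g"

locale triangulated_category = category_with_shift C for C :: "('o, 'm, 'x) tricat" +
  assumes tri_wf: "(X, Y, Z, u, v, w) \<in> Tri C \<Longrightarrow>
        X \<in> Ob C \<and> Y \<in> Ob C \<and> Z \<in> Ob C \<and>
        u \<in> Mor C X Y \<and> v \<in> Mor C Y Z \<and> w \<in> Mor C Z (Sh C X)"
    and tri_iso: "\<lbrakk>(X, Y, Z, u, v, w) \<in> Tri C; X' \<in> Ob C; Y' \<in> Ob C; Z' \<in> Ob C;
        u' \<in> Mor C X' Y'; v' \<in> Mor C Y' Z'; w' \<in> Mor C Z' (Sh C X');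
        is_iso C X X' a; is_iso C Y Y' b; is_iso C Z Z' c;
        tri_morphism C (X, Y, Z, u, v, w) (X', Y', Z', u', v', w') a b c\<rbrakk>
      \<Longrightarrow> (X', Y', Z', u', v', w') \<in> Tri C"
    and tri_id: "\<lbrakk>X \<in> Ob C; zero_ob C Z\<rbrakk>
      \<Longrightarrow> (X, X, Z, Idm C X, \<zero>\<^bsub>Hom C X Z\<^esub>, \<zero>\<^bsub>Hom C Z (Sh C X)\<^esub>) \<in> Tri C"
    and tri_ex: "\<lbrakk>X \<in> Ob C; Y \<in> Ob C; u \<in> Mor C X Y\<rbrakk> \<Longrightarrow> \<exists>Z v w. (X, Y, Z, u, v, w) \<in> Tri C"
    and tri_rotate: "\<lbrakk>X \<in> Ob C; Y \<in> Ob C; Z \<in> Ob C;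
        u \<in> Mor C X Y; v \<in> Mor C Y Z; w \<in> Mor C Z (Sh C X)\<rbrakk>
      \<Longrightarrow> (X, Y, Z, u, v, w) \<in> Tri C \<longleftrightarrow>
          (Y, Z, Sh C X, v, w, \<ominus>\<^bsub>Hom C (Sh C X) (Sh C Y)\<^esub> ShM C X Y u) \<in> Tri C"
    and tri_complete: "\<lbrakk>(X, Y, Z, u, v, w) \<in> Tri C; (X', Y', Z', u', v', w') \<in> Tri C;
        a \<in> Mor C X X'; b \<in> Mor C Y Y'; Comp C X Y Y' b u = Comp C X X' Y' u' a\<rbrakk>
      \<Longrightarrow> \<exists>c. tri_morphism C (X, Y, Z, u, v, w) (X', Y', Z', u', v', w') a b c"
    and tri_octahedral: "\<lbrakk>(X, Y, Z', u, i, i') \<in> Tri C; (Y, Z, X', v, j, j') \<in> Tri C;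
        (X, Z, Y', Comp C X Y Z v u, k, k') \<in> Tri C\<rbrakk>
      \<Longrightarrow> \<exists>f g. (Z', Y', X', f, g, Comp C X' (Sh C Y) (Sh C Z') (ShM C Y Z' i) j') \<in> Tri C \<and>
          Comp C Y Z' Y' f i = Comp C Y Z Y' k v \<and>
          Comp C Z' Y' (Sh C X) k' f = i' \<and>
          Comp C Z Y' X' g k = j \<and>
          Comp C Y' X' (Sh C Y) j' g = Comp C Y' (Sh C X) (Sh C Y) (ShM C X Y u) k'"

locale linear_triangulated_category = field K + triangulated_category C
  for K :: "('k, 'z) ring_scheme" and C :: "('o, 'm, 'k) lin_tricat" +
  assumes hom_module: "\<lbrakk>X \<in> Ob C; Y \<in> Ob C\<rbrakk> \<Longrightarrow> module K (Hom C X Y)"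
    and comp_smult_left: "\<lbrakk>X \<in> Ob C; Y \<in> Ob C; Z \<in> Ob C; r \<in> carrier K; f \<in> Mor C X Y; g \<in> Mor C Y Z\<rbrakk>
      \<Longrightarrow> Comp C X Y Z (r \<odot>\<^bsub>Hom C Y Z\<^esub> g) f = r \<odot>\<^bsub>Hom C X Z\<^esub> Comp C X Y Z g f"
    and comp_smult_right: "\<lbrakk>X \<in> Ob C; Y \<in> Ob C; Z \<in> Ob C; r \<in> carrier K; f \<in> Mor C X Y; g \<in> Mor C Y Z\<rbrakk>
      \<Longrightarrow> Comp C X Y Z g (r \<odot>\<^bsub>Hom C X Y\<^esub> f) = r \<odot>\<^bsub>Hom C X Z\<^esub> Comp C X Y Z g f"
    and shm_smult: "\<lbrakk>X \<in> Ob C; Y \<in> Ob C; r \<in> carrier K; f \<in> Mor C X Y\<rbrakk>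
      \<Longrightarrow> ShM C X Y (r \<odot>\<^bsub>Hom C X Y\<^esub> f) = r \<odot>\<^bsub>Hom C (Sh C X) (Sh C Y)\<^esub> ShM C X Y f"

definition ShI :: "('o, 'm, 'x) tricat \<Rightarrow> 'o \<Rightarrow> 'o"
  where "ShI C = inv_into (Ob C) (Sh C)"

text \<open>\<open>ShMI C X Y f : \<Sigma>\<^sup>-\<^sup>1X \<rightarrow> \<Sigma>\<^sup>-\<^sup>1Y\<close> for \<open>f : X \<rightarrow> Y\<close>.\<close>

definition ShMI :: "('o, 'm, 'x) tricat \<Rightarrow> 'o \<Rightarrow> 'o \<Rightarrow> 'm \<Rightarrow> 'm"
  where "ShMI C X Y = inv_into (Mor C (ShI C X) (ShI C Y)) (ShM C (ShI C X) (ShI C Y))"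

definition ShP :: "('o, 'm, 'x) tricat \<Rightarrow> int \<Rightarrow> 'o \<Rightarrow> 'o"
  where "ShP C j X = (if 0 \<le> j then (Sh C ^^ nat j) X else (ShI C ^^ nat (- j)) X)"


section \<open>Subcategories, t-structures, torsion classes, tilts, metrics\<close>

text \<open>
  A full subcategory is given by its set of objects. Subcategories are considered up to
  isomorphism of objects, so these sets are taken to be closed under isomorphism.
\<close>

definition full_subcategory :: "('o, 'm, 'x) tricat \<Rightarrow> 'o set \<Rightarrow> bool"
  where "full_subcategory C U \<longleftrightarrow> U \<subseteq> Ob C \<and> (\<forall>X\<in>U. \<forall>Y\<in>Ob C. isomorphic C X Y \<longrightarrow> Y \<in> U)"

definition star :: "('o, 'm, 'x) tricat \<Rightarrow> 'o set \<Rightarrow> 'o set \<Rightarrow> 'o set"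
  where "star C U V = {Z \<in> Ob C. \<exists>X\<in>U. \<exists>Y\<in>V. \<exists>u v w. (X, Z, Y, u, v, w) \<in> Tri C}"

definition perp :: "('o, 'm, 'x) tricat \<Rightarrow> 'o set \<Rightarrow> 'o set \<Rightarrow> 'o set"
  where "perp C U A = {Y \<in> A. \<forall>X\<in>U. hom_zero (Hom C X Y)}"

text \<open>\<open>shifted C U n\<close> is \<open>\<Sigma>\<^sup>-\<^sup>nU\<close>, so it yields \<open>T\<^sup>\<le>\<^sup>n\<close> from \<open>T\<^sup>\<le>\<^sup>0\<close> and \<open>T\<^sup>\<ge>\<^sup>n\<close> from \<open>T\<^sup>\<ge>\<^sup>0\<close>.\<close>

definition shifted :: "('o, 'm, 'x) tricat \<Rightarrow> 'o set \<Rightarrow> int \<Rightarrow> 'o set"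
  where "shifted C U n = ShP C (- n) ` U"

definition t_structure :: "('o, 'm, 'x) tricat \<Rightarrow> 'o set \<Rightarrow> 'o set \<Rightarrow> bool"
  where "t_structure C tle tge \<longleftrightarrow>
    full_subcategory C tle \<and> full_subcategory C tge \<and>
    shifted C tle (-1) \<subseteq> tle \<and> tge \<subseteq> shifted C tge (-1) \<and>
    (\<forall>X\<in>shifted C tle (-1). \<forall>Y\<in>tge. hom_zero (Hom C X Y)) \<and>
    Ob C = star C (shifted C tle (-1)) tge"

definition heart :: "'o set \<Rightarrow> 'o set \<Rightarrow> 'o set"
  where "heart tle tge = tle \<inter> tge"

text \<open>Kernels, cokernels and short exact sequences in the full subcategory on \<open>A\<close>.\<close>

definition is_kernel :: "('o, 'm, 'x) tricat \<Rightarrow> 'o set \<Rightarrow> 'o \<Rightarrow> 'o \<Rightarrow> 'o \<Rightarrow> 'm \<Rightarrow> 'm \<Rightarrow> bool"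
  where "is_kernel C A X Y Z f g \<longleftrightarrow>
    Comp C X Y Z g f = \<zero>\<^bsub>Hom C X Z\<^esub> \<and>
    (\<forall>W\<in>A. \<forall>h\<in>Mor C W Y. Comp C W Y Z g h = \<zero>\<^bsub>Hom C W Z\<^esub> \<longrightarrow>
      (\<exists>!h'. h' \<in> Mor C W X \<and> Comp C W X Y f h' = h))"

definition is_cokernel :: "('o, 'm, 'x) tricat \<Rightarrow> 'o set \<Rightarrow> 'o \<Rightarrow> 'o \<Rightarrow> 'o \<Rightarrow> 'm \<Rightarrow> 'm \<Rightarrow> bool"
  where "is_cokernel C A X Y Z f g \<longleftrightarrow>
    Comp C X Y Z g f = \<zero>\<^bsub>Hom C X Z\<^esub> \<and>
    (\<forall>W\<in>A. \<forall>h\<in>Mor C Y W. Comp C X Y W h f = \<zero>\<^bsub>Hom C X W\<^esub> \<longrightarrow>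
      (\<exists>!h'. h' \<in> Mor C Z W \<and> Comp C Y Z W h' g = h))"

definition short_exact :: "('o, 'm, 'x) tricat \<Rightarrow> 'o set \<Rightarrow> 'o \<Rightarrow> 'o \<Rightarrow> 'o \<Rightarrow> 'm \<Rightarrow> 'm \<Rightarrow> bool"
  where "short_exact C A X Y Z f g \<longleftrightarrow>
    X \<in> A \<and> Y \<in> A \<and> Z \<in> A \<and> f \<in> Mor C X Y \<and> g \<in> Mor C Y Z \<and>
    is_kernel C A X Y Z f g \<and> is_cokernel C A X Y Z f g"

definition torsion_class :: "('o, 'm, 'x) tricat \<Rightarrow> 'o set \<Rightarrow> 'o set \<Rightarrow> bool"
  where "torsion_class C A X \<longleftrightarrow>
    full_subcategory C X \<and> X \<subseteq> A \<and>
    (\<forall>a\<in>A. \<exists>x\<in>X. \<exists>y\<in>perp C X A. \<exists>f g. short_exact C A x a y f g)"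

definition good_metric :: "('o, 'm, 'x) tricat \<Rightarrow> (nat \<Rightarrow> 'o set) \<Rightarrow> bool"
  where "good_metric C B \<longleftrightarrow>
    (\<forall>n. full_subcategory C (B n) \<and> (\<exists>Z\<in>B n. zero_ob C Z) \<and> star C (B n) (B n) = B n \<and>
      ShI C ` B (Suc n) \<union> B (Suc n) \<union> Sh C ` B (Suc n) \<subseteq> B n)"

definition extendable :: "(nat \<Rightarrow> 'o set) \<Rightarrow> 'o set \<Rightarrow> bool"
  where "extendable B tle \<longleftrightarrow> (\<exists>n. B n \<subseteq> tle)"

definition tilt_le :: "('o, 'm, 'x) tricat \<Rightarrow> 'o set \<Rightarrow> 'o set \<Rightarrow> 'o set"
  where "tilt_le C tle X = star C (shifted C tle (-1)) X"

definition tilt_ge :: "('o, 'm, 'x) tricat \<Rightarrow> 'o set \<Rightarrow> 'o set \<Rightarrow> 'o set \<Rightarrow> 'o set"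
  where "tilt_ge C tle tge X = star C (Sh C ` perp C X (heart tle tge)) tge"


section \<open>Modules over a category\<close>

text \<open>
  Contravariant additive functors to abelian groups with elements in \<open>'g\<close>:
  for \<open>f : X \<rightarrow> Y\<close>, \<open>Fm F X Y f\<close> is the map \<open>F(Y) \<rightarrow> F(X)\<close>. The two extensionality clauses fix
  the values on irrelevant arguments, so that the shift is invertible on objects.
  The type \<open>'g\<close> plays the role of the universe of the groups: as soon as \<open>nat \<times> 'm\<close> injects into
  \<open>'g\<close>, every module that is a colimit of a sequence of representable ones has a copy with
  elements in \<open>'g\<close>.
\<close>

record ('o, 'm, 'g) cmod =
  Fo :: "'o \<Rightarrow> 'g ring"
  Fm :: "'o \<Rightarrow> 'o \<Rightarrow> 'm \<Rightarrow> 'g \<Rightarrow> 'g"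

definition Mods :: "('o, 'm, 'x) tricat \<Rightarrow> ('o, 'm, 'g) cmod set"
  where "Mods C = {F.
    (\<forall>X\<in>Ob C. abelian_group (Fo F X)) \<and>
    (\<forall>X\<in>Ob C. \<forall>Y\<in>Ob C. \<forall>f\<in>Mor C X Y. abelian_group_hom (Fo F Y) (Fo F X) (Fm F X Y f)) \<and>
    (\<forall>X\<in>Ob C. \<forall>x\<in>carrier (Fo F X). Fm F X X (Idm C X) x = x) \<and>
    (\<forall>X\<in>Ob C. \<forall>Y\<in>Ob C. \<forall>Z\<in>Ob C. \<forall>f\<in>Mor C X Y. \<forall>g\<in>Mor C Y Z. \<forall>x\<in>carrier (Fo F Z).
      Fm F X Z (Comp C X Y Z g f) x = Fm F X Y f (Fm F Y Z g x)) \<and>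
    (\<forall>X\<in>Ob C. \<forall>Y\<in>Ob C. \<forall>f\<in>Mor C X Y. \<forall>g\<in>Mor C X Y. \<forall>x\<in>carrier (Fo F Y).
      Fm F X Y (f \<oplus>\<^bsub>Hom C X Y\<^esub> g) x = Fm F X Y f x \<oplus>\<^bsub>Fo F X\<^esub> Fm F X Y g x) \<and>
    Fo F \<in> extensional (Ob C) \<and>
    (\<forall>X Y f. if X \<in> Ob C \<and> Y \<in> Ob C \<and> f \<in> Mor C X Y
      then Fm F X Y f \<in> extensional (carrier (Fo F Y)) else Fm F X Y f = undefined)}"

text \<open>
  Natural transformations. Source and target may take values in groups over different element
  types, which allows maps from representable functors (with elements in \<open>'m\<close>) to any module.
\<close>

definition NatTr :: "('o, 'm, 'x) tricat \<Rightarrow> ('o, 'm, 'g) cmod \<Rightarrow> ('o, 'm, 'h) cmod \<Rightarrow> ('o \<Rightarrow> 'g \<Rightarrow> 'h) set"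
  where "NatTr C F G = {\<eta> \<in> extensional (Ob C).
    (\<forall>X\<in>Ob C. \<eta> X \<in> extensional (carrier (Fo F X)) \<and> abelian_group_hom (Fo F X) (Fo G X) (\<eta> X)) \<and>
    (\<forall>X\<in>Ob C. \<forall>Y\<in>Ob C. \<forall>f\<in>Mor C X Y. \<forall>x\<in>carrier (Fo F Y).
      \<eta> X (Fm F X Y f x) = Fm G X Y f (\<eta> Y x))}"

definition NatHom :: "('o, 'm, 'x) tricat \<Rightarrow> ('o, 'm, 'g) cmod \<Rightarrow> ('o, 'm, 'h) cmod \<Rightarrow> ('o \<Rightarrow> 'g \<Rightarrow> 'h) ring"
  where "NatHom C F G =
    \<lparr>carrier = NatTr C F G, mult = undefined, one = undefined,
     zero = (\<lambda>X\<in>Ob C. \<lambda>x\<in>carrier (Fo F X). \<zero>\<^bsub>Fo G X\<^esub>),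
     add = (\<lambda>\<eta> \<theta>. \<lambda>X\<in>Ob C. \<lambda>x\<in>carrier (Fo F X). \<eta> X x \<oplus>\<^bsub>Fo G X\<^esub> \<theta> X x)\<rparr>"

definition NatComp :: "('o, 'm, 'x) tricat \<Rightarrow> ('o, 'm, 'g) cmod \<Rightarrow>
    ('o \<Rightarrow> 'h \<Rightarrow> 'i) \<Rightarrow> ('o \<Rightarrow> 'g \<Rightarrow> 'h) \<Rightarrow> ('o \<Rightarrow> 'g \<Rightarrow> 'i)"
  where "NatComp C F \<theta> \<eta> = (\<lambda>X\<in>Ob C. \<lambda>x\<in>carrier (Fo F X). \<theta> X (\<eta> X x))"

definition NatId :: "('o, 'm, 'x) tricat \<Rightarrow> ('o, 'm, 'g) cmod \<Rightarrow> ('o \<Rightarrow> 'g \<Rightarrow> 'g)"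
  where "NatId C F = (\<lambda>X\<in>Ob C. \<lambda>x\<in>carrier (Fo F X). x)"

definition mod_isomorphic :: "('o, 'm, 'x) tricat \<Rightarrow> ('o, 'm, 'g) cmod \<Rightarrow> ('o, 'm, 'h) cmod \<Rightarrow> bool"
  where "mod_isomorphic C F G \<longleftrightarrow>
    (\<exists>\<eta>\<in>NatTr C F G. \<exists>\<theta>\<in>NatTr C G F. NatComp C F \<theta> \<eta> = NatId C F \<and> NatComp C G \<eta> \<theta> = NatId C G)"

definition Yo :: "('o, 'm, 'x) tricat \<Rightarrow> 'o \<Rightarrow> ('o, 'm, 'm) cmod"
  where "Yo C T =
    \<lparr>Fo = (\<lambda>X\<in>Ob C. ring.truncate (Hom C X T)),
     Fm = (\<lambda>X Y f. if X \<in> Ob C \<and> Y \<in> Ob C \<and> f \<in> Mor C X Y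
       then (\<lambda>g\<in>Mor C Y T. Comp C X Y T g f) else undefined)\<rparr>"

definition YoM :: "('o, 'm, 'x) tricat \<Rightarrow> 'o \<Rightarrow> 'o \<Rightarrow> 'm \<Rightarrow> ('o \<Rightarrow> 'm \<Rightarrow> 'm)"
  where "YoM C T T' f = (\<lambda>X\<in>Ob C. \<lambda>g\<in>Mor C X T. Comp C X T T' f g)"

definition Yo_image :: "('o, 'm, 'x) tricat \<Rightarrow> 'o set \<Rightarrow> ('o, 'm, 'g) cmod set"
  where "Yo_image C U = {F \<in> Mods C. \<exists>T\<in>U. mod_isomorphic C F (Yo C T)}"

definition ModSh :: "('o, 'm, 'x) tricat \<Rightarrow> ('o, 'm, 'g) cmod \<Rightarrow> ('o, 'm, 'g) cmod"
  where "ModSh C F =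
    \<lparr>Fo = (\<lambda>X\<in>Ob C. Fo F (ShI C X)),
     Fm = (\<lambda>X Y f. if X \<in> Ob C \<and> Y \<in> Ob C \<and> f \<in> Mor C X Y
       then Fm F (ShI C X) (ShI C Y) (ShMI C X Y f) else undefined)\<rparr>"

definition NatSh :: "('o, 'm, 'x) tricat \<Rightarrow> ('o \<Rightarrow> 'g \<Rightarrow> 'h) \<Rightarrow> ('o \<Rightarrow> 'g \<Rightarrow> 'h)"
  where "NatSh C \<eta> = (\<lambda>X\<in>Ob C. \<eta> (ShI C X))"

text \<open>
  \<open>F\<close> with the cocone \<open>\<phi>\<close> is the colimit of the sequence \<open>D 0 \<rightarrow> D 1 \<rightarrow> \<dots>\<close> of modules, where
  \<open>d n : D n \<rightarrow> D (Suc n)\<close>.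
\<close>

definition cocone :: "('o, 'm, 'x) tricat \<Rightarrow> (nat \<Rightarrow> ('o, 'm, 'h) cmod) \<Rightarrow> (nat \<Rightarrow> 'o \<Rightarrow> 'h \<Rightarrow> 'h)
    \<Rightarrow> ('o, 'm, 'g) cmod \<Rightarrow> (nat \<Rightarrow> 'o \<Rightarrow> 'h \<Rightarrow> 'g) \<Rightarrow> bool"
  where "cocone C D d F \<phi> \<longleftrightarrow>
    (\<forall>n. \<phi> n \<in> NatTr C (D n) F \<and> NatComp C (D n) (\<phi> (Suc n)) (d n) = \<phi> n)"

definition is_colimit :: "('o, 'm, 'x) tricat \<Rightarrow> (nat \<Rightarrow> ('o, 'm, 'h) cmod) \<Rightarrow> (nat \<Rightarrow> 'o \<Rightarrow> 'h \<Rightarrow> 'h)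
    \<Rightarrow> ('o, 'm, 'g) cmod \<Rightarrow> (nat \<Rightarrow> 'o \<Rightarrow> 'h \<Rightarrow> 'g) \<Rightarrow> bool"
  where "is_colimit C D d F \<phi> \<longleftrightarrow>
    F \<in> Mods C \<and> cocone C D d F \<phi> \<and>
    (\<forall>G \<psi>. (G :: ('o, 'm, 'g) cmod) \<in> Mods C \<and> cocone C D d G \<psi> \<longrightarrow>
      (\<exists>!\<theta>. \<theta> \<in> NatTr C F G \<and> (\<forall>n. NatComp C (D n) \<theta> (\<phi> n) = \<psi> n)))"


section \<open>The completion\<close>

text \<open>
  A sequence \<open>X 0 \<rightarrow> X 1 \<rightarrow> \<dots>\<close> has maps \<open>f (Suc n) : X n \<rightarrow> X (Suc n)\<close>; the value \<open>f 0\<close> is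
  irrelevant. Cones are unique up to isomorphism, and the members of the metric are closed under
  isomorphism.
\<close>

definition cone_in :: "('o, 'm, 'x) tricat \<Rightarrow> 'o \<Rightarrow> 'o \<Rightarrow> 'm \<Rightarrow> 'o set \<Rightarrow> bool"
  where "cone_in C X Y f U \<longleftrightarrow> (\<exists>Z\<in>U. \<exists>g h. (X, Y, Z, f, g, h) \<in> Tri C)"

definition cauchy :: "('o, 'm, 'x) tricat \<Rightarrow> (nat \<Rightarrow> 'o set) \<Rightarrow> (nat \<Rightarrow> 'o) \<Rightarrow> (nat \<Rightarrow> 'm) \<Rightarrow> bool"
  where "cauchy C B X f \<longleftrightarrow>
    (\<forall>n. X n \<in> Ob C \<and> f (Suc n) \<in> Mor C (X n) (X (Suc n))) \<and>
    (\<forall>i\<ge>1. \<exists>n\<ge>1. \<forall>j\<ge>n. cone_in C (X (j - 1)) (X j) (f j) (B i))"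

definition Yo_colimit :: "('o, 'm, 'x) tricat \<Rightarrow> (nat \<Rightarrow> 'o) \<Rightarrow> (nat \<Rightarrow> 'm)
    \<Rightarrow> ('o, 'm, 'g) cmod \<Rightarrow> (nat \<Rightarrow> 'o \<Rightarrow> 'm \<Rightarrow> 'g) \<Rightarrow> bool"
  where "Yo_colimit C X f F \<phi> \<longleftrightarrow>
    is_colimit C (\<lambda>n. Yo C (X n)) (\<lambda>n. YoM C (X n) (X (Suc n)) (f (Suc n))) F \<phi>"

definition LL :: "('o, 'm, 'x) tricat \<Rightarrow> (nat \<Rightarrow> 'o set) \<Rightarrow> 'o set \<Rightarrow> ('o, 'm, 'g) cmod set"
  where "LL C B U = {F \<in> Mods C. \<exists>X f \<phi>. cauchy C B X f \<and> (\<forall>n. X n \<in> U) \<and> Yo_colimit C X f F \<phi>}"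

definition CC :: "('o, 'm, 'x) tricat \<Rightarrow> (nat \<Rightarrow> 'o set) \<Rightarrow> ('o, 'm, 'g) cmod set"
  where "CC C B = {F \<in> Mods C. \<forall>j :: int. \<exists>i. \<forall>b\<in>B i. hom_zero (NatHom C (Yo C (ShP C j b)) F)}"

definition GG :: "('o, 'm, 'x) tricat \<Rightarrow> (nat \<Rightarrow> 'o set) \<Rightarrow> 'o set \<Rightarrow> ('o, 'm, 'g) cmod set"
  where "GG C B U = LL C B U \<inter> CC C B"

definition cauchy_triangles :: "('o, 'm, 'x) tricat \<Rightarrow> (nat \<Rightarrow> 'o set) \<Rightarrow>
    (nat \<Rightarrow> 'o) \<Rightarrow> (nat \<Rightarrow> 'o) \<Rightarrow> (nat \<Rightarrow> 'o) \<Rightarrow> (nat \<Rightarrow> 'm) \<Rightarrow> (nat \<Rightarrow> 'm) \<Rightarrow> (nat \<Rightarrow> 'm) \<Rightarrow>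
    (nat \<Rightarrow> 'm) \<Rightarrow> (nat \<Rightarrow> 'm) \<Rightarrow> (nat \<Rightarrow> 'm) \<Rightarrow> bool"
  where "cauchy_triangles C B X Y Z a b c u v w \<longleftrightarrow>
    cauchy C B X a \<and> cauchy C B Y b \<and> cauchy C B Z c \<and>
    (\<forall>n. (X n, Y n, Z n, u n, v n, w n) \<in> Tri C) \<and>
    (\<forall>n. tri_morphism C (X n, Y n, Z n, u n, v n, w n)
       (X (Suc n), Y (Suc n), Z (Suc n), u (Suc n), v (Suc n), w (Suc n))
       (a (Suc n)) (b (Suc n)) (c (Suc n)))"

text \<open>
  For \<open>\<phi> : Y(T) \<rightarrow> F\<close>, this is \<open>\<Sigma>\<phi> : Y(\<Sigma>T) \<rightarrow> \<Sigma>F\<close>, where \<open>Y(\<Sigma>T)\<close> is identified with \<open>\<Sigma>Y(T)\<close> along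
  \<open>\<Sigma>\<^sup>-\<^sup>1 : Hom(X, \<Sigma>T) \<rightarrow> Hom(\<Sigma>\<^sup>-\<^sup>1X, T)\<close>.
\<close>

definition YoSh :: "('o, 'm, 'x) tricat \<Rightarrow> 'o \<Rightarrow> ('o \<Rightarrow> 'm \<Rightarrow> 'g) \<Rightarrow> ('o \<Rightarrow> 'm \<Rightarrow> 'g)"
  where "YoSh C T \<phi> = (\<lambda>X\<in>Ob C. \<lambda>g\<in>Mor C X (Sh C T). \<phi> (ShI C X) (ShMI C X (Sh C T) g))"

text \<open>
  The triangles of the completion. Colimits being determined only up to isomorphism, a sequence
  is isomorphic to the colimit of the Yoneda images of a Cauchy sequence of triangles iff it is
  itself such a colimit, for suitable colimit cocones \<open>\<phi>\<close>, \<open>\<psi>\<close>, \<open>\<chi>\<close> (and \<open>\<Sigma>\<phi>\<close> at the last term);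
  its maps are then the ones induced on colimits.
\<close>

definition GTri :: "('o, 'm, 'x) tricat \<Rightarrow> (nat \<Rightarrow> 'o set) \<Rightarrow>
    (('o, 'm, 'g) cmod \<times> ('o, 'm, 'g) cmod \<times> ('o, 'm, 'g) cmod \<times>
      ('o \<Rightarrow> 'g \<Rightarrow> 'g) \<times> ('o \<Rightarrow> 'g \<Rightarrow> 'g) \<times> ('o \<Rightarrow> 'g \<Rightarrow> 'g)) set"
  where "GTri C B = {(F, G, H, p, q, r).
    F \<in> GG C B (Ob C) \<and> G \<in> GG C B (Ob C) \<and> H \<in> GG C B (Ob C) \<and>
    p \<in> NatTr C F G \<and> q \<in> NatTr C G H \<and> r \<in> NatTr C H (ModSh C F) \<and>
    (\<exists>X Y Z a b c u v w \<phi> \<psi> \<chi>.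
      cauchy_triangles C B X Y Z a b c u v w \<and>
      Yo_colimit C X a F \<phi> \<and> Yo_colimit C Y b G \<psi> \<and> Yo_colimit C Z c H \<chi> \<and>
      (\<forall>n. NatComp C (Yo C (X n)) p (\<phi> n) = NatComp C (Yo C (X n)) (\<psi> n) (YoM C (X n) (Y n) (u n)) \<and>
           NatComp C (Yo C (Y n)) q (\<psi> n) = NatComp C (Yo C (Y n)) (\<chi> n) (YoM C (Y n) (Z n) (v n)) \<and>
           NatComp C (Yo C (Z n)) r (\<chi> n) =
             NatComp C (Yo C (Z n)) (YoSh C (X n) (\<phi> n)) (YoM C (Z n) (Sh C (X n)) (w n))))}"

definition completion :: "('o, 'm, 'x) tricat \<Rightarrow> (nat \<Rightarrow> 'o set) \<Rightarrow>
    (('o, 'm, 'g) cmod, 'o \<Rightarrow> 'g \<Rightarrow> 'g, unit) tricat"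
  where "completion C B =
    \<lparr>Ob = GG C B (Ob C), Hom = NatHom C, Comp = (\<lambda>F G H. NatComp C F), Idm = NatId C,
     Sh = ModSh C, ShM = (\<lambda>F G. NatSh C), Tri = GTri C B\<rparr>"

definition G_tilt_le :: "('o, 'm, 'x) tricat \<Rightarrow> (nat \<Rightarrow> 'o set) \<Rightarrow> 'o set \<Rightarrow> 'o set \<Rightarrow> ('o, 'm, 'g) cmod set"
  where "G_tilt_le C B tle X = star (completion C B) (GG C B (shifted C tle (-1))) (GG C B X)"

definition G_tilt_ge :: "('o, 'm, 'x) tricat \<Rightarrow> (nat \<Rightarrow> 'o set) \<Rightarrow> 'o set \<Rightarrow> 'o set \<Rightarrow> 'o set
    \<Rightarrow> ('o, 'm, 'g) cmod set"
  where "G_tilt_ge C B tle tge X =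
    star (completion C B)
      (Sh (completion C B) ` perp (completion C B) (GG C B X) (Yo_image C (heart tle tge)))
      (GG C B tge)"

end

theory Submission
  imports Defs
begin

text \<open>
  Write \<open>L\<close> for \<open>\<Sigma>T\<^sup>\<le>\<^sup>0 = T\<^sup>\<le>\<^sup>-\<^sup>1\<close>, \<open>R\<close> for \<open>T\<^sup>\<ge>\<^sup>0\<close> and \<open>X\<close> for the torsion class. Extendability forces
  the metric arbitrarily deep into the aisle: for every \<open>k\<close> some \<open>B n\<close> is contained in \<open>\<Sigma>\<^sup>kT\<^sup>\<le>\<^sup>0\<close>. Hence
  the cones of the late maps in a Cauchy sequence are invisible to truncation: the coaisle parts of the
  terms become constant, and the aisle parts have the same cones as the sequence itself, by an
  octahedron. So truncating a Cauchy sequence termwise gives a Cauchy sequence of triangles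
  (\<open>cauchy_truncation\<close>), and its colimit is a triangle of the completion. Since the defining
  triangles of objects of either tilt are truncation triangles, this proves that the completion of a
  tilt lies in the tilt of the completion.

  For the converse inclusions, a triangle \<open>A \<rightarrow> F \<rightarrow> D\<close> of the completion is a colimit of triangles
  \<open>P\<^sub>n \<rightarrow> Y\<^sub>n \<rightarrow> Z\<^sub>n\<close>, but the terms of \<open>P\<close> and \<open>Z\<close> need not lie in the subcategories that \<open>A\<close> and \<open>D\<close> come
  from; only some other sequences with colimits \<open>A\<close> and \<open>D\<close> have such terms. Two sequences with the same
  colimit are isomorphic as ind-objects (\<open>tr_factors\<close>), and this suffices in both cases.

  The tilted aisle is a left orthogonal of objects in \<open>R\<close> (\<open>in_tilt_le\<close>). A map from a late term \<open>P\<^sub>n\<close> to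
  an object of \<open>R\<close> extends to all later terms, so it factors through the other sequence
  (\<open>orth_late_terms\<close>). Thus the late \<open>P\<^sub>n\<close> and \<open>Z\<^sub>n\<close> are orthogonal to the required objects, then so are
  the \<open>Y\<^sub>n\<close>, and a tail of \<open>Y\<close> lies in the tilted aisle.

  For the tilted coaisle, \<open>F\<close> vanishes on \<open>\<Sigma>L\<close> and on \<open>\<Sigma>X\<close>, because \<open>A\<close> and \<open>D\<close> do. The first vanishing
  makes \<open>F\<close> representable by an object \<open>Q\<close> of \<open>\<Sigma>R\<close>, namely the coaisle part of any late \<open>Y\<^sub>n\<close>
  (\<open>represented_by_truncation\<close>); the second places \<open>Q\<close> in the tilted coaisle (\<open>in_tilt_ge\<close>).

  Colimits of modules are handled through elements. By the Yoneda lemma a cocone from a sequence of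
  representable functors to \<open>F\<close> is a compatible family of elements of \<open>F\<close>, and it is a colimit iff
  these elements generate \<open>F\<close> and are subject only to the relations that hold at some later stage
  (\<open>seq_colim\<close>). That every colimit in the sense of the universal property has this form follows by
  comparing it with an explicit module of germs, which exists because \<open>nat \<times> 'm\<close> embeds into the
  universe of the modules.
\<close>

section \<open>Additive categories with shift\<close>

context additive_category
begin

text \<open>
  The axioms constrain the morphisms between \<open>X\<close> and \<open>Y\<close> only if these are objects, so both
  conditions travel with a morphism.
\<close>

definition arr :: "'o \<Rightarrow> 'o \<Rightarrow> 'm \<Rightarrow> bool"
  where "arr X Y f \<longleftrightarrow> X \<in> Ob C \<and> Y \<in> Ob C \<and> f \<in> Mor C X Y"

definition orth :: "'o \<Rightarrow> 'o \<Rightarrow> bool"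
  where "orth X Y \<longleftrightarrow> X \<in> Ob C \<and> Y \<in> Ob C \<and> (\<forall>f. arr X Y f \<longrightarrow> f = \<zero>\<^bsub>Hom C X Y\<^esub>)"

lemma arrI: "\<lbrakk>X \<in> Ob C; Y \<in> Ob C; f \<in> Mor C X Y\<rbrakk> \<Longrightarrow> arr X Y f"
  by (simp add: arr_def)

lemma arrD: "arr X Y f \<Longrightarrow> X \<in> Ob C" "arr X Y f \<Longrightarrow> Y \<in> Ob C" "arr X Y f \<Longrightarrow> f \<in> Mor C X Y"
  by (simp_all add: arr_def)

lemma arr_id [simp]: "X \<in> Ob C \<Longrightarrow> arr X X (Idm C X)"
  by (simp add: arr_def id_in)

lemma arr_comp [simp]: "\<lbrakk>arr X Y f; arr Y Z g\<rbrakk> \<Longrightarrow> arr X Z (Comp C X Y Z g f)"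
  by (simp add: arr_def comp_in)

lemma arr_zero [simp]: "\<lbrakk>X \<in> Ob C; Y \<in> Ob C\<rbrakk> \<Longrightarrow> arr X Y \<zero>\<^bsub>Hom C X Y\<^esub>"
  by (simp add: arr_def abelian_group.a_group abelian_monoid.zero_closed abelian_group.axioms(1) hom_group)

lemma arr_add [simp]: "\<lbrakk>arr X Y f; arr X Y g\<rbrakk> \<Longrightarrow> arr X Y (f \<oplus>\<^bsub>Hom C X Y\<^esub> g)"
  by (simp add: arr_def abelian_monoid.a_closed abelian_group.axioms(1) hom_group)

lemma arr_neg [simp]: "arr X Y f \<Longrightarrow> arr X Y (\<ominus>\<^bsub>Hom C X Y\<^esub> f)"
  by (simp add: arr_def abelian_group.a_inv_closed hom_group)

lemma comp_idr [simp]: "arr X Y f \<Longrightarrow> Comp C X X Y f (Idm C X) = f"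
  by (simp add: arr_def comp_id_right)

lemma comp_idl [simp]: "arr X Y f \<Longrightarrow> Comp C X Y Y (Idm C Y) f = f"
  by (simp add: arr_def comp_id_left)

lemma comp_assoc': "\<lbrakk>arr W X f; arr X Y g; arr Y Z h\<rbrakk>
    \<Longrightarrow> Comp C W X Z (Comp C X Y Z h g) f = Comp C W Y Z h (Comp C W X Y g f)"
  by (simp add: arr_def comp_assoc)

lemma comp_zero_left [simp]:
  assumes "arr X Y f" "Z \<in> Ob C" shows "Comp C X Y Z \<zero>\<^bsub>Hom C Y Z\<^esub> f = \<zero>\<^bsub>Hom C X Z\<^esub>"
proof -
  interpret YZ: abelian_group "Hom C Y Z" using assms by (simp add: arr_def hom_group)
  interpret XZ: abelian_group "Hom C X Z" using assms by (simp add: arr_def hom_group)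
  have "Comp C X Y Z \<zero>\<^bsub>Hom C Y Z\<^esub> f \<in> Mor C X Z" using assms by (simp add: arr_def comp_in)
  moreover have "Comp C X Y Z \<zero>\<^bsub>Hom C Y Z\<^esub> f \<oplus>\<^bsub>Hom C X Z\<^esub> Comp C X Y Z \<zero>\<^bsub>Hom C Y Z\<^esub> f
      = Comp C X Y Z \<zero>\<^bsub>Hom C Y Z\<^esub> f"
    using comp_add_left[of X Y Z f "\<zero>\<^bsub>Hom C Y Z\<^esub>" "\<zero>\<^bsub>Hom C Y Z\<^esub>"] assms by (simp add: arr_def)
  ultimately show ?thesis by (simp add: XZ.add.l_cancel_one)
qed

lemma comp_zero_right [simp]:
  assumes "arr Y Z g" "X \<in> Ob C" shows "Comp C X Y Z g \<zero>\<^bsub>Hom C X Y\<^esub> = \<zero>\<^bsub>Hom C X Z\<^esub>"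
proof -
  interpret XY: abelian_group "Hom C X Y" using assms by (simp add: arr_def hom_group)
  interpret XZ: abelian_group "Hom C X Z" using assms by (simp add: arr_def hom_group)
  have "Comp C X Y Z g \<zero>\<^bsub>Hom C X Y\<^esub> \<in> Mor C X Z" using assms by (simp add: arr_def comp_in)
  moreover have "Comp C X Y Z g \<zero>\<^bsub>Hom C X Y\<^esub> \<oplus>\<^bsub>Hom C X Z\<^esub> Comp C X Y Z g \<zero>\<^bsub>Hom C X Y\<^esub>
      = Comp C X Y Z g \<zero>\<^bsub>Hom C X Y\<^esub>"
    using comp_add_right[of X Y Z "\<zero>\<^bsub>Hom C X Y\<^esub>" "\<zero>\<^bsub>Hom C X Y\<^esub>" g] assms by (simp add: arr_def)
  ultimately show ?thesis by (simp add: XZ.add.l_cancel_one)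
qed

lemma comp_neg_left:
  assumes "arr X Y f" "arr Y Z g"
  shows "Comp C X Y Z (\<ominus>\<^bsub>Hom C Y Z\<^esub> g) f = \<ominus>\<^bsub>Hom C X Z\<^esub> Comp C X Y Z g f"
proof -
  interpret YZ: abelian_group "Hom C Y Z" using assms by (simp add: arr_def hom_group)
  interpret XZ: abelian_group "Hom C X Z" using assms by (simp add: arr_def hom_group)
  have "Comp C X Y Z (\<ominus>\<^bsub>Hom C Y Z\<^esub> g) f \<oplus>\<^bsub>Hom C X Z\<^esub> Comp C X Y Z g f = \<zero>\<^bsub>Hom C X Z\<^esub>"
    using comp_add_left[of X Y Z f "\<ominus>\<^bsub>Hom C Y Z\<^esub> g" g] assms
    by (simp add: arr_def YZ.l_neg)
  moreover have "Comp C X Y Z (\<ominus>\<^bsub>Hom C Y Z\<^esub> g) f \<in> Mor C X Z" "Comp C X Y Z g f \<in> Mor C X Z"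
    using assms by (simp_all add: arr_def comp_in)
  ultimately show ?thesis by (metis XZ.minus_equality)
qed

lemma comp_neg_right:
  assumes "arr X Y f" "arr Y Z g"
  shows "Comp C X Y Z g (\<ominus>\<^bsub>Hom C X Y\<^esub> f) = \<ominus>\<^bsub>Hom C X Z\<^esub> Comp C X Y Z g f"
proof -
  interpret XY: abelian_group "Hom C X Y" using assms by (simp add: arr_def hom_group)
  interpret XZ: abelian_group "Hom C X Z" using assms by (simp add: arr_def hom_group)
  have "Comp C X Y Z g (\<ominus>\<^bsub>Hom C X Y\<^esub> f) \<oplus>\<^bsub>Hom C X Z\<^esub> Comp C X Y Z g f = \<zero>\<^bsub>Hom C X Z\<^esub>"
    using comp_add_right[of X Y Z "\<ominus>\<^bsub>Hom C X Y\<^esub> f" f g] assms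
    by (simp add: arr_def XY.l_neg)
  moreover have "Comp C X Y Z g (\<ominus>\<^bsub>Hom C X Y\<^esub> f) \<in> Mor C X Z" "Comp C X Y Z g f \<in> Mor C X Z"
    using assms by (simp_all add: arr_def comp_in)
  ultimately show ?thesis by (metis XZ.minus_equality)
qed

lemma neg_neg [simp]: "arr X Y f \<Longrightarrow> \<ominus>\<^bsub>Hom C X Y\<^esub> (\<ominus>\<^bsub>Hom C X Y\<^esub> f) = f"
  by (simp add: arr_def abelian_group.minus_minus hom_group)

lemma neg_eq_iff: "\<lbrakk>arr X Y f; arr X Y g\<rbrakk> \<Longrightarrow> \<ominus>\<^bsub>Hom C X Y\<^esub> f = \<ominus>\<^bsub>Hom C X Y\<^esub> g \<longleftrightarrow> f = g"
  by (metis neg_neg)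

lemma neg_zero [simp]: "\<lbrakk>X \<in> Ob C; Y \<in> Ob C\<rbrakk> \<Longrightarrow> \<ominus>\<^bsub>Hom C X Y\<^esub> \<zero>\<^bsub>Hom C X Y\<^esub> = \<zero>\<^bsub>Hom C X Y\<^esub>"
  by (metis abelian_group.l_neg abelian_group.a_inv_closed abelian_group.axioms(1) abelian_monoid.r_zero arrD(3) arr_zero hom_group)

lemma diff_eq_zero:
  assumes "arr X Y f" "arr X Y g" "f \<oplus>\<^bsub>Hom C X Y\<^esub> (\<ominus>\<^bsub>Hom C X Y\<^esub> g) = \<zero>\<^bsub>Hom C X Y\<^esub>"
  shows "f = g"
proof -
  interpret XY: abelian_group "Hom C X Y" using assms by (simp add: arr_def hom_group)
  show ?thesis using assms by (metis arrD(3) XY.a_inv_closed XY.minus_equality XY.minus_minus)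
qed

lemma diff_self: "arr X Y f \<Longrightarrow> f \<oplus>\<^bsub>Hom C X Y\<^esub> (\<ominus>\<^bsub>Hom C X Y\<^esub> f) = \<zero>\<^bsub>Hom C X Y\<^esub>"
  by (simp add: arr_def abelian_group.r_neg hom_group)

text \<open>Cancellation is reduced to maps killed by composition, by forming differences.\<close>

lemma eq_if_diff_zero_left:
  assumes f: "arr X Y f" and g: "arr Y Z g" "arr Y Z g'" and eq: "Comp C X Y Z g f = Comp C X Y Z g' f"
    and z: "\<And>d. \<lbrakk>arr Y Z d; Comp C X Y Z d f = \<zero>\<^bsub>Hom C X Z\<^esub>\<rbrakk> \<Longrightarrow> d = \<zero>\<^bsub>Hom C Y Z\<^esub>"
  shows "g = g'"
proof -
  let ?d = "g \<oplus>\<^bsub>Hom C Y Z\<^esub> (\<ominus>\<^bsub>Hom C Y Z\<^esub> g')"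
  have "Comp C X Y Z ?d f = Comp C X Y Z g f \<oplus>\<^bsub>Hom C X Z\<^esub> (\<ominus>\<^bsub>Hom C X Z\<^esub> Comp C X Y Z g' f)"
    using comp_add_left[of X Y Z f g "\<ominus>\<^bsub>Hom C Y Z\<^esub> g'"] comp_neg_left[OF f g(2)] f g arr_neg[OF g(2)]
    by (simp add: arr_def)
  also have "\<dots> = \<zero>\<^bsub>Hom C X Z\<^esub>" using eq diff_self f g(2) by simp
  finally have "?d = \<zero>\<^bsub>Hom C Y Z\<^esub>" using z g by simp
  then show ?thesis using diff_eq_zero g by blast
qed

lemma eq_if_diff_zero_right:
  assumes f: "arr Y Z f" and g: "arr X Y g" "arr X Y g'" and eq: "Comp C X Y Z f g = Comp C X Y Z f g'"
    and z: "\<And>d. \<lbrakk>arr X Y d; Comp C X Y Z f d = \<zero>\<^bsub>Hom C X Z\<^esub>\<rbrakk> \<Longrightarrow> d = \<zero>\<^bsub>Hom C X Y\<^esub>"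
  shows "g = g'"
proof -
  let ?d = "g \<oplus>\<^bsub>Hom C X Y\<^esub> (\<ominus>\<^bsub>Hom C X Y\<^esub> g')"
  have "Comp C X Y Z f ?d = Comp C X Y Z f g \<oplus>\<^bsub>Hom C X Z\<^esub> (\<ominus>\<^bsub>Hom C X Z\<^esub> Comp C X Y Z f g')"
    using comp_add_right[of X Y Z g "\<ominus>\<^bsub>Hom C X Y\<^esub> g'" f] comp_neg_right[OF g(2) f] f g arr_neg[OF g(2)]
    by (simp add: arr_def)
  also have "\<dots> = \<zero>\<^bsub>Hom C X Z\<^esub>" using eq diff_self f g(2) by simp
  finally have "?d = \<zero>\<^bsub>Hom C X Y\<^esub>" using z g by simp
  then show ?thesis using diff_eq_zero g by blast
qed

lemma orthD: "orth X Y \<Longrightarrow> arr X Y f \<Longrightarrow> f = \<zero>\<^bsub>Hom C X Y\<^esub>"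
  by (simp add: orth_def)

lemma orthI: "\<lbrakk>X \<in> Ob C; Y \<in> Ob C; \<And>f. arr X Y f \<Longrightarrow> f = \<zero>\<^bsub>Hom C X Y\<^esub>\<rbrakk> \<Longrightarrow> orth X Y"
  by (simp add: orth_def)

lemma orth_Ob: "orth X Y \<Longrightarrow> X \<in> Ob C" "orth X Y \<Longrightarrow> Y \<in> Ob C"
  by (simp_all add: orth_def)

lemma orth_iff_hom_zero: "\<lbrakk>X \<in> Ob C; Y \<in> Ob C\<rbrakk> \<Longrightarrow> orth X Y \<longleftrightarrow> hom_zero (Hom C X Y)"
  using arr_zero[of X Y] by (auto simp: orth_def hom_zero_def arr_def)

lemma zero_ob_iff: "zero_ob C Z \<longleftrightarrow> Z \<in> Ob C \<and> Idm C Z = \<zero>\<^bsub>Hom C Z Z\<^esub>"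
proof
  assume "zero_ob C Z"
  then show "Z \<in> Ob C \<and> Idm C Z = \<zero>\<^bsub>Hom C Z Z\<^esub>"
    by (auto simp: zero_ob_def hom_zero_def) (metis id_in singletonD)
next
  assume Z: "Z \<in> Ob C \<and> Idm C Z = \<zero>\<^bsub>Hom C Z Z\<^esub>"
  have "orth X Z \<and> orth Z X" if X: "X \<in> Ob C" for X
    using X Z by (metis orthI comp_idl comp_idr comp_zero_left comp_zero_right arrD)
  then show "zero_ob C Z" using Z by (simp add: zero_ob_def orth_iff_hom_zero[symmetric])
qed

lemma zero_ob_orth: "\<lbrakk>zero_ob C Z; X \<in> Ob C\<rbrakk> \<Longrightarrow> orth X Z" "\<lbrakk>zero_ob C Z; X \<in> Ob C\<rbrakk> \<Longrightarrow> orth Z X"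
  by (simp_all add: zero_ob_def orth_iff_hom_zero)

lemma zero_ob_Ob: "zero_ob C Z \<Longrightarrow> Z \<in> Ob C"
  by (simp add: zero_ob_def)

lemma is_isoI: "\<lbrakk>arr X Y f; arr Y X g; Comp C X Y X g f = Idm C X; Comp C Y X Y f g = Idm C Y\<rbrakk> \<Longrightarrow> is_iso C X Y f"
  by (auto simp: is_iso_def arr_def)

lemma is_isoE:
  assumes "is_iso C X Y f" "X \<in> Ob C" "Y \<in> Ob C"
  obtains g where "arr X Y f" "arr Y X g" "Comp C X Y X g f = Idm C X" "Comp C Y X Y f g = Idm C Y"
  using assms by (auto simp: is_iso_def arr_def)

lemma id_iso: "X \<in> Ob C \<Longrightarrow> is_iso C X X (Idm C X)"
  by (rule is_isoI[of _ _ _ "Idm C X"]) simp_all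

lemma neg_iso: "X \<in> Ob C \<Longrightarrow> is_iso C X X (\<ominus>\<^bsub>Hom C X X\<^esub> Idm C X)"
  by (rule is_isoI[of _ _ _ "\<ominus>\<^bsub>Hom C X X\<^esub> Idm C X"]) (simp_all add: comp_neg_left)

lemma full_subcategory_iso:
  "\<lbrakk>full_subcategory C U; X \<in> U; is_iso C X Y f; Y \<in> Ob C\<rbrakk> \<Longrightarrow> Y \<in> U"
  by (auto simp: full_subcategory_def isomorphic_def)

end

context category_with_shift
begin

lemma Sh_Ob [simp]: "X \<in> Ob C \<Longrightarrow> Sh C X \<in> Ob C"
  using sh_bij by (auto simp: bij_betw_def)

lemma ShI_Ob [simp]: "X \<in> Ob C \<Longrightarrow> ShI C X \<in> Ob C"
  unfolding ShI_def using sh_bij by (metis bij_betw_def inv_into_into)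

lemma Sh_ShI [simp]: "X \<in> Ob C \<Longrightarrow> Sh C (ShI C X) = X"
  unfolding ShI_def using sh_bij by (metis bij_betw_inv_into_right)

lemma ShI_Sh [simp]: "X \<in> Ob C \<Longrightarrow> ShI C (Sh C X) = X"
  unfolding ShI_def using sh_bij by (metis bij_betw_inv_into_left)

lemma arr_ShM [simp]: "arr X Y f \<Longrightarrow> arr (Sh C X) (Sh C Y) (ShM C X Y f)"
  using shm_bij[of X Y] by (auto simp: arr_def bij_betw_def)

lemma ShM_inj: "\<lbrakk>arr X Y f; arr X Y g; ShM C X Y f = ShM C X Y g\<rbrakk> \<Longrightarrow> f = g"
  using shm_bij[of X Y] by (auto simp: arr_def bij_betw_def inj_on_def)

lemma ShM_surj:
  assumes "arr (Sh C X) (Sh C Y) g" "X \<in> Ob C" "Y \<in> Ob C"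
  obtains f where "arr X Y f" "ShM C X Y f = g"
  using shm_bij[of X Y] assms that by (force simp: arr_def bij_betw_def image_iff)

lemma ShM_comp: "\<lbrakk>arr X Y f; arr Y Z g\<rbrakk>
    \<Longrightarrow> ShM C X Z (Comp C X Y Z g f) = Comp C (Sh C X) (Sh C Y) (Sh C Z) (ShM C Y Z g) (ShM C X Y f)"
  by (simp add: arr_def shm_comp)

lemma ShM_zero [simp]:
  assumes "X \<in> Ob C" "Y \<in> Ob C" shows "ShM C X Y \<zero>\<^bsub>Hom C X Y\<^esub> = \<zero>\<^bsub>Hom C (Sh C X) (Sh C Y)\<^esub>"
proof -
  interpret XY: abelian_group "Hom C X Y" using assms by (simp add: hom_group)
  interpret S: abelian_group "Hom C (Sh C X) (Sh C Y)" using assms by (simp add: hom_group)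
  have "ShM C X Y \<zero>\<^bsub>Hom C X Y\<^esub> \<in> Mor C (Sh C X) (Sh C Y)"
    using arr_ShM[OF arr_zero[OF assms]] by (simp add: arr_def)
  then show ?thesis using shm_add[OF assms, of "\<zero>\<^bsub>Hom C X Y\<^esub>" "\<zero>\<^bsub>Hom C X Y\<^esub>"]
    by (simp add: S.add.l_cancel_one)
qed

lemma arr_ShMI [simp]: "arr X Y f \<Longrightarrow> arr (ShI C X) (ShI C Y) (ShMI C X Y f)"
  unfolding ShMI_def using shm_bij[of "ShI C X" "ShI C Y"]
  by (auto simp: arr_def bij_betw_def) (metis inv_into_into)

lemma ShM_ShMI [simp]: "arr X Y f \<Longrightarrow> ShM C (ShI C X) (ShI C Y) (ShMI C X Y f) = f"
  unfolding ShMI_def using shm_bij[of "ShI C X" "ShI C Y"]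
  by (auto simp: arr_def bij_betw_def f_inv_into_f)

lemma ShMI_ShM [simp]: "arr X Y f \<Longrightarrow> ShMI C (Sh C X) (Sh C Y) (ShM C X Y f) = f"
  by (metis ShM_ShMI ShM_inj ShI_Sh arrD(1) arrD(2) arr_ShM arr_ShMI)

lemma ShMI_eqI: "\<lbrakk>arr X Y f; arr (ShI C X) (ShI C Y) g; ShM C (ShI C X) (ShI C Y) g = f\<rbrakk> \<Longrightarrow> ShMI C X Y f = g"
  by (metis ShM_ShMI ShM_inj arr_ShMI)

lemma ShMI_comp: "\<lbrakk>arr X Y f; arr Y Z g\<rbrakk>
    \<Longrightarrow> ShMI C X Z (Comp C X Y Z g f) = Comp C (ShI C X) (ShI C Y) (ShI C Z) (ShMI C Y Z g) (ShMI C X Y f)"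
  by (rule ShMI_eqI) (simp_all add: ShM_comp arrD)

lemma ShMI_id: "X \<in> Ob C \<Longrightarrow> ShMI C X X (Idm C X) = Idm C (ShI C X)"
  by (rule ShMI_eqI) (simp_all add: shm_id)

lemma ShMI_add: "\<lbrakk>arr X Y f; arr X Y g\<rbrakk>
    \<Longrightarrow> ShMI C X Y (f \<oplus>\<^bsub>Hom C X Y\<^esub> g) = ShMI C X Y f \<oplus>\<^bsub>Hom C (ShI C X) (ShI C Y)\<^esub> ShMI C X Y g"
  by (rule ShMI_eqI) (use shm_add[of "ShI C X" "ShI C Y"] in \<open>simp_all add: arrD(1,2) arr_ShMI[THEN arrD(3)]\<close>)

lemma orth_Sh_iff: "\<lbrakk>X \<in> Ob C; Y \<in> Ob C\<rbrakk> \<Longrightarrow> orth (Sh C X) (Sh C Y) \<longleftrightarrow> orth X Y"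
  by (smt (verit, ccfv_threshold) ShM_inj ShM_surj ShM_zero Sh_Ob arr_ShM arr_zero orth_def)

lemma zero_ob_Sh: "zero_ob C Z \<Longrightarrow> zero_ob C (Sh C Z)"
  by (metis ShM_zero Sh_Ob shm_id zero_ob_iff)

end

context category_with_shift
begin

lemma ShM_neg:
  assumes "arr X Y f" shows "ShM C X Y (\<ominus>\<^bsub>Hom C X Y\<^esub> f) = \<ominus>\<^bsub>Hom C (Sh C X) (Sh C Y)\<^esub> ShM C X Y f"
proof -
  have X: "X \<in> Ob C" "Y \<in> Ob C" using assms by (simp_all add: arr_def)
  interpret XY: abelian_group "Hom C X Y" using X by (simp add: hom_group)
  interpret S: abelian_group "Hom C (Sh C X) (Sh C Y)" using X by (simp add: hom_group)
  have "ShM C X Y (\<ominus>\<^bsub>Hom C X Y\<^esub> f) \<oplus>\<^bsub>Hom C (Sh C X) (Sh C Y)\<^esub> ShM C X Y f = \<zero>\<^bsub>Hom C (Sh C X) (Sh C Y)\<^esub>"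
    using shm_add[OF X, of "\<ominus>\<^bsub>Hom C X Y\<^esub> f" f] assms X by (simp add: arr_def XY.l_neg)
  then show ?thesis
    using arr_ShM[OF arr_neg[OF assms]] arr_ShM[OF assms] by (metis arrD(3) S.minus_equality)
qed

end

section \<open>Exactness and cones in triangulated categories\<close>

context triangulated_category
begin

lemma tri_arr:
  assumes "(X, Y, Z, u, v, w) \<in> Tri C"
  shows "arr X Y u" "arr Y Z v" "arr Z (Sh C X) w"
  using tri_wf[OF assms] by (simp_all add: arr_def)

lemma tri_Ob:
  assumes "(X, Y, Z, u, v, w) \<in> Tri C"
  shows "X \<in> Ob C" "Y \<in> Ob C" "Z \<in> Ob C"
  using tri_wf[OF assms] by simp_all

lemma tri_rot:
  assumes "(X, Y, Z, u, v, w) \<in> Tri C"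
  shows "(Y, Z, Sh C X, v, w, \<ominus>\<^bsub>Hom C (Sh C X) (Sh C Y)\<^esub> ShM C X Y u) \<in> Tri C"
  using tri_rotate[of X Y Z u v w] tri_wf[OF assms] assms by simp

lemma tri_unrot:
  assumes "arr X Y u" "(Y, Z, Sh C X, v, w, \<ominus>\<^bsub>Hom C (Sh C X) (Sh C Y)\<^esub> ShM C X Y u) \<in> Tri C"
  shows "(X, Y, Z, u, v, w) \<in> Tri C"
  using tri_rotate[of X Y Z u v w] tri_wf[OF assms(2)] assms by (simp add: arr_def)

text \<open>
  Inverse rotation. The sign that rotation introduces is absorbed into \<open>e\<close>, so \<open>u\<close> and \<open>v\<close> are unchanged.
\<close>

lemma tri_back:
  assumes t: "(X, Y, Z, u, v, w) \<in> Tri C"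
  obtains e where "arr (ShI C Z) X e" "(ShI C Z, X, Y, e, u, v) \<in> Tri C"
proof -
  note a = tri_arr[OF t] and o = tri_Ob[OF t]
  have "arr (Sh C (ShI C Z)) (Sh C X) (\<ominus>\<^bsub>Hom C Z (Sh C X)\<^esub> w)" using a o by simp
  then obtain e where e: "arr (ShI C Z) X e" "ShM C (ShI C Z) X e = \<ominus>\<^bsub>Hom C Z (Sh C X)\<^esub> w"
    using ShM_surj[of "ShI C Z" X "\<ominus>\<^bsub>Hom C Z (Sh C X)\<^esub> w"] o by auto
  have "(ShI C Z, X, Y, e, u, v) \<in> Tri C"
    by (rule tri_unrot[OF e(1)]) (use t o a e in simp)
  with e(1) show ?thesis by (rule that)
qed

lemma tri_zero_left:
  assumes "zero_ob C N" "S \<in> Ob C"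
  shows "(N, S, S, \<zero>\<^bsub>Hom C N S\<^esub>, Idm C S, \<zero>\<^bsub>Hom C S (Sh C N)\<^esub>) \<in> Tri C"
proof (rule tri_unrot)
  have N: "N \<in> Ob C" by (rule zero_ob_Ob[OF assms(1)])
  show "arr N S \<zero>\<^bsub>Hom C N S\<^esub>" using N assms(2) by simp
  show "(S, S, Sh C N, Idm C S, \<zero>\<^bsub>Hom C S (Sh C N)\<^esub>,
      \<ominus>\<^bsub>Hom C (Sh C N) (Sh C S)\<^esub> ShM C N S \<zero>\<^bsub>Hom C N S\<^esub>) \<in> Tri C"
    using tri_id[OF assms(2) zero_ob_Sh[OF assms(1)]] N assms(2) by simp
qed

text \<open>
  Completing the square formed by \<open>g\<close> and \<open>0 \<rightarrow> Z\<close> to a map from the triangle \<open>S \<rightarrow> 0 \<rightarrow> \<Sigma>S\<close> into the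
  rotated one produces \<open>\<Sigma>h\<close>.
\<close>

lemma factor_fiber:
  assumes t: "(X, Y, Z, u, v, w) \<in> Tri C" and g: "arr S Y g" "Comp C S Y Z v g = \<zero>\<^bsub>Hom C S Z\<^esub>"
  obtains h where "arr S X h" "Comp C S X Y u h = g"
proof -
  note a = tri_arr[OF t] and o = tri_Ob[OF t]
  have S: "S \<in> Ob C" using g by (simp add: arr_def)
  obtain N where N: "zero_ob C N" using ex_zero_ob by blast
  note N' = zero_ob_Ob[OF N]
  note t1 = tri_rot[OF tri_id[OF S N]]
  obtain c where c: "tri_morphism C
      (S, N, Sh C S, \<zero>\<^bsub>Hom C S N\<^esub>, \<zero>\<^bsub>Hom C N (Sh C S)\<^esub>, \<ominus>\<^bsub>Hom C (Sh C S) (Sh C S)\<^esub> ShM C S S (Idm C S))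
      (Y, Z, Sh C X, v, w, \<ominus>\<^bsub>Hom C (Sh C X) (Sh C Y)\<^esub> ShM C X Y u) g \<zero>\<^bsub>Hom C N Z\<^esub> c"
    using tri_complete[OF t1 tri_rot[OF t], of g "\<zero>\<^bsub>Hom C N Z\<^esub>"] g a o N' S
    by (auto simp: arrD(3)[OF g(1)] arrD(3)[OF arr_zero])
  then have ca: "arr (Sh C S) (Sh C X) c"
    using S o by (auto simp: tri_morphism_def arr_def)
  then obtain h where h: "arr S X h" "ShM C S X h = c" using ShM_surj S o by blast
  have "Comp C (Sh C S) (Sh C S) (Sh C Y) (ShM C S Y g) (\<ominus>\<^bsub>Hom C (Sh C S) (Sh C S)\<^esub> ShM C S S (Idm C S)) =
     Comp C (Sh C S) (Sh C X) (Sh C Y) (\<ominus>\<^bsub>Hom C (Sh C X) (Sh C Y)\<^esub> ShM C X Y u) c"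
    using c by (simp add: tri_morphism_def)
  then have "\<ominus>\<^bsub>Hom C (Sh C S) (Sh C Y)\<^esub> ShM C S Y g
      = \<ominus>\<^bsub>Hom C (Sh C S) (Sh C Y)\<^esub> Comp C (Sh C S) (Sh C X) (Sh C Y) (ShM C X Y u) c"
    using g(1) S a(1) ca comp_neg_right[of "Sh C S" "Sh C S" "Idm C (Sh C S)" "Sh C Y" "ShM C S Y g"]
      comp_neg_left[of "Sh C S" "Sh C X" c "Sh C Y" "ShM C X Y u"] by (simp add: shm_id)
  then have "ShM C S Y g = Comp C (Sh C S) (Sh C X) (Sh C Y) (ShM C X Y u) c"
    using neg_eq_iff arr_ShM g(1) a(1) ca arr_comp by metis
  also have "\<dots> = ShM C S Y (Comp C S X Y u h)" using h a(1) by (simp add: ShM_comp)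
  finally have "Comp C S X Y u h = g" using ShM_inj g(1) h(1) a(1) arr_comp by metis
  with h(1) show ?thesis by (rule that)
qed

text \<open>
  Completing \<open>X \<rightarrow> 0\<close> and \<open>g\<close> to a map into the triangle \<open>0 \<rightarrow> S = S\<close> produces \<open>h\<close>.
\<close>

lemma factor_cone:
  assumes t: "(X, Y, Z, u, v, w) \<in> Tri C" and g: "arr Y S g" "Comp C X Y S g u = \<zero>\<^bsub>Hom C X S\<^esub>"
  obtains h where "arr Z S h" "Comp C Y Z S h v = g"
proof -
  note a = tri_arr[OF t] and o = tri_Ob[OF t]
  have S: "S \<in> Ob C" using g by (simp add: arr_def)
  obtain N where N: "zero_ob C N" using ex_zero_ob by blast
  note N' = zero_ob_Ob[OF N]
  obtain c where "tri_morphism C (X, Y, Z, u, v, w)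
      (N, S, S, \<zero>\<^bsub>Hom C N S\<^esub>, Idm C S, \<zero>\<^bsub>Hom C S (Sh C N)\<^esub>) \<zero>\<^bsub>Hom C X N\<^esub> g c"
    using tri_complete[OF t tri_zero_left[OF N S], of "\<zero>\<^bsub>Hom C X N\<^esub>" g] g a o N' S
    by (auto simp: arrD(3)[OF g(1)] arrD(3)[OF arr_zero])
  then have "arr Z S c" "Comp C Y Z S c v = g"
    using S o g by (auto simp: tri_morphism_def arr_def comp_id_left)
  then show ?thesis by (rule that)
qed

text \<open>
  Orthogonality spreads along triangles by exactness of the Hom functors; at the fibre \<open>X\<close> the third
  term enters as \<open>\<Sigma>\<^sup>-\<^sup>1Z\<close>.
\<close>

lemma orth_mid_right:
  assumes t: "(X, Y, Z, u, v, w) \<in> Tri C" and o: "orth S X" "orth S Z" shows "orth S Y"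
proof (rule orthI)
  note a = tri_arr[OF t]
  fix g assume g: "arr S Y g"
  have "Comp C S Y Z v g = \<zero>\<^bsub>Hom C S Z\<^esub>" using orthD[OF o(2)] a g by simp
  then obtain h where h: "arr S X h" "Comp C S X Y u h = g" using factor_fiber[OF t g] by blast
  then show "g = \<zero>\<^bsub>Hom C S Y\<^esub>" using orthD[OF o(1) h(1)] a h by (simp add: orth_Ob[OF o(1)])
qed (use o tri_Ob[OF t] in \<open>auto dest: orth_Ob\<close>)

lemma orth_mid_left:
  assumes t: "(X, Y, Z, u, v, w) \<in> Tri C" and o: "orth X S" "orth Z S" shows "orth Y S"
proof (rule orthI)
  note a = tri_arr[OF t]
  fix g assume g: "arr Y S g"
  have "Comp C X Y S g u = \<zero>\<^bsub>Hom C X S\<^esub>" using orthD[OF o(1)] a g by simp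
  then obtain h where h: "arr Z S h" "Comp C Y Z S h v = g" using factor_cone[OF t g] by blast
  then show "g = \<zero>\<^bsub>Hom C Y S\<^esub>" using orthD[OF o(2) h(1)] a h by (simp add: orth_Ob[OF o(1)])
qed (use o tri_Ob[OF t] in \<open>auto dest: orth_Ob\<close>)

lemmas orth_cone_left = orth_mid_left[OF tri_rot]

lemma orth_ShI_right: "orth (Sh C S) Z \<Longrightarrow> S \<in> Ob C \<Longrightarrow> orth S (ShI C Z)"
  by (metis orth_Ob(2) orth_Sh_iff Sh_ShI ShI_Ob)

lemma orth_ShI_left: "orth Z (Sh C S) \<Longrightarrow> S \<in> Ob C \<Longrightarrow> orth (ShI C Z) S"
  by (metis orth_Ob(1) orth_Sh_iff Sh_ShI ShI_Ob)

lemma orth_fiber_right: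
  assumes t: "(X, Y, Z, u, v, w) \<in> Tri C" and o: "orth S Y" "orth (Sh C S) Z" shows "orth S X"
proof -
  obtain e where "(ShI C Z, X, Y, e, u, v) \<in> Tri C" using tri_back[OF t] .
  then show ?thesis using orth_mid_right orth_ShI_right o by (metis orth_Ob(1))
qed

text \<open>
  Two maps that agree on \<open>X\<close> differ by a map that factors through \<open>Z\<close>. The two variants below are
  the same argument at the other places of the triangle.
\<close>

lemma cancel_first:
  assumes t: "(X, Y, Z, u, v, w) \<in> Tri C" and g: "arr Y S g" "arr Y S g'"
    and eq: "Comp C X Y S g u = Comp C X Y S g' u" and o: "orth Z S"
  shows "g = g'"
proof (rule eq_if_diff_zero_left[OF tri_arr(1)[OF t] g eq])
  fix d assume d: "arr Y S d" "Comp C X Y S d u = \<zero>\<^bsub>Hom C X S\<^esub>"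
  obtain h where h: "arr Z S h" "Comp C Y Z S h v = d" using factor_cone[OF t d] .
  then show "d = \<zero>\<^bsub>Hom C Y S\<^esub>" using orthD[OF o h(1)] orth_Ob[OF o] tri_arr[OF t] by simp
qed

lemmas cancel_second = cancel_first[OF tri_rot]

lemma cancel_fiber:
  assumes t: "(X, Y, Z, u, v, w) \<in> Tri C" and g: "arr S X g" "arr S X g'"
    and eq: "Comp C S X Y u g = Comp C S X Y u g'" and o: "orth (Sh C S) Z"
  shows "g = g'"
proof (rule eq_if_diff_zero_right[OF tri_arr(1)[OF t] g eq])
  fix d assume d: "arr S X d" "Comp C S X Y u d = \<zero>\<^bsub>Hom C S Y\<^esub>"
  have S: "S \<in> Ob C" using g by (simp add: arr_def)
  obtain e where e: "arr (ShI C Z) X e" "(ShI C Z, X, Y, e, u, v) \<in> Tri C" using tri_back[OF t] .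
  obtain h where h: "arr S (ShI C Z) h" "Comp C S (ShI C Z) X e h = d"
    using factor_fiber[OF e(2) d] .
  then show "d = \<zero>\<^bsub>Hom C S X\<^esub>" using orthD[OF orth_ShI_right[OF o S] h(1)] S e by simp
qed

text \<open>
  The obstruction to extending \<open>g\<close> is its composite with \<open>\<Sigma>\<^sup>-\<^sup>1Z \<rightarrow> X\<close>.
\<close>

lemma extend_first:
  assumes t: "(X, Y, Z, u, v, w) \<in> Tri C" and g: "arr X S g" and o: "orth Z (Sh C S)"
  obtains h where "arr Y S h" "Comp C X Y S h u = g"
proof -
  have S: "S \<in> Ob C" using g by (simp add: arr_def)
  obtain e where e: "arr (ShI C Z) X e" "(ShI C Z, X, Y, e, u, v) \<in> Tri C" using tri_back[OF t] .
  have "Comp C (ShI C Z) X S g e = \<zero>\<^bsub>Hom C (ShI C Z) S\<^esub>"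
    using orthD[OF orth_ShI_left[OF o S]] e g by simp
  then show ?thesis using factor_cone[OF e(2) g] that by blast
qed

lemma iso_if_cone_zero:
  assumes t: "(X, Y, Z, u, v, w) \<in> Tri C" and z: "zero_ob C Z" shows "is_iso C X Y u"
proof -
  note a = tri_arr[OF t] and o = tri_Ob[OF t]
  have "Comp C Y Y Z v (Idm C Y) = \<zero>\<^bsub>Hom C Y Z\<^esub>"
    using zero_ob_orth(1)[OF z o(2)] orthD a o by simp
  then obtain h where h: "arr Y X h" "Comp C Y X Y u h = Idm C Y"
    using factor_fiber[OF t arr_id[OF o(2)]] by blast
  have "Comp C X X Y u (Comp C X Y X h u) = Comp C X X Y u (Idm C X)"
    using comp_assoc'[OF a(1) h(1) a(1)] h a by simp
  then have "Comp C X Y X h u = Idm C X"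
    using cancel_fiber[OF t _ _ _ zero_ob_orth(1)[OF z Sh_Ob[OF o(1)]]] h a o by simp
  with h a show ?thesis by (blast intro: is_isoI)
qed

lemma iso_if_fiber_zero:
  assumes t: "(X, Y, Z, u, v, w) \<in> Tri C" and z: "zero_ob C X" shows "is_iso C Y Z v"
proof -
  note a = tri_arr[OF t] and o = tri_Ob[OF t]
  have "Comp C X Y Y (Idm C Y) u = \<zero>\<^bsub>Hom C X Y\<^esub>"
    using zero_ob_orth(2)[OF z o(2)] orthD a o by simp
  then obtain h where h: "arr Z Y h" "Comp C Y Z Y h v = Idm C Y"
    using factor_cone[OF t arr_id[OF o(2)]] by blast
  have "Comp C Y Z Z (Comp C Z Y Z v h) v = Comp C Y Z Z (Idm C Z) v"
    using comp_assoc'[OF a(2) h(1) a(2)] h a by simp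
  then have "Comp C Z Y Z v h = Idm C Z"
    using cancel_second[OF t _ _ _ zero_ob_orth(2)[OF zero_ob_Sh[OF z] o(3)]] h a o by simp
  with h a show ?thesis by (blast intro: is_isoI)
qed

text \<open>
  A morphism of triangles whose third component is invertible has isomorphic cones in its first
  two places: this is the octahedron over \<open>Y \<rightarrow> Y' \<rightarrow> V'\<close>.
\<close>

lemma cone_of_first_component:
  assumes t: "(Y, Y', D, z, j, k) \<in> Tri C"
    and t1: "(U, Y, V, u, v, w) \<in> Tri C" and t2: "(U', Y', V', u', v', w') \<in> Tri C"
    and m: "tri_morphism C (U, Y, V, u, v, w) (U', Y', V', u', v', w') a z c"
    and iso: "is_iso C V V' c" and o: "orth (Sh C U) V'"
  obtains p q where "(U, U', D, a, p, q) \<in> Tri C"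
proof -
  note A = tri_arr[OF t] tri_arr[OF t1] tri_arr[OF t2] and N = tri_Ob[OF t] tri_Ob[OF t1] tri_Ob[OF t2]
  obtain d where d: "arr V V' c" "arr V' V d" "Comp C V V' V d c = Idm C V" "Comp C V' V V' c d = Idm C V'"
    using is_isoE[OF iso] N by metis
  have a: "arr U U' a" and az: "Comp C U Y Y' z u = Comp C U U' Y' u' a"
    and cz: "Comp C Y V V' c v = Comp C Y Y' V' v' z"
    using m N by (auto simp: tri_morphism_def arr_def)
  let ?nu = "\<ominus>\<^bsub>Hom C (Sh C U) (Sh C Y)\<^esub> ShM C U Y u"
  let ?nu' = "\<ominus>\<^bsub>Hom C (Sh C U') (Sh C Y')\<^esub> ShM C U' Y' u'"
  have wd: "arr V' (Sh C U) (Comp C V' V (Sh C U) w d)" using d A by simp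
  \<comment> \<open>the rotated truncation triangle of \<open>Y\<close>, carried along \<open>c\<close>, has the composite \<open>Y \<rightarrow> Y' \<rightarrow> V'\<close> as its first map\<close>
  have t3: "(Y, V', Sh C U, Comp C Y Y' V' v' z, Comp C V' V (Sh C U) w d, ?nu) \<in> Tri C"
  proof (rule tri_iso[OF tri_rot[OF t1], of Y V' "Sh C U" _ _ _ "Idm C Y" c "Idm C (Sh C U)"])
    show "tri_morphism C (Y, V, Sh C U, v, w, ?nu)
       (Y, V', Sh C U, Comp C Y Y' V' v' z, Comp C V' V (Sh C U) w d, ?nu) (Idm C Y) c (Idm C (Sh C U))"
      using A N d cz wd comp_assoc'[OF d(1) d(2) A(6)]
      by (auto simp: tri_morphism_def id_in arrD(3) shm_id)
  qed (use A N wd iso in \<open>auto simp: id_iso arrD(3)\<close>)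
  obtain f g where fg: "(D, Sh C U, Sh C U', f, g,
        Comp C (Sh C U') (Sh C Y') (Sh C D) (ShM C Y' D j) ?nu') \<in> Tri C"
      "Comp C (Sh C U) (Sh C U') (Sh C Y') ?nu' g = Comp C (Sh C U) (Sh C Y) (Sh C Y') (ShM C Y Y' z) ?nu"
    using tri_octahedral[OF t tri_rot[OF t2] t3] by blast
  have g: "arr (Sh C U) (Sh C U') g" using tri_arr[OF fg(1)] by simp
  obtain g' where g': "arr U U' g'" "ShM C U U' g' = g" using ShM_surj[OF g] N by blast
  have "\<ominus>\<^bsub>Hom C (Sh C U) (Sh C Y')\<^esub> ShM C U Y' (Comp C U U' Y' u' g')
      = \<ominus>\<^bsub>Hom C (Sh C U) (Sh C Y')\<^esub> ShM C U Y' (Comp C U Y Y' z u)"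
    using fg(2) g g' A comp_neg_left[OF g arr_ShM[OF A(7)]]
      comp_neg_right[OF arr_ShM[OF A(4)] arr_ShM[OF A(1)]] by (simp add: ShM_comp)
  then have "ShM C U Y' (Comp C U U' Y' u' g') = ShM C U Y' (Comp C U Y Y' z u)"
    using g' A by (metis neg_eq_iff arr_ShM arr_comp)
  then have "Comp C U U' Y' u' g' = Comp C U U' Y' u' a"
    using az g' A ShM_inj by (metis arr_comp)
  \<comment> \<open>the octahedron only provides some map \<open>U \<rightarrow> U'\<close> over \<open>z\<close>, but such a map is unique\<close>
  then have "g' = a" using cancel_fiber[OF t2 g'(1) a _ o] by simp
  with g' fg have h: "(D, Sh C U, Sh C U', f, ShM C U U' a,
      Comp C (Sh C U') (Sh C Y') (Sh C D) (ShM C Y' D j) ?nu') \<in> Tri C" by simp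
  let ?h = "Comp C (Sh C U') (Sh C Y') (Sh C D) (ShM C Y' D j) ?nu'"
  note H = tri_arr[OF h]
  obtain p where p: "arr U' D p" "ShM C U' D p = \<ominus>\<^bsub>Hom C (Sh C U') (Sh C D)\<^esub> ?h"
    using ShM_surj[OF arr_neg[OF H(3)]] N by blast
  \<comment> \<open>rotating back to \<open>U \<rightarrow> U' \<rightarrow> D\<close> changes the sign of \<open>a\<close>, which the automorphism \<open>-1\<close> of \<open>U'\<close> undoes\<close>
  have h1: "(U', D, Sh C U, p, f, ShM C U U' a) \<in> Tri C"
    by (rule tri_unrot[OF p(1)]) (use h p H in simp)
  have h2: "(U, U', D, \<ominus>\<^bsub>Hom C U U'\<^esub> a, p, f) \<in> Tri C"
    by (rule tri_unrot) (use h1 a arr_ShM[OF a] ShM_neg[OF a] in simp_all)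
  have "(U, U', D, a, \<ominus>\<^bsub>Hom C U' D\<^esub> p, f) \<in> Tri C"
  proof (rule tri_iso[OF h2, of U U' D _ _ _ "Idm C U" "\<ominus>\<^bsub>Hom C U' U'\<^esub> Idm C U'" "Idm C D"])
    show "tri_morphism C (U, U', D, \<ominus>\<^bsub>Hom C U U'\<^esub> a, p, f) (U, U', D, a, \<ominus>\<^bsub>Hom C U' D\<^esub> p, f)
     (Idm C U) (\<ominus>\<^bsub>Hom C U' U'\<^esub> Idm C U') (Idm C D)"
      using a p H N arr_neg[OF p(1)] arr_neg[OF arr_id[OF N(7)]]
      by (auto simp: tri_morphism_def id_in arrD(3) shm_id comp_neg_left comp_neg_right)
  qed (use a p H N arr_neg[OF p(1)] in \<open>auto simp: id_iso neg_iso arrD(3)\<close>)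
  then show ?thesis by (rule that)
qed

text \<open>
  Here \<open>V\<close> and \<open>V'\<close> are the coaisle parts of \<open>Y\<close> and \<open>Y'\<close>. The map \<open>Y \<rightarrow> V\<close> extends over \<open>Y'\<close> because the
  cone of \<open>z\<close> is orthogonal to \<open>\<Sigma>V\<close>, and the extension factors through \<open>V'\<close>, giving an inverse of \<open>c\<close>.
\<close>

lemma truncation_iso:
  assumes t: "(Y, Y', D, z, j, k) \<in> Tri C"
    and t1: "(U, Y, V, u, v, w) \<in> Tri C" and t2: "(U', Y', V', u', v', w') \<in> Tri C"
    and m: "tri_morphism C (U, Y, V, u, v, w) (U', Y', V', u', v', w') a z c"
    and o: "orth D (Sh C V)" "orth D V'" "orth U' V" "orth (Sh C U) V" "orth (Sh C U') V'"
  shows "is_iso C V V' c"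
proof -
  note A = tri_arr[OF t] tri_arr[OF t1] tri_arr[OF t2] and N = tri_Ob[OF t] tri_Ob[OF t1] tri_Ob[OF t2]
  have c: "arr V V' c" and cz: "Comp C Y V V' c v = Comp C Y Y' V' v' z"
    using m N by (auto simp: tri_morphism_def arr_def)
  obtain e where e: "arr Y' V e" "Comp C Y Y' V e z = v" using extend_first[OF t A(5) o(1)] .
  have "Comp C U' Y' V e u' = \<zero>\<^bsub>Hom C U' V\<^esub>" using orthD[OF o(3)] e A by simp
  then obtain d where d: "arr V' V d" "Comp C Y' V' V d v' = e" using factor_cone[OF t2 e(1)] by blast
  have "Comp C Y V V (Comp C V V' V d c) v = Comp C Y V V (Idm C V) v"
    using comp_assoc'[OF A(5) c d(1)] comp_assoc'[OF A(1) A(8) d(1)] cz d e A by simp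
  then have 1: "Comp C V V' V d c = Idm C V"
    using cancel_second[OF t1 _ _ _ o(4)] c d N by simp
  have "Comp C Y Y' V' (Comp C Y' V V' c e) z = Comp C Y Y' V' v' z"
    using comp_assoc'[OF A(1) e(1) c] e cz by simp
  then have "Comp C Y' V V' c e = v'" using cancel_first[OF t _ _ _ o(2)] e c A by simp
  then have "Comp C Y' V' V' (Comp C V' V V' c d) v' = Comp C Y' V' V' (Idm C V') v'"
    using comp_assoc'[OF A(8) d(1) c] d A by simp
  then have "Comp C V' V V' c d = Idm C V'"
    using cancel_second[OF t2 _ _ _ o(5)] c d N by simp
  with 1 c d show ?thesis by (blast intro: is_isoI)
qed

lemma truncation_morphism:
  assumes t1: "(U, Y, V, u, v, w) \<in> Tri C" and t2: "(U', Y', V', u', v', w') \<in> Tri C"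
    and z: "arr Y Y' z" and o: "orth U V'"
  obtains a c where "tri_morphism C (U, Y, V, u, v, w) (U', Y', V', u', v', w') a z c"
proof -
  note A = tri_arr[OF t1] tri_arr[OF t2]
  have "Comp C U Y' V' v' (Comp C U Y Y' z u) = \<zero>\<^bsub>Hom C U V'\<^esub>"
    using orthD[OF o] A z by simp
  then obtain a where a: "arr U U' a" "Comp C U U' Y' u' a = Comp C U Y Y' z u"
    using factor_fiber[OF t2 arr_comp[OF A(1) z]] by blast
  then show ?thesis using tri_complete[OF t1 t2, of a z] z that by (auto simp: arrD(3))
qed

end

section \<open>Modules and the Yoneda lemma\<close>

abbreviation El :: "('o, 'm, 'g) cmod \<Rightarrow> 'o \<Rightarrow> 'g set"
  where "El F X \<equiv> carrier (Fo F X)"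

lemma abelian_group_hom_iff:
  "abelian_group_hom G H h \<longleftrightarrow> abelian_group G \<and> abelian_group H \<and> h \<in> carrier G \<rightarrow> carrier H \<and>
    (\<forall>x\<in>carrier G. \<forall>y\<in>carrier G. h (x \<oplus>\<^bsub>G\<^esub> y) = h x \<oplus>\<^bsub>H\<^esub> h y)"
  (is "?l \<longleftrightarrow> ?r")
proof
  assume ?l
  then interpret abelian_group_hom G H h .
  show ?r using G.abelian_group_axioms H.abelian_group_axioms by auto
next
  assume r: ?r
  then show ?l
    by (intro abelian_group_homI)
       (auto simp: group_hom_def group_hom_axioms_def hom_def abelian_group.a_group Pi_iff)
qed

lemma truncate_sel [simp]:
  "carrier (ring.truncate R) = carrier R" "add (ring.truncate R) = add R" "zero (ring.truncate R) = zero R"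
  by (simp_all add: ring.truncate_def)

lemma abelian_group_truncate:
  assumes "abelian_group R" shows "abelian_group (ring.truncate R)"
proof -
  interpret abelian_group R by fact
  show ?thesis by (rule abelian_groupI) (auto simp: a_ac intro: l_neg a_inv_closed)
qed

lemma NatHom_sel [simp]:
  "carrier (NatHom C F G) = NatTr C F G"
  "\<zero>\<^bsub>NatHom C F G\<^esub> = (\<lambda>X\<in>Ob C. \<lambda>x\<in>El F X. \<zero>\<^bsub>Fo G X\<^esub>)"
  by (simp_all add: NatHom_def)

context additive_category
begin

lemma Mods_group:
  assumes "F \<in> Mods C" "X \<in> Ob C" shows "abelian_group (Fo F X)"
proof -
  have "\<forall>X\<in>Ob C. abelian_group (Fo F X)" using assms(1) unfolding Mods_def mem_Collect_eq by (rule conjunct1)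
  then show ?thesis using assms(2) by (rule bspec)
qed

lemma act_hom:
  assumes "F \<in> Mods C" "arr X Y f" shows "abelian_group_hom (Fo F Y) (Fo F X) (Fm F X Y f)"
proof -
  have "\<forall>X\<in>Ob C. \<forall>Y\<in>Ob C. \<forall>f\<in>Mor C X Y. abelian_group_hom (Fo F Y) (Fo F X) (Fm F X Y f)"
    using assms(1) unfolding Mods_def mem_Collect_eq by (elim conjE)
  then show ?thesis using assms(2) unfolding arr_def by blast
qed

lemma act_in: "\<lbrakk>F \<in> Mods C; arr X Y f; y \<in> El F Y\<rbrakk> \<Longrightarrow> Fm F X Y f y \<in> El F X"
  by (rule abelian_group_hom.hom_closed[OF act_hom])

lemma act_add: "\<lbrakk>F \<in> Mods C; arr X Y f; y \<in> El F Y; z \<in> El F Y\<rbrakk>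
    \<Longrightarrow> Fm F X Y f (y \<oplus>\<^bsub>Fo F Y\<^esub> z) = Fm F X Y f y \<oplus>\<^bsub>Fo F X\<^esub> Fm F X Y f z"
  by (rule abelian_group_hom.hom_add[OF act_hom])

lemma act_zero [simp]: "\<lbrakk>F \<in> Mods C; arr X Y f\<rbrakk> \<Longrightarrow> Fm F X Y f \<zero>\<^bsub>Fo F Y\<^esub> = \<zero>\<^bsub>Fo F X\<^esub>"
  by (rule abelian_group_hom.hom_zero[OF act_hom])

lemma zero_in [simp]: "\<lbrakk>F \<in> Mods C; X \<in> Ob C\<rbrakk> \<Longrightarrow> \<zero>\<^bsub>Fo F X\<^esub> \<in> El F X"
  using Mods_group abelian_group.axioms(1) abelian_monoid.zero_closed by blast

lemma act_id [simp]: "\<lbrakk>F \<in> Mods C; X \<in> Ob C; x \<in> El F X\<rbrakk> \<Longrightarrow> Fm F X X (Idm C X) x = x"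
  unfolding Mods_def mem_Collect_eq by (elim conjE) (drule (1) bspec, drule (1) bspec, blast)

lemma act_comp: "\<lbrakk>F \<in> Mods C; arr X Y f; arr Y Z g; z \<in> El F Z\<rbrakk>
    \<Longrightarrow> Fm F X Z (Comp C X Y Z g f) z = Fm F X Y f (Fm F Y Z g z)"
  unfolding Mods_def arr_def by blast

lemma act_add_arr: "\<lbrakk>F \<in> Mods C; arr X Y f; arr X Y g; y \<in> El F Y\<rbrakk>
    \<Longrightarrow> Fm F X Y (f \<oplus>\<^bsub>Hom C X Y\<^esub> g) y = Fm F X Y f y \<oplus>\<^bsub>Fo F X\<^esub> Fm F X Y g y"
  unfolding Mods_def arr_def by blast

lemma act_zero_arr [simp]:
  assumes "F \<in> Mods C" "X \<in> Ob C" "Y \<in> Ob C" "y \<in> El F Y"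
  shows "Fm F X Y \<zero>\<^bsub>Hom C X Y\<^esub> y = \<zero>\<^bsub>Fo F X\<^esub>"
proof -
  interpret X: abelian_group "Fo F X" using assms Mods_group by blast
  interpret XY: abelian_group "Hom C X Y" using assms hom_group by blast
  have "Fm F X Y \<zero>\<^bsub>Hom C X Y\<^esub> y \<oplus>\<^bsub>Fo F X\<^esub> Fm F X Y \<zero>\<^bsub>Hom C X Y\<^esub> y = Fm F X Y \<zero>\<^bsub>Hom C X Y\<^esub> y"
    using act_add_arr[of F X Y "\<zero>\<^bsub>Hom C X Y\<^esub>" "\<zero>\<^bsub>Hom C X Y\<^esub>" y] assms by simp
  then show ?thesis using act_in[OF assms(1) arr_zero[OF assms(2,3)] assms(4)]
    by (simp add: X.add.l_cancel_one)
qed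

lemma Nat_hom: "\<lbrakk>\<eta> \<in> NatTr C F G; X \<in> Ob C\<rbrakk> \<Longrightarrow> abelian_group_hom (Fo F X) (Fo G X) (\<eta> X)"
  unfolding NatTr_def by blast

lemma Nat_in: "\<lbrakk>\<eta> \<in> NatTr C F G; X \<in> Ob C; x \<in> El F X\<rbrakk> \<Longrightarrow> \<eta> X x \<in> El G X"
  by (rule abelian_group_hom.hom_closed[OF Nat_hom])

lemma Nat_act: "\<lbrakk>\<eta> \<in> NatTr C F G; arr X Y f; y \<in> El F Y\<rbrakk> \<Longrightarrow> \<eta> X (Fm F X Y f y) = Fm G X Y f (\<eta> Y y)"
  unfolding NatTr_def arr_def by blast

lemma Nat_add: "\<lbrakk>\<eta> \<in> NatTr C F G; X \<in> Ob C; x \<in> El F X; y \<in> El F X\<rbrakk>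
    \<Longrightarrow> \<eta> X (x \<oplus>\<^bsub>Fo F X\<^esub> y) = \<eta> X x \<oplus>\<^bsub>Fo G X\<^esub> \<eta> X y"
  by (rule abelian_group_hom.hom_add[OF Nat_hom])

lemma Nat_zero: "\<lbrakk>\<eta> \<in> NatTr C F G; X \<in> Ob C\<rbrakk> \<Longrightarrow> \<eta> X \<zero>\<^bsub>Fo F X\<^esub> = \<zero>\<^bsub>Fo G X\<^esub>"
  by (rule abelian_group_hom.hom_zero[OF Nat_hom])

lemma Nat_eqI:
  assumes "\<eta> \<in> NatTr C F G" "\<theta> \<in> NatTr C F G" "\<And>X x. \<lbrakk>X \<in> Ob C; x \<in> El F X\<rbrakk> \<Longrightarrow> \<eta> X x = \<theta> X x"
  shows "\<eta> = \<theta>"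
proof (rule extensionalityI[of _ "Ob C"])
  fix X assume X: "X \<in> Ob C"
  show "\<eta> X = \<theta> X"
    by (rule extensionalityI[of _ "El F X"]) (use assms X in \<open>auto simp: NatTr_def\<close>)
qed (use assms in \<open>auto simp: NatTr_def\<close>)

lemma NatTrI:
  assumes "\<And>X. X \<in> Ob C \<Longrightarrow> abelian_group (Fo F X)" "\<And>X. X \<in> Ob C \<Longrightarrow> abelian_group (Fo G X)"
    and "\<And>X x. \<lbrakk>X \<in> Ob C; x \<in> El F X\<rbrakk> \<Longrightarrow> h X x \<in> El G X"
    and "\<And>X x y. \<lbrakk>X \<in> Ob C; x \<in> El F X; y \<in> El F X\<rbrakk>
      \<Longrightarrow> h X (x \<oplus>\<^bsub>Fo F X\<^esub> y) = h X x \<oplus>\<^bsub>Fo G X\<^esub> h X y"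
    and "\<And>X Y f y. \<lbrakk>arr X Y f; y \<in> El F Y; Fm F X Y f y \<in> El F X\<rbrakk> \<Longrightarrow> h X (Fm F X Y f y) = Fm G X Y f (h Y y)"
    and "\<And>X Y f y. \<lbrakk>arr X Y f; y \<in> El F Y\<rbrakk> \<Longrightarrow> Fm F X Y f y \<in> El F X"
  shows "(\<lambda>X\<in>Ob C. \<lambda>x\<in>El F X. h X x) \<in> NatTr C F G"
proof -
  have "abelian_group_hom (Fo F X) (Fo G X) (\<lambda>x\<in>El F X. h X x)" if X: "X \<in> Ob C" for X
    unfolding abelian_group_hom_iff using X assms(1-4) abelian_monoid.a_closed[OF abelian_group.axioms(1)[OF assms(1)[OF X]]]
    by simp
  then show ?thesis using assms(5,6) by (simp add: NatTr_def arr_def)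
qed

lemma NatComp_in:
  assumes "\<eta> \<in> NatTr C F G" "\<theta> \<in> NatTr C G H" "F \<in> Mods C"
  shows "NatComp C F \<theta> \<eta> \<in> NatTr C F H"
  unfolding NatComp_def
proof (rule NatTrI)
  fix X assume X: "X \<in> Ob C"
  show "abelian_group (Fo F X)" using assms X Mods_group by blast
  show "abelian_group (Fo H X)" using assms(2) X unfolding NatTr_def abelian_group_hom_def by blast
next
  fix X Y f y assume "arr X Y f" "y \<in> El F Y"
  then show "Fm F X Y f y \<in> El F X" by (rule act_in[OF assms(3)])
  then show "\<theta> X (\<eta> X (Fm F X Y f y)) = Fm H X Y f (\<theta> Y (\<eta> Y y))"
    using assms \<open>arr X Y f\<close> \<open>y \<in> El F Y\<close> by (simp add: Nat_act Nat_in arrD(2))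
qed (use assms in \<open>simp_all add: Nat_in Nat_add\<close>)

lemma NatId_in: "F \<in> Mods C \<Longrightarrow> NatId C F \<in> NatTr C F F"
  unfolding NatId_def by (rule NatTrI) (auto simp: Mods_group act_in)

lemma NatComp_apply [simp]: "\<lbrakk>X \<in> Ob C; x \<in> El F X\<rbrakk> \<Longrightarrow> NatComp C F \<theta> \<eta> X x = \<theta> X (\<eta> X x)"
  by (simp add: NatComp_def)

lemma NatId_apply [simp]: "\<lbrakk>X \<in> Ob C; x \<in> El F X\<rbrakk> \<Longrightarrow> NatId C F X x = x"
  by (simp add: NatId_def)

lemma Yo_sel [simp]:
  "X \<in> Ob C \<Longrightarrow> El (Yo C T) X = Mor C X T"
  "X \<in> Ob C \<Longrightarrow> add (Fo (Yo C T) X) = add (Hom C X T)"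
  "X \<in> Ob C \<Longrightarrow> \<zero>\<^bsub>Fo (Yo C T) X\<^esub> = \<zero>\<^bsub>Hom C X T\<^esub>"
  "arr X Y f \<Longrightarrow> g \<in> Mor C Y T \<Longrightarrow> Fm (Yo C T) X Y f g = Comp C X Y T g f"
  by (simp_all add: Yo_def arr_def)

lemma Yo_group: "\<lbrakk>X \<in> Ob C; T \<in> Ob C\<rbrakk> \<Longrightarrow> abelian_group (Fo (Yo C T) X)"
  by (simp add: Yo_def abelian_group_truncate hom_group)

text \<open>The map out of a representable functor that corresponds to an element, by Yoneda.\<close>

definition yon :: "('o, 'm, 'g) cmod \<Rightarrow> 'o \<Rightarrow> 'g \<Rightarrow> 'o \<Rightarrow> 'm \<Rightarrow> 'g"
  where "yon F T \<xi> = (\<lambda>S\<in>Ob C. \<lambda>g\<in>Mor C S T. Fm F S T g \<xi>)"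

lemma yon_apply [simp]: "arr S T g \<Longrightarrow> yon F T \<xi> S g = Fm F S T g \<xi>"
  by (simp add: yon_def arr_def)

lemma yon_in:
  assumes "F \<in> Mods C" "T \<in> Ob C" "\<xi> \<in> El F T" shows "yon F T \<xi> \<in> NatTr C (Yo C T) F"
proof -
  have "(\<lambda>S\<in>Ob C. \<lambda>g\<in>El (Yo C T) S. Fm F S T g \<xi>) \<in> NatTr C (Yo C T) F"
  proof (rule NatTrI)
    fix X Y f y assume f: "arr X Y f" and y: "y \<in> El (Yo C T) Y"
    then have y': "arr Y T y" using assms by (simp add: arr_def)
    show "Fm (Yo C T) X Y f y \<in> El (Yo C T) X"
      using f y' arr_comp[OF f y'] by (simp add: arr_def)
    show "Fm F X T (Fm (Yo C T) X Y f y) \<xi> = Fm F X Y f (Fm F Y T y \<xi>)"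
      using f y' act_comp[OF assms(1) f y' assms(3)] by (simp add: arrD(3)[OF y'])
  next
    fix X x assume "X \<in> Ob C" "x \<in> El (Yo C T) X"
    then show "Fm F X T x \<xi> \<in> El F X" using assms by (intro act_in) (simp_all add: arr_def)
  next
    fix X x y assume X: "X \<in> Ob C" "x \<in> El (Yo C T) X" "y \<in> El (Yo C T) X"
    then show "Fm F X T (x \<oplus>\<^bsub>Fo (Yo C T) X\<^esub> y) \<xi> = Fm F X T x \<xi> \<oplus>\<^bsub>Fo F X\<^esub> Fm F X T y \<xi>"
      using act_add_arr[of F X T x y \<xi>] assms by (simp add: arr_def)
  qed (use assms Mods_group Yo_group in auto)
  moreover have "(\<lambda>S\<in>Ob C. \<lambda>g\<in>El (Yo C T) S. Fm F S T g \<xi>) = yon F T \<xi>"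
    unfolding yon_def by (auto simp: restrict_def fun_eq_iff)
  ultimately show ?thesis by simp
qed

lemma Yoneda:
  assumes "F \<in> Mods C" "T \<in> Ob C" "\<phi> \<in> NatTr C (Yo C T) F"
  shows "\<phi> T (Idm C T) \<in> El F T" "\<phi> = yon F T (\<phi> T (Idm C T))"
proof -
  show i: "\<phi> T (Idm C T) \<in> El F T" using Nat_in[OF assms(3,2)] assms(2) by (simp add: id_in)
  show "\<phi> = yon F T (\<phi> T (Idm C T))"
  proof (rule Nat_eqI[OF assms(3) yon_in[OF assms(1,2) i]])
    fix X x assume X: "X \<in> Ob C" "x \<in> El (Yo C T) X"
    then have x: "arr X T x" using assms by (simp add: arr_def)
    show "\<phi> X x = yon F T (\<phi> T (Idm C T)) X x"
      using Nat_act[OF assms(3) x, of "Idm C T"] x assms(2) by (simp add: id_in)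
  qed
qed

lemma yon_id [simp]: "\<lbrakk>F \<in> Mods C; T \<in> Ob C; \<xi> \<in> El F T\<rbrakk> \<Longrightarrow> yon F T \<xi> T (Idm C T) = \<xi>"
  by simp

lemma yon_eq_iff:
  "\<lbrakk>F \<in> Mods C; T \<in> Ob C; \<xi> \<in> El F T; \<zeta> \<in> El F T\<rbrakk> \<Longrightarrow> yon F T \<xi> = yon F T \<zeta> \<longleftrightarrow> \<xi> = \<zeta>"
  by (metis yon_id)

lemma NatComp_yon:
  assumes "F \<in> Mods C" "T \<in> Ob C" "\<xi> \<in> El F T" "\<eta> \<in> NatTr C F G"
  shows "NatComp C (Yo C T) \<eta> (yon F T \<xi>) = yon G T (\<eta> T \<xi>)"
  unfolding NatComp_def yon_def
proof (intro restrict_ext)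
  fix X assume X: "X \<in> Ob C"
  show "(\<lambda>x\<in>El (Yo C T) X. \<eta> X ((\<lambda>S\<in>Ob C. \<lambda>g\<in>Mor C S T. Fm F S T g \<xi>) X x)) = (\<lambda>g\<in>Mor C X T. Fm G X T g (\<eta> T \<xi>))"
    using X assms by (auto simp: restrict_def fun_eq_iff Nat_act arr_def)
qed

lemma NatComp_yon_YoM:
  assumes "F \<in> Mods C" "arr S T f" "\<xi> \<in> El F T"
  shows "NatComp C (Yo C S) (yon F T \<xi>) (YoM C S T f) = yon F S (Fm F S T f \<xi>)"
proof -
  have "yon F T \<xi> X (YoM C S T f X x) = Fm F X S x (Fm F S T f \<xi>)" if "X \<in> Ob C" "x \<in> Mor C X S" for X x
  proof -
    have "arr X S x" using that assms by (simp add: arr_def)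
    then show ?thesis using that assms by (simp add: YoM_def act_comp)
  qed
  then show ?thesis unfolding NatComp_def yon_def[of F S]
    by (auto simp: restrict_def fun_eq_iff)
qed

lemma hom_zero_Yo:
  assumes "F \<in> Mods C" "T \<in> Ob C"
  shows "hom_zero (NatHom C (Yo C T) F) \<longleftrightarrow> El F T = {\<zero>\<^bsub>Fo F T\<^esub>}"
proof -
  have z: "\<zero>\<^bsub>NatHom C (Yo C T) F\<^esub> = yon F T \<zero>\<^bsub>Fo F T\<^esub>"
    unfolding NatHom_sel yon_def using assms by (auto simp: restrict_def fun_eq_iff arrI)
  show ?thesis
  proof
    assume h: "hom_zero (NatHom C (Yo C T) F)"
    then have "yon F T y = yon F T \<zero>\<^bsub>Fo F T\<^esub>" if "y \<in> El F T" for y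
      using yon_in[OF assms that] z by (auto simp: hom_zero_def)
    then show "El F T = {\<zero>\<^bsub>Fo F T\<^esub>}" using assms by (auto simp: yon_eq_iff)
  next
    assume e: "El F T = {\<zero>\<^bsub>Fo F T\<^esub>}"
    then have "\<phi> = yon F T \<zero>\<^bsub>Fo F T\<^esub>" if "\<phi> \<in> NatTr C (Yo C T) F" for \<phi>
      using Yoneda[OF assms that] by (metis singletonD)
    then have "NatTr C (Yo C T) F = {yon F T \<zero>\<^bsub>Fo F T\<^esub>}"
      using yon_in[OF assms zero_in[OF assms]] by blast
    then show "hom_zero (NatHom C (Yo C T) F)"
      by (simp only: hom_zero_def z NatHom_sel(1))
  qed
qed

section \<open>Sequential colimits of representable modules\<close>

text \<open>
  The indices follow the convention for Cauchy sequences: \<open>f (Suc n)\<close> is the map that leaves \<open>X n\<close>.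
\<close>

definition seq :: "(nat \<Rightarrow> 'o) \<Rightarrow> (nat \<Rightarrow> 'm) \<Rightarrow> bool"
  where "seq X f \<longleftrightarrow> (\<forall>n. arr (X n) (X (Suc n)) (f (Suc n)))"

text \<open>
  The transition map \<open>X n \<rightarrow> X m\<close>; the values for \<open>n > m\<close> are arbitrary.
\<close>

primrec tr :: "(nat \<Rightarrow> 'o) \<Rightarrow> (nat \<Rightarrow> 'm) \<Rightarrow> nat \<Rightarrow> nat \<Rightarrow> 'm"
  where "tr X f n 0 = Idm C (X 0)"
  | "tr X f n (Suc m) = (if n \<le> m then Comp C (X n) (X m) (X (Suc m)) (f (Suc m)) (tr X f n m) else Idm C (X (Suc m)))"

abbreviation push :: "(nat \<Rightarrow> 'o) \<Rightarrow> (nat \<Rightarrow> 'm) \<Rightarrow> 'o \<Rightarrow> nat \<Rightarrow> nat \<Rightarrow> 'm \<Rightarrow> 'm"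
  where "push X f S n m g \<equiv> Comp C S (X n) (X m) (tr X f n m) g"

lemma seq_arr: "seq X f \<Longrightarrow> arr (X n) (X (Suc n)) (f (Suc n))" and seq_Ob: "seq X f \<Longrightarrow> X n \<in> Ob C"
  by (auto simp: seq_def arr_def)

lemma tr_refl [simp]: "tr X f n n = Idm C (X n)"
  by (cases n) simp_all

lemma tr_Suc: "n \<le> m \<Longrightarrow> tr X f n (Suc m) = Comp C (X n) (X m) (X (Suc m)) (f (Suc m)) (tr X f n m)"
  by simp

declare tr.simps [simp del]

lemma tr_arr [simp]: "seq X f \<Longrightarrow> n \<le> m \<Longrightarrow> arr (X n) (X m) (tr X f n m)"
proof (induction m)
  case (Suc m)
  then show ?case
    by (cases "n = Suc m") (auto simp: seq_Ob tr_Suc intro!: arr_comp[of _ "X m"] seq_arr)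
qed (simp add: seq_Ob)

lemma tr_comp:
  assumes s: "seq X f" and "n \<le> m" "m \<le> k"
  shows "push X f (X n) m k (tr X f n m) = tr X f n k"
  using assms(3)
proof (induction k rule: dec_induct)
  case base
  then show ?case using tr_arr[OF s assms(2)] by simp
next
  case (step k)
  then show ?case
    using comp_assoc'[OF tr_arr[OF s assms(2)] tr_arr[OF s step(1)] seq_arr[OF s]] assms(2)
    by (simp add: tr_Suc)
qed

lemma tr_push:
  assumes s: "seq X f" and "n \<le> m" "m \<le> k" and "arr S (X n) g"
  shows "push X f S m k (push X f S n m g) = push X f S n k g"
  using assms tr_comp[OF s assms(2,3)] comp_assoc'[OF assms(4) tr_arr[OF s assms(2)] tr_arr[OF s assms(3)]]
  by simp

text \<open>
  The colimit of the representable functors \<open>Y(X n)\<close>, described by elements: by Yoneda, a cocone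
  is a compatible family of elements \<open>\<xi> n \<in> F(X n)\<close>, and filtered colimits of abelian groups are
  characterised by generation and eventual equality.
\<close>

definition seq_colim :: "(nat \<Rightarrow> 'o) \<Rightarrow> (nat \<Rightarrow> 'm) \<Rightarrow> ('o, 'm, 'g) cmod \<Rightarrow> (nat \<Rightarrow> 'g) \<Rightarrow> bool"
  where "seq_colim X f F \<xi> \<longleftrightarrow> F \<in> Mods C \<and> (\<forall>n. \<xi> n \<in> El F (X n)) \<and>
    (\<forall>n. Fm F (X n) (X (Suc n)) (f (Suc n)) (\<xi> (Suc n)) = \<xi> n) \<and>
    (\<forall>S\<in>Ob C. \<forall>y\<in>El F S. \<exists>n g. arr S (X n) g \<and> y = Fm F S (X n) g (\<xi> n)) \<and>
    (\<forall>S n g g'. arr S (X n) g \<and> arr S (X n) g' \<and> Fm F S (X n) g (\<xi> n) = Fm F S (X n) g' (\<xi> n) \<longrightarrow>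
      (\<exists>m\<ge>n. push X f S n m g = push X f S n m g'))"

lemma compat_tr:
  assumes s: "seq X f" and F: "F \<in> Mods C" and x: "\<And>n. \<xi> n \<in> El F (X n)"
    and c: "\<And>n. Fm F (X n) (X (Suc n)) (f (Suc n)) (\<xi> (Suc n)) = \<xi> n" and le: "n \<le> m"
  shows "Fm F (X n) (X m) (tr X f n m) (\<xi> m) = \<xi> n"
  using le
proof (induction m rule: dec_induct)
  case base
  then show ?case using F x seq_Ob[OF s] by simp
next
  case (step m)
  then show ?case using act_comp[OF F tr_arr[OF s step(1)] seq_arr[OF s] x] c by (simp add: tr_Suc)
qed

lemma compat_push:
  assumes s: "seq X f" and F: "F \<in> Mods C" and x: "\<And>n. \<xi> n \<in> El F (X n)"
    and c: "\<And>n. Fm F (X n) (X (Suc n)) (f (Suc n)) (\<xi> (Suc n)) = \<xi> n" and le: "n \<le> m"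
    and g: "arr S (X n) g"
  shows "Fm F S (X m) (push X f S n m g) (\<xi> m) = Fm F S (X n) g (\<xi> n)"
  using act_comp[OF F g tr_arr[OF s le] x] compat_tr[OF s F x c le] by simp

lemma seq_colimD:
  assumes "seq_colim X f F \<xi>"
  shows "F \<in> Mods C" "\<xi> n \<in> El F (X n)" "Fm F (X n) (X (Suc n)) (f (Suc n)) (\<xi> (Suc n)) = \<xi> n"
  using assms by (auto simp: seq_colim_def)

lemma seq_colim_tr: "\<lbrakk>seq X f; seq_colim X f F \<xi>; n \<le> m\<rbrakk> \<Longrightarrow> Fm F (X n) (X m) (tr X f n m) (\<xi> m) = \<xi> n"
  using compat_tr seq_colimD by metis

lemma seq_colim_push: "\<lbrakk>seq X f; seq_colim X f F \<xi>; n \<le> m; arr S (X n) g\<rbrakk>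
    \<Longrightarrow> Fm F S (X m) (push X f S n m g) (\<xi> m) = Fm F S (X n) g (\<xi> n)"
  using compat_push seq_colimD by metis

lemma seq_colim_gen:
  assumes s: "seq X f" and c: "seq_colim X f F \<xi>" and "S \<in> Ob C" "y \<in> El F S"
  obtains n g where "n \<ge> N" "arr S (X n) g" "y = Fm F S (X n) g (\<xi> n)"
proof -
  obtain n g where g: "arr S (X n) g" "y = Fm F S (X n) g (\<xi> n)"
    using assms unfolding seq_colim_def by blast
  show ?thesis
  proof (rule that[of "max n N" "Comp C S (X n) (X (max n N)) (tr X f n (max n N)) g"])
    show "arr S (X (max n N)) (Comp C S (X n) (X (max n N)) (tr X f n (max n N)) g)"
      using s g by (meson arr_comp max.cobounded1 tr_arr)
    show "y = Fm F S (X (max n N)) (Comp C S (X n) (X (max n N)) (tr X f n (max n N)) g) (\<xi> (max n N))"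
      using seq_colim_push[OF s c _ g(1), of "max n N"] g(2) by simp
  qed simp
qed

lemma seq_colim_eq:
  assumes s: "seq X f" and c: "seq_colim X f F \<xi>" and g: "arr S (X n) g" "arr S (X n) g'"
    and e: "Fm F S (X n) g (\<xi> n) = Fm F S (X n) g' (\<xi> n)"
  obtains m where "m \<ge> n" "m \<ge> N" "push X f S n m g = push X f S n m g'"
proof -
  obtain m where m: "m \<ge> n" "push X f S n m g = push X f S n m g'"
    using assms unfolding seq_colim_def by blast
  have "Comp C S (X n) (X (max m N)) (tr X f n (max m N)) g = Comp C S (X n) (X (max m N)) (tr X f n (max m N)) g'"
    using tr_push[OF s m(1) _ g(1), of "max m N"] tr_push[OF s m(1) _ g(2), of "max m N"] m(2) by simp
  then show ?thesis using that[of "max m N"] m(1) by simp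
qed

lemma seq_colim_kill:
  assumes s: "seq X f" and c: "seq_colim X f F \<xi>" and g: "arr S (X n) g"
    and e: "Fm F S (X n) g (\<xi> n) = \<zero>\<^bsub>Fo F S\<^esub>"
  obtains m where "m \<ge> n" "m \<ge> N" "push X f S n m g = \<zero>\<^bsub>Hom C S (X m)\<^esub>"
proof -
  have S: "S \<in> Ob C" "X n \<in> Ob C" using g by (simp_all add: arr_def)
  have "Fm F S (X n) g (\<xi> n) = Fm F S (X n) \<zero>\<^bsub>Hom C S (X n)\<^esub> (\<xi> n)"
    using e S seq_colimD[OF c] by simp
  then obtain m where m: "m \<ge> n" "m \<ge> N" "push X f S n m g
      = push X f S n m \<zero>\<^bsub>Hom C S (X n)\<^esub>"
    using seq_colim_eq[OF s c g arr_zero[OF S]] by metis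
  then show ?thesis using that comp_zero_right[OF tr_arr[OF s m(1)] S(1)] by metis
qed

text \<open>The elements \<open>\<xi> n\<close> generate \<open>F\<close>.\<close>

lemma seq_colim_map_unique:
  assumes s: "seq X f" and c: "seq_colim X f F \<xi>" and "\<theta> \<in> NatTr C F G" "\<theta>' \<in> NatTr C F G"
    and "\<And>n. \<theta> (X n) (\<xi> n) = \<theta>' (X n) (\<xi> n)"
  shows "\<theta> = \<theta>'"
proof (rule Nat_eqI[OF assms(3,4)])
  fix S y assume "S \<in> Ob C" "y \<in> El F S"
  then obtain n g where g: "arr S (X n) g" "y = Fm F S (X n) g (\<xi> n)"
    using seq_colim_gen[OF s c] by metis
  then show "\<theta> S y = \<theta>' S y" using assms seq_colimD[OF c] by (simp add: Nat_act)
qed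

text \<open>
  The value on the element presented by \<open>g : S \<rightarrow> X n\<close> has to be the image of \<open>\<eta> n\<close> under \<open>g\<close>. It is well
  defined because two presentations of an element become equal at a later stage.
\<close>

lemma seq_colim_map:
  assumes s: "seq X f" and c: "seq_colim X f F \<xi>" and G: "G \<in> Mods C"
    and h: "\<And>n. \<eta> n \<in> El G (X n)" "\<And>n. Fm G (X n) (X (Suc n)) (f (Suc n)) (\<eta> (Suc n)) = \<eta> n"
  obtains \<theta> where "\<theta> \<in> NatTr C F G" "\<And>n. \<theta> (X n) (\<xi> n) = \<eta> n"
proof -
  note D = seq_colimD[OF c]
  define \<theta> where "\<theta> S y = (SOME z. \<exists>n g. arr S (X n) g \<and> y = Fm F S (X n) g (\<xi> n) \<and> z = Fm G S (X n) g (\<eta> n))" for S y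
  have th: "\<theta> S (Fm F S (X n) g (\<xi> n)) = Fm G S (X n) g (\<eta> n)" if g: "arr S (X n) g" for S n g
    unfolding \<theta>_def
  proof (rule some_equality)
    fix z assume "\<exists>m g'. arr S (X m) g' \<and> Fm F S (X n) g (\<xi> n) = Fm F S (X m) g' (\<xi> m) \<and> z = Fm G S (X m) g' (\<eta> m)"
    then obtain m g' where g': "arr S (X m) g'" "Fm F S (X n) g (\<xi> n) = Fm F S (X m) g' (\<xi> m)"
      "z = Fm G S (X m) g' (\<eta> m)" by blast
    let ?k = "max n m"
    let ?t = "push X f S n ?k g" and ?t' = "push X f S m ?k g'"
    have a: "arr S (X ?k) ?t" "arr S (X ?k) ?t'"
      using g g'(1) s by (meson arr_comp max.cobounded1 max.cobounded2 tr_arr)+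
    have "Fm F S (X ?k) ?t (\<xi> ?k) = Fm F S (X ?k) ?t' (\<xi> ?k)"
      using seq_colim_push[OF s c _ g, of ?k] seq_colim_push[OF s c _ g'(1), of ?k] g'(2) by simp
    then obtain l where l: "l \<ge> ?k" "push X f S ?k l ?t = push X f S ?k l ?t'"
      using seq_colim_eq[OF s c a] by metis
    then have "push X f S n l g = push X f S m l g'"
      using tr_push[OF s _ l(1) g] tr_push[OF s _ l(1) g'(1)] by simp
    then show "z = Fm G S (X n) g (\<eta> n)"
      using compat_push[OF s G h _ g, of l] compat_push[OF s G h _ g'(1), of l] l(1) g'(3) by simp
  qed (use g in blast)
  have gen2: "\<exists>n g g'. arr S (X n) g \<and> arr S (X n) g' \<and> y = Fm F S (X n) g (\<xi> n) \<and> y' = Fm F S (X n) g' (\<xi> n)"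
    if S: "S \<in> Ob C" "y \<in> El F S" "y' \<in> El F S" for S y y'
  proof -
    obtain n g where g: "arr S (X n) g" "y = Fm F S (X n) g (\<xi> n)"
      using seq_colim_gen[OF s c S(1,2)] by metis
    obtain m g' where g': "m \<ge> n" "arr S (X m) g'" "y' = Fm F S (X m) g' (\<xi> m)"
      using seq_colim_gen[OF s c S(1,3)] by metis
    show ?thesis using g g' seq_colim_push[OF s c g'(1) g(1)] arr_comp[OF g(1) tr_arr[OF s g'(1)]] by metis
  qed
  have "(\<lambda>S\<in>Ob C. \<lambda>y\<in>El F S. \<theta> S y) \<in> NatTr C F G"
  proof (rule NatTrI)
    fix S y assume S: "S \<in> Ob C" "y \<in> El F S"
    then obtain n g where "arr S (X n) g" "y = Fm F S (X n) g (\<xi> n)" using gen2 by blast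
    then show "\<theta> S y \<in> El G S" using th h act_in[OF G] by metis
  next
    fix S y y' assume S: "S \<in> Ob C" "y \<in> El F S" "y' \<in> El F S"
    then obtain n g g' where g: "arr S (X n) g" "arr S (X n) g'" "y = Fm F S (X n) g (\<xi> n)" "y' = Fm F S (X n) g' (\<xi> n)"
      using gen2 by blast
    then have "y \<oplus>\<^bsub>Fo F S\<^esub> y' = Fm F S (X n) (g \<oplus>\<^bsub>Hom C S (X n)\<^esub> g') (\<xi> n)"
      using act_add_arr[OF D(1) g(1,2) D(2)] by simp
    then show "\<theta> S (y \<oplus>\<^bsub>Fo F S\<^esub> y') = \<theta> S y \<oplus>\<^bsub>Fo G S\<^esub> \<theta> S y'"
      using g th arr_add[OF g(1,2)] act_add_arr[OF G g(1,2) h(1)] by simp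
  next
    fix S T a y assume a: "arr S T a" "y \<in> El F T"
    then obtain n g where g: "arr T (X n) g" "y = Fm F T (X n) g (\<xi> n)" using gen2 arrD(2) by blast
    then have "Fm F S T a y = Fm F S (X n) (Comp C S T (X n) g a) (\<xi> n)"
      using act_comp[OF D(1) a(1) g(1) D(2)] by simp
    then show "\<theta> S (Fm F S T a y) = Fm G S T a (\<theta> T y)"
      using g th arr_comp[OF a(1) g(1)] act_comp[OF G a(1) g(1) h(1)] by simp
  qed (use D(1) G Mods_group act_in in auto)
  moreover have "(\<lambda>S\<in>Ob C. \<lambda>y\<in>El F S. \<theta> S y) (X n) (\<xi> n) = \<eta> n" for n
    using th[of "X n" n "Idm C (X n)"] D G h seq_Ob[OF s] by simp
  ultimately show ?thesis by (rule that)
qed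

end

context additive_category
begin

section \<open>Existence of the colimit\<close>

text \<open>
  Elements of the colimit are germs \<open>(n, g)\<close> with \<open>g : S \<rightarrow> X n\<close>; a chosen representative of the
  class of a germ, coded by \<open>emb\<close>, is the corresponding element.
\<close>

definition same_germ :: "(nat \<Rightarrow> 'o) \<Rightarrow> (nat \<Rightarrow> 'm) \<Rightarrow> 'o \<Rightarrow> nat \<Rightarrow> 'm \<Rightarrow> nat \<Rightarrow> 'm \<Rightarrow> bool"
  where "same_germ X f S n g m g' \<longleftrightarrow>
    (\<exists>k\<ge>max n m. push X f S n k g = push X f S m k g')"

definition germ :: "(nat \<times> 'm \<Rightarrow> 'g) \<Rightarrow> (nat \<Rightarrow> 'o) \<Rightarrow> (nat \<Rightarrow> 'm) \<Rightarrow> 'o \<Rightarrow> nat \<Rightarrow> 'm \<Rightarrow> 'g"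
  where "germ emb X f S n g = emb (SOME q. arr S (X (fst q)) (snd q) \<and> same_germ X f S n g (fst q) (snd q))"

lemma same_germ_later:
  assumes s: "seq X f" and g: "arr S (X n) g" "arr S (X m) g'" and r: "same_germ X f S n g m g'"
  obtains k where "k \<ge> N" "k \<ge> n" "k \<ge> m"
    "push X f S n k g = push X f S m k g'"
proof -
  obtain k where k: "k \<ge> n" "k \<ge> m" "push X f S n k g = push X f S m k g'"
    using r by (auto simp: same_germ_def)
  have "Comp C S (X n) (X (max k N)) (tr X f n (max k N)) g = Comp C S (X m) (X (max k N)) (tr X f m (max k N)) g'"
    using tr_push[OF s k(1) _ g(1), of "max k N"] tr_push[OF s k(2) _ g(2), of "max k N"] k(3) by simp
  then show ?thesis using that[of "max k N"] k by simp
qed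

lemma same_germ_refl: "same_germ X f S n g n g"
  by (auto simp: same_germ_def)

lemma same_germ_sym: "same_germ X f S n g m g' \<Longrightarrow> same_germ X f S m g' n g"
  unfolding same_germ_def by (metis max.commute)

lemma same_germ_trans:
  assumes s: "seq X f" and g: "arr S (X n) g" "arr S (X m) g'" "arr S (X l) g''"
    and r: "same_germ X f S n g m g'" "same_germ X f S m g' l g''"
  shows "same_germ X f S n g l g''"
proof -
  obtain k where k: "k \<ge> n" "k \<ge> m" "push X f S n k g = push X f S m k g'"
    using same_germ_later[OF s g(1,2) r(1)] by metis
  obtain j where j: "j \<ge> k" "j \<ge> m" "j \<ge> l" "push X f S m j g' = push X f S l j g''"
    using same_germ_later[OF s g(2,3) r(2)] by metis
  have "push X f S n j g = push X f S m j g'"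
    using tr_push[OF s k(1) j(1) g(1)] tr_push[OF s k(2) j(1) g(2)] k(3) by simp
  with j k show ?thesis unfolding same_germ_def by (metis le_trans max.bounded_iff)
qed

lemma same_germ_tr:
  assumes s: "seq X f" and g: "arr S (X n) g" and "n \<le> m"
  shows "same_germ X f S n g m (push X f S n m g)"
  unfolding same_germ_def using tr_push[OF s assms(3) _ g, of m] assms(3) by (intro exI[of _ m]) simp

lemma germ_eq_iff:
  assumes s: "seq X f" and i: "inj emb" and g: "arr S (X n) g" "arr S (X m) g'"
  shows "germ emb X f S n g = germ emb X f S m g' \<longleftrightarrow> same_germ X f S n g m g'"
proof
  let ?Q = "\<lambda>n g q. arr S (X (fst q)) (snd q) \<and> same_germ X f S n g (fst q) (snd q)"
  have Q: "?Q n g (SOME q. ?Q n g q)" by (rule someI[of _ "(n, g)"]) (simp add: g same_germ_refl)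
  have Q': "?Q m g' (SOME q. ?Q m g' q)" by (rule someI[of _ "(m, g')"]) (simp add: g same_germ_refl)
  {
    assume "germ emb X f S n g = germ emb X f S m g'"
    then have e: "(SOME q. ?Q n g q) = (SOME q. ?Q m g' q)"
      using i unfolding germ_def by (auto dest: injD)
    show "same_germ X f S n g m g'"
      using same_germ_trans[OF s g(1) _ g(2) conjunct2[OF Q] same_germ_sym] Q Q' unfolding e by blast
  next
    assume r: "same_germ X f S n g m g'"
    have "?Q n g q = ?Q m g' q" for q
    proof (cases "arr S (X (fst q)) (snd q)")
      case True
      show ?thesis
        using True same_germ_trans[OF s g True r] same_germ_trans[OF s g(2) g(1) True same_germ_sym[OF r]] by (intro iffI conjI) simp_all
    qed simp
    then have "?Q n g = ?Q m g'" by (rule ext)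
    then show "germ emb X f S n g = germ emb X f S m g'" unfolding germ_def by simp
  }
qed

text \<open>
  Germs are added at a common stage. The choice operator only removes the dependence on
  representatives from the definition; \<open>germ_add\<close> shows that the result does not depend on them.
\<close>

definition germ_group :: "(nat \<times> 'm \<Rightarrow> 'g) \<Rightarrow> (nat \<Rightarrow> 'o) \<Rightarrow> (nat \<Rightarrow> 'm) \<Rightarrow> 'o \<Rightarrow> 'g ring"
  where "germ_group emb X f S =
    \<lparr>carrier = {germ emb X f S n g |n g. arr S (X n) g}, mult = undefined, one = undefined,
     zero = germ emb X f S 0 \<zero>\<^bsub>Hom C S (X 0)\<^esub>,
     add = (\<lambda>a b. SOME z. \<exists>n g h. arr S (X n) g \<and> arr S (X n) h \<and> a = germ emb X f S n g \<and>
       b = germ emb X f S n h \<and> z = germ emb X f S n (g \<oplus>\<^bsub>Hom C S (X n)\<^esub> h))\<rparr>"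

definition germ_mod :: "(nat \<times> 'm \<Rightarrow> 'g) \<Rightarrow> (nat \<Rightarrow> 'o) \<Rightarrow> (nat \<Rightarrow> 'm) \<Rightarrow> ('o, 'm, 'g) cmod"
  where "germ_mod emb X f =
    \<lparr>Fo = (\<lambda>S\<in>Ob C. germ_group emb X f S),
     Fm = (\<lambda>S T a. if S \<in> Ob C \<and> T \<in> Ob C \<and> a \<in> Mor C S T
       then (\<lambda>y\<in>carrier (germ_group emb X f T). SOME z. \<exists>n g. arr T (X n) g \<and> y = germ emb X f T n g \<and>
         z = germ emb X f S n (Comp C S T (X n) g a)) else undefined)\<rparr>"

lemma germ_carrier: "carrier (germ_group emb X f S) = {germ emb X f S n g |n g. arr S (X n) g}"
  by (simp add: germ_group_def)

lemma germ_in: "arr S (X n) g \<Longrightarrow> germ emb X f S n g \<in> carrier (germ_group emb X f S)"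
  by (auto simp: germ_carrier)

lemma germ_common:
  assumes s: "seq X f" and i: "inj emb" and "y \<in> carrier (germ_group emb X f S)"
  obtains n g where "n \<ge> N" "arr S (X n) g" "y = germ emb X f S n g"
proof -
  obtain n g where g: "arr S (X n) g" "y = germ emb X f S n g" using assms(3) by (auto simp: germ_carrier)
  have t: "arr S (X (max n N)) (Comp C S (X n) (X (max n N)) (tr X f n (max n N)) g)"
    using arr_comp[OF g(1) tr_arr[OF s, of n "max n N"]] by simp
  have "y = germ emb X f S (max n N) (Comp C S (X n) (X (max n N)) (tr X f n (max n N)) g)"
    unfolding g(2) germ_eq_iff[OF s i g(1) t] by (rule same_germ_tr[OF s g(1)]) simp
  with t show ?thesis by (rule that[rotated]) simp
qed

lemma germ_tr:
  assumes s: "seq X f" and i: "inj emb" and g: "arr S (X n) g" and le: "n \<le> m"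
  shows "germ emb X f S m (push X f S n m g) = germ emb X f S n g"
  using same_germ_tr[OF s g le] germ_eq_iff[OF s i g arr_comp[OF g tr_arr[OF s le]]] by simp

lemma germ_add:
  assumes s: "seq X f" and i: "inj emb" and g: "arr S (X n) g" "arr S (X n) h"
  shows "add (germ_group emb X f S) (germ emb X f S n g) (germ emb X f S n h)
    = germ emb X f S n (g \<oplus>\<^bsub>Hom C S (X n)\<^esub> h)"
proof -
  have "(SOME z. \<exists>m g' h'. arr S (X m) g' \<and> arr S (X m) h' \<and> germ emb X f S n g = germ emb X f S m g' \<and>
       germ emb X f S n h = germ emb X f S m h' \<and> z = germ emb X f S m (g' \<oplus>\<^bsub>Hom C S (X m)\<^esub> h'))
     = germ emb X f S n (g \<oplus>\<^bsub>Hom C S (X n)\<^esub> h)"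
  proof (rule some_equality)
    fix z assume "\<exists>m g' h'. arr S (X m) g' \<and> arr S (X m) h' \<and> germ emb X f S n g = germ emb X f S m g' \<and>
       germ emb X f S n h = germ emb X f S m h' \<and> z = germ emb X f S m (g' \<oplus>\<^bsub>Hom C S (X m)\<^esub> h')"
    then obtain m g' h' where g': "arr S (X m) g'" "arr S (X m) h'"
        "same_germ X f S n g m g'" "same_germ X f S n h m h'"
      and z: "z = germ emb X f S m (g' \<oplus>\<^bsub>Hom C S (X m)\<^esub> h')"
      using germ_eq_iff[OF s i] g by metis
    obtain k where k: "k \<ge> n" "k \<ge> m" "push X f S n k g = push X f S m k g'"
      using same_germ_later[OF s g(1) g'(1,3)] by metis
    obtain l where l: "l \<ge> k" "l \<ge> n" "l \<ge> m" "push X f S n l h = push X f S m l h'"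
      using same_germ_later[OF s g(2) g'(2,4)] by metis
    have 1: "push X f S n l g = push X f S m l g'"
      using tr_push[OF s k(1) l(1) g(1)] tr_push[OF s k(2) l(1) g'(1)] k(3) by simp
    have "push X f S n l (g \<oplus>\<^bsub>Hom C S (X n)\<^esub> h)
        = push X f S m l (g' \<oplus>\<^bsub>Hom C S (X m)\<^esub> h')"
      using comp_add_right[of S "X n" "X l" g h "tr X f n l"] comp_add_right[of S "X m" "X l" g' h' "tr X f m l"]
        1 l(4) g g' tr_arr[OF s l(2)] tr_arr[OF s l(3)] by (simp add: arr_def)
    then have "same_germ X f S n (g \<oplus>\<^bsub>Hom C S (X n)\<^esub> h) m (g' \<oplus>\<^bsub>Hom C S (X m)\<^esub> h')"
      unfolding same_germ_def using l by auto
    then show "z = germ emb X f S n (g \<oplus>\<^bsub>Hom C S (X n)\<^esub> h)"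
      using germ_eq_iff[OF s i] arr_add g g' z by metis
  qed (use g in blast)
  then show ?thesis by (simp add: germ_group_def)
qed

lemma germ_zero:
  assumes s: "seq X f" and i: "inj emb" and S: "S \<in> Ob C"
  shows "\<zero>\<^bsub>germ_group emb X f S\<^esub> = germ emb X f S n \<zero>\<^bsub>Hom C S (X n)\<^esub>"
  using germ_tr[OF s i arr_zero[OF S seq_Ob[OF s, of 0]], of n] tr_arr[OF s, of 0 n] S
  by (simp add: germ_group_def)

lemma germ_group_abelian:
  assumes s: "seq X f" and i: "inj emb" and S: "S \<in> Ob C"
  shows "abelian_group (germ_group emb X f S)" (is "abelian_group ?G")
proof -
  have H: "abelian_group (Hom C S (X n))" for n using hom_group[OF S seq_Ob[OF s]] .
  have rep: "\<exists>n g h k. arr S (X n) g \<and> arr S (X n) h \<and> arr S (X n) k \<and>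
      x = germ emb X f S n g \<and> y = germ emb X f S n h \<and> z = germ emb X f S n k"
    if xyz: "x \<in> carrier ?G" "y \<in> carrier ?G" "z \<in> carrier ?G" for x y z
  proof -
    obtain n g where n: "arr S (X n) g" "x = germ emb X f S n g" using germ_common[OF s i xyz(1)] by metis
    obtain m h where m: "m \<ge> n" "arr S (X m) h" "y = germ emb X f S m h" using germ_common[OF s i xyz(2)] by metis
    obtain l k where l: "l \<ge> m" "arr S (X l) k" "z = germ emb X f S l k" using germ_common[OF s i xyz(3)] by metis
    have "n \<le> l" using m l by simp
    then show ?thesis
      using n m l germ_tr[OF s i n(1) \<open>n \<le> l\<close>] germ_tr[OF s i m(2) l(1)]
        arr_comp[OF n(1) tr_arr[OF s \<open>n \<le> l\<close>]] arr_comp[OF m(2) tr_arr[OF s l(1)]] by metis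
  qed
  note add = germ_add[OF s i]
  show ?thesis
  proof (rule abelian_groupI)
    fix x y assume x: "x \<in> carrier ?G" "y \<in> carrier ?G"
    then obtain n g h where g: "arr S (X n) g" "arr S (X n) h" "x = germ emb X f S n g" "y = germ emb X f S n h"
      using rep by metis
    show "x \<oplus>\<^bsub>?G\<^esub> y \<in> carrier ?G" using g add germ_in[of S X n, OF arr_add[OF g(1,2)]] by simp
    have "g \<oplus>\<^bsub>Hom C S (X n)\<^esub> h = h \<oplus>\<^bsub>Hom C S (X n)\<^esub> g"
      using abelian_monoid.a_comm[OF abelian_group.axioms(1)[OF H]] g arrD(3) by blast
    then show "x \<oplus>\<^bsub>?G\<^esub> y = y \<oplus>\<^bsub>?G\<^esub> x" using g add by simp
  next
    show "\<zero>\<^bsub>?G\<^esub> \<in> carrier ?G" using arr_zero[OF S seq_Ob[OF s]] by (auto simp: germ_group_def)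
  next
    fix x y z assume x: "x \<in> carrier ?G" "y \<in> carrier ?G" "z \<in> carrier ?G"
    then obtain n g h k where g: "arr S (X n) g" "arr S (X n) h" "arr S (X n) k"
      "x = germ emb X f S n g" "y = germ emb X f S n h" "z = germ emb X f S n k"
      using rep by metis
    have "g \<oplus>\<^bsub>Hom C S (X n)\<^esub> h \<oplus>\<^bsub>Hom C S (X n)\<^esub> k = g \<oplus>\<^bsub>Hom C S (X n)\<^esub> (h \<oplus>\<^bsub>Hom C S (X n)\<^esub> k)"
      using abelian_monoid.a_assoc[OF abelian_group.axioms(1)[OF H]] g(1-3) arrD(3) by blast
    then show "x \<oplus>\<^bsub>?G\<^esub> y \<oplus>\<^bsub>?G\<^esub> z = x \<oplus>\<^bsub>?G\<^esub> (y \<oplus>\<^bsub>?G\<^esub> z)" using g add arr_add by simp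
  next
    fix x assume x: "x \<in> carrier ?G"
    then obtain n g where g: "arr S (X n) g" "x = germ emb X f S n g" using rep by metis
    have z: "arr S (X n) \<zero>\<^bsub>Hom C S (X n)\<^esub>" using S seq_Ob[OF s] by simp
    have "\<zero>\<^bsub>Hom C S (X n)\<^esub> \<oplus>\<^bsub>Hom C S (X n)\<^esub> g = g"
      using abelian_monoid.l_zero[OF abelian_group.axioms(1)[OF H]] g(1) arrD(3) by blast
    then show "\<zero>\<^bsub>?G\<^esub> \<oplus>\<^bsub>?G\<^esub> x = x" using g add[OF z g(1)] germ_zero[OF s i S, of n] by simp
    have "(\<ominus>\<^bsub>Hom C S (X n)\<^esub> g) \<oplus>\<^bsub>Hom C S (X n)\<^esub> g = \<zero>\<^bsub>Hom C S (X n)\<^esub>"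
      using abelian_group.l_neg[OF H] g(1) arrD(3) by blast
    then have "germ emb X f S n (\<ominus>\<^bsub>Hom C S (X n)\<^esub> g) \<oplus>\<^bsub>?G\<^esub> x = \<zero>\<^bsub>?G\<^esub>"
      using g add[OF arr_neg[OF g(1)] g(1)] germ_zero[OF s i S, of n] by simp
    then show "\<exists>y\<in>carrier ?G. y \<oplus>\<^bsub>?G\<^esub> x = \<zero>\<^bsub>?G\<^esub>" using arr_neg[OF g(1)] by (auto simp: germ_carrier)
  qed
qed

lemma germ_act:
  assumes s: "seq X f" and i: "inj emb" and a: "arr S T a" and g: "arr T (X n) g"
  shows "Fm (germ_mod emb X f) S T a (germ emb X f T n g) = germ emb X f S n (Comp C S T (X n) g a)"
proof -
  have "(SOME z. \<exists>m g'. arr T (X m) g' \<and> germ emb X f T n g = germ emb X f T m g' \<and>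
      z = germ emb X f S m (Comp C S T (X m) g' a)) = germ emb X f S n (Comp C S T (X n) g a)"
  proof (rule some_equality)
    fix z assume "\<exists>m g'. arr T (X m) g' \<and> germ emb X f T n g = germ emb X f T m g' \<and>
      z = germ emb X f S m (Comp C S T (X m) g' a)"
    then obtain m g' where g': "arr T (X m) g'" "same_germ X f T n g m g'"
      and z: "z = germ emb X f S m (Comp C S T (X m) g' a)" using germ_eq_iff[OF s i] g by metis
    obtain k where k: "k \<ge> n" "k \<ge> m" "push X f T n k g = push X f T m k g'"
      using same_germ_later[OF s g g'] by metis
    have "push X f S n k (Comp C S T (X n) g a)
        = push X f S m k (Comp C S T (X m) g' a)"
      using comp_assoc'[OF a g tr_arr[OF s k(1)]] comp_assoc'[OF a g'(1) tr_arr[OF s k(2)]] k(3) by simp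
    then have "same_germ X f S n (Comp C S T (X n) g a) m (Comp C S T (X m) g' a)"
      unfolding same_germ_def using k by auto
    then show "z = germ emb X f S n (Comp C S T (X n) g a)"
      using germ_eq_iff[OF s i] arr_comp[OF a g] arr_comp[OF a g'(1)] z by metis
  qed (use g in blast)
  moreover have "germ emb X f T n g \<in> carrier (germ_group emb X f T)" using g by (auto simp: germ_carrier)
  ultimately show ?thesis using a by (simp add: germ_mod_def arr_def)
qed

lemma germ_mod_sel: "S \<in> Ob C \<Longrightarrow> Fo (germ_mod emb X f) S = germ_group emb X f S"
  by (simp add: germ_mod_def)

lemma ModsI:
  assumes "\<And>X. X \<in> Ob C \<Longrightarrow> abelian_group (Fo F X)"
    and "\<And>X Y f y. \<lbrakk>arr X Y f; y \<in> El F Y\<rbrakk> \<Longrightarrow> Fm F X Y f y \<in> El F X"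
    and "\<And>X Y f y z. \<lbrakk>arr X Y f; y \<in> El F Y; z \<in> El F Y\<rbrakk>
      \<Longrightarrow> Fm F X Y f (y \<oplus>\<^bsub>Fo F Y\<^esub> z) = Fm F X Y f y \<oplus>\<^bsub>Fo F X\<^esub> Fm F X Y f z"
    and "\<And>X x. \<lbrakk>X \<in> Ob C; x \<in> El F X\<rbrakk> \<Longrightarrow> Fm F X X (Idm C X) x = x"
    and "\<And>X Y Z f g z. \<lbrakk>arr X Y f; arr Y Z g; z \<in> El F Z\<rbrakk>
      \<Longrightarrow> Fm F X Z (Comp C X Y Z g f) z = Fm F X Y f (Fm F Y Z g z)"
    and "\<And>X Y f g y. \<lbrakk>arr X Y f; arr X Y g; y \<in> El F Y\<rbrakk>
      \<Longrightarrow> Fm F X Y (f \<oplus>\<^bsub>Hom C X Y\<^esub> g) y = Fm F X Y f y \<oplus>\<^bsub>Fo F X\<^esub> Fm F X Y g y"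
    and "Fo F \<in> extensional (Ob C)"
    and "\<And>X Y f. arr X Y f \<Longrightarrow> Fm F X Y f \<in> extensional (El F Y)"
    and "\<And>X Y f. \<not> arr X Y f \<Longrightarrow> Fm F X Y f = undefined"
  shows "F \<in> Mods C"
  unfolding Mods_def mem_Collect_eq
proof (intro conjI)
  show "\<forall>X\<in>Ob C. \<forall>Y\<in>Ob C. \<forall>f\<in>Mor C X Y. abelian_group_hom (Fo F Y) (Fo F X) (Fm F X Y f)"
    unfolding abelian_group_hom_iff using assms(1-3) by (auto simp: arr_def)
  show "\<forall>X Y f. if X \<in> Ob C \<and> Y \<in> Ob C \<and> f \<in> Mor C X Y
      then Fm F X Y f \<in> extensional (El F Y) else Fm F X Y f = undefined"
    using assms(8,9) by (auto simp: arr_def)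
qed (use assms(1,4-7) in \<open>auto simp: arr_def\<close>)

lemma germ_mod_Mods:
  assumes s: "seq X f" and i: "inj emb" shows "germ_mod emb X f \<in> Mods C" (is "?F \<in> _")
proof (rule ModsI)
  fix S assume "S \<in> Ob C"
  then show "abelian_group (Fo ?F S)" using germ_group_abelian[OF s i] by (simp add: germ_mod_sel)
next
  fix S T a y assume a: "arr S T a" "y \<in> El ?F T"
  then obtain n g where g: "arr T (X n) g" "y = germ emb X f T n g" by (auto simp: germ_mod_sel arrD germ_carrier)
  show "Fm ?F S T a y \<in> El ?F S"
    using germ_act[OF s i a(1) g(1)] germ_in[of S X n, OF arr_comp[OF a(1) g(1)]] a g(2)
    by (simp add: germ_mod_sel arrD)
next
  fix S T a y z assume a: "arr S T a" and yz: "y \<in> El ?F T" "z \<in> El ?F T"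
  then have yz': "y \<in> carrier (germ_group emb X f T)" "z \<in> carrier (germ_group emb X f T)"
    by (simp_all add: germ_mod_sel arrD)
  obtain n g where n: "arr T (X n) g" "y = germ emb X f T n g" using germ_common[OF s i yz'(1)] by metis
  obtain m h where m: "m \<ge> n" "arr T (X m) h" "z = germ emb X f T m h" using germ_common[OF s i yz'(2)] by metis
  let ?g = "push X f T n m g"
  have g: "arr T (X m) ?g" "y = germ emb X f T m ?g"
    using n arr_comp[OF n(1) tr_arr[OF s m(1)]] germ_tr[OF s i n(1) m(1)] by simp_all
  have "Comp C S T (X m) (?g \<oplus>\<^bsub>Hom C T (X m)\<^esub> h) a
      = Comp C S T (X m) ?g a \<oplus>\<^bsub>Hom C S (X m)\<^esub> Comp C S T (X m) h a"
    using a g(1) m(2) comp_add_left by (simp add: arr_def)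
  then show "Fm ?F S T a (y \<oplus>\<^bsub>Fo ?F T\<^esub> z) = Fm ?F S T a y \<oplus>\<^bsub>Fo ?F S\<^esub> Fm ?F S T a z"
    using a g m(2,3) germ_add[OF s i] germ_act[OF s i a] arr_add[OF g(1) m(2)] arr_comp[OF a g(1)] arr_comp[OF a m(2)]
    by (simp add: germ_mod_sel arrD)
next
  fix S y assume y: "S \<in> Ob C" "y \<in> El ?F S"
  then obtain n g where "arr S (X n) g" "y = germ emb X f S n g" by (auto simp: germ_mod_sel germ_carrier)
  then show "Fm ?F S S (Idm C S) y = y" using germ_act[OF s i arr_id[OF y(1)]] by simp
next
  fix R S T a b y assume a: "arr R S a" "arr S T b" "y \<in> El ?F T"
  then obtain n g where g: "arr T (X n) g" "y = germ emb X f T n g" by (auto simp: germ_mod_sel arrD germ_carrier)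
  then show "Fm ?F R T (Comp C R S T b a) y = Fm ?F R S a (Fm ?F S T b y)"
    using germ_act[OF s i] a arr_comp[OF a(1,2)] arr_comp[OF a(2) g(1)] comp_assoc'[OF a(1,2) g(1)] by simp
next
  fix S T a b y assume a: "arr S T a" "arr S T b" "y \<in> El ?F T"
  then obtain n g where g: "arr T (X n) g" "y = germ emb X f T n g" by (auto simp: germ_mod_sel arrD germ_carrier)
  have "Comp C S T (X n) g (a \<oplus>\<^bsub>Hom C S T\<^esub> b) = Comp C S T (X n) g a \<oplus>\<^bsub>Hom C S (X n)\<^esub> Comp C S T (X n) g b"
    using a g(1) comp_add_right by (simp add: arr_def)
  then show "Fm ?F S T (a \<oplus>\<^bsub>Hom C S T\<^esub> b) y = Fm ?F S T a y \<oplus>\<^bsub>Fo ?F S\<^esub> Fm ?F S T b y"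
    using a g germ_act[OF s i] germ_add[OF s i] arr_add[OF a(1,2)] arr_comp[OF a(1) g(1)] arr_comp[OF a(2) g(1)]
    by (simp add: germ_mod_sel arrD)
qed (auto simp: germ_mod_def arr_def)

lemma seq_colim_germ_mod:
  assumes s: "seq X f" and i: "inj emb"
  shows "seq_colim X f (germ_mod emb X f) (\<lambda>n. germ emb X f (X n) n (Idm C (X n)))" (is "seq_colim X f ?F ?\<xi>")
proof -
  note O = seq_Ob[OF s] and a = germ_act[OF s i]
  have act: "Fm ?F S (X n) g (?\<xi> n) = germ emb X f S n g" if "arr S (X n) g" for S n g
    using a[OF that arr_id[OF O]] that by simp
  show ?thesis
    unfolding seq_colim_def
  proof (intro conjI allI impI ballI)
    show "?F \<in> Mods C" by (rule germ_mod_Mods[OF s i])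
    show "?\<xi> n \<in> El ?F (X n)" for n using germ_in[of "X n" X n, OF arr_id[OF O]] O by (simp add: germ_mod_sel)
    show "Fm ?F (X n) (X (Suc n)) (f (Suc n)) (?\<xi> (Suc n)) = ?\<xi> n" for n
    proof -
      have "Comp C (X n) (X n) (X (Suc n)) (tr X f n (Suc n)) (Idm C (X n)) = f (Suc n)"
        using seq_arr[OF s] O by (simp add: tr_Suc)
      then show ?thesis using act[OF seq_arr[OF s]] germ_tr[OF s i arr_id[OF O], of n "Suc n"] by simp
    qed
    show "\<exists>n g. arr S (X n) g \<and> y = Fm ?F S (X n) g (?\<xi> n)" if "S \<in> Ob C" "y \<in> El ?F S" for S y
      using that act by (auto simp: germ_mod_sel germ_carrier) metis
    fix S n g g' assume g: "arr S (X n) g \<and> arr S (X n) g' \<and> Fm ?F S (X n) g (?\<xi> n) = Fm ?F S (X n) g' (?\<xi> n)"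
    then have "same_germ X f S n g n g'" using act germ_eq_iff[OF s i] by metis
    then show "\<exists>m\<ge>n. push X f S n m g = push X f S n m g'"
      by (auto simp: same_germ_def)
  qed
qed

text \<open>
  Naturality in the sequence becomes compatibility of the elements that the Yoneda lemma assigns to
  the components of the cocone.
\<close>

lemma cocone_YoE:
  assumes s: "seq X f" and F: "F \<in> Mods C"
    and l: "cocone C (\<lambda>n. Yo C (X n)) (\<lambda>n. YoM C (X n) (X (Suc n)) (f (Suc n))) F \<phi>"
  obtains \<xi> where "\<And>n. \<xi> n \<in> El F (X n)" "\<And>n. Fm F (X n) (X (Suc n)) (f (Suc n)) (\<xi> (Suc n)) = \<xi> n"
      "\<phi> = (\<lambda>n. yon F (X n) (\<xi> n))"
proof (rule that)
  note O = seq_Ob[OF s] and a = seq_arr[OF s]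
  let ?\<xi> = "\<lambda>n. \<phi> n (X n) (Idm C (X n))"
  have p: "\<phi> n \<in> NatTr C (Yo C (X n)) F" for n using l by (simp add: cocone_def)
  show x: "?\<xi> n \<in> El F (X n)" for n by (rule Yoneda(1)[OF F O p])
  have y: "\<phi> n = yon F (X n) (?\<xi> n)" for n by (rule Yoneda(2)[OF F O p])
  then show "\<phi> = (\<lambda>n. yon F (X n) (?\<xi> n))" by blast
  have "NatComp C (Yo C (X n)) (\<phi> (Suc n)) (YoM C (X n) (X (Suc n)) (f (Suc n))) = \<phi> n" for n
    using l unfolding cocone_def by blast
  then have "yon F (X n) (Fm F (X n) (X (Suc n)) (f (Suc n)) (?\<xi> (Suc n))) = yon F (X n) (?\<xi> n)" for n
    using NatComp_yon_YoM[OF F a x] y by metis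
  then show "Fm F (X n) (X (Suc n)) (f (Suc n)) (?\<xi> (Suc n)) = ?\<xi> n" for n
    using yon_eq_iff[OF F O act_in[OF F a x] x] by blast
qed

lemma cocone_YoI:
  assumes s: "seq X f" and F: "F \<in> Mods C"
    and x: "\<And>n. \<xi> n \<in> El F (X n)" "\<And>n. Fm F (X n) (X (Suc n)) (f (Suc n)) (\<xi> (Suc n)) = \<xi> n"
  shows "cocone C (\<lambda>n. Yo C (X n)) (\<lambda>n. YoM C (X n) (X (Suc n)) (f (Suc n))) F (\<lambda>n. yon F (X n) (\<xi> n))"
  unfolding cocone_def
  using yon_in[OF F seq_Ob[OF s] x(1)] NatComp_yon_YoM[OF F seq_arr[OF s] x(1)] x(2) by simp

lemma Yo_colimitI:
  assumes s: "seq X f" and c: "seq_colim X f F \<xi>"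
  shows "Yo_colimit C X f F (\<lambda>n. yon F (X n) (\<xi> n))"
  unfolding Yo_colimit_def is_colimit_def
proof (intro conjI allI impI)
  note D = seq_colimD[OF c] and O = seq_Ob[OF s]
  show "F \<in> Mods C" by (rule D)
  show "cocone C (\<lambda>n. Yo C (X n)) (\<lambda>n. YoM C (X n) (X (Suc n)) (f (Suc n))) F (\<lambda>n. yon F (X n) (\<xi> n))"
    by (rule cocone_YoI[OF s D])
  fix G \<psi>
  assume G: "G \<in> Mods C \<and> cocone C (\<lambda>n. Yo C (X n)) (\<lambda>n. YoM C (X n) (X (Suc n)) (f (Suc n))) G \<psi>"
  then have G1: "G \<in> Mods C" and G2: "cocone C (\<lambda>n. Yo C (X n)) (\<lambda>n. YoM C (X n) (X (Suc n)) (f (Suc n))) G \<psi>"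
    by blast+
  obtain \<eta> where h: "\<And>n. \<eta> n \<in> El G (X n)" "\<And>n. Fm G (X n) (X (Suc n)) (f (Suc n)) (\<eta> (Suc n)) = \<eta> n"
    "\<psi> = (\<lambda>n. yon G (X n) (\<eta> n))" by (rule cocone_YoE[OF s G1 G2]) (rule that)
  have eq: "(NatComp C (Yo C (X n)) \<theta> (yon F (X n) (\<xi> n)) = \<psi> n) = (\<theta> (X n) (\<xi> n) = \<eta> n)"
    if "\<theta> \<in> NatTr C F G" for \<theta> n
    using NatComp_yon[OF D(1) O D(2) that] yon_eq_iff[OF G1 O Nat_in[OF that O D(2)] h(1)] h(3) by simp
  obtain \<theta> where t: "\<theta> \<in> NatTr C F G" "\<And>n. \<theta> (X n) (\<xi> n) = \<eta> n"
    using seq_colim_map[OF s c G1 h(1,2)] by metis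
  show "\<exists>!\<theta>. \<theta> \<in> NatTr C F G \<and> (\<forall>n. NatComp C (Yo C (X n)) \<theta> (yon F (X n) (\<xi> n)) = \<psi> n)"
  proof (rule ex1I[of _ \<theta>])
    show "\<theta> \<in> NatTr C F G \<and> (\<forall>n. NatComp C (Yo C (X n)) \<theta> (yon F (X n) (\<xi> n)) = \<psi> n)" using t eq by simp
    fix \<theta>' assume t': "\<theta>' \<in> NatTr C F G \<and> (\<forall>n. NatComp C (Yo C (X n)) \<theta>' (yon F (X n) (\<xi> n)) = \<psi> n)"
    show "\<theta>' = \<theta>"
      by (rule seq_colim_map_unique[OF s c]) (use t t' eq in auto)
  qed
qed

text \<open>
  Conversely a colimit has the elementwise description: it is a retract of the module of germs,
  compatibly with the cocones, and both generation and eventual equality pass to such a retract.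
  The module of germs takes values in \<open>'g\<close> thanks to \<open>emb\<close>, so the universal property applies to it.
\<close>

lemma Yo_colimitE:
  fixes F :: "('o, 'm, 'g) cmod"
  assumes s: "seq X f" and i: "inj (emb :: nat \<times> 'm \<Rightarrow> 'g)" and c: "Yo_colimit C X f F \<phi>"
  obtains \<xi> where "seq_colim X f F \<xi>" "\<phi> = (\<lambda>n. yon F (X n) (\<xi> n))"
proof -
  note O = seq_Ob[OF s]
  let ?coc = "\<lambda>F. cocone C (\<lambda>n. Yo C (X n)) (\<lambda>n. YoM C (X n) (X (Suc n)) (f (Suc n))) F"
  have F: "F \<in> Mods C" and coc: "?coc F \<phi>"
    and univ: "\<And>G \<psi>. \<lbrakk>(G :: ('o, 'm, 'g) cmod) \<in> Mods C; ?coc G \<psi>\<rbrakk>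
      \<Longrightarrow> \<exists>!\<theta>. \<theta> \<in> NatTr C F G \<and> (\<forall>n. NatComp C (Yo C (X n)) \<theta> (\<phi> n) = \<psi> n)"
    using c unfolding Yo_colimit_def is_colimit_def by blast+
  obtain \<xi> where x: "\<And>n. \<xi> n \<in> El F (X n)" "\<And>n. Fm F (X n) (X (Suc n)) (f (Suc n)) (\<xi> (Suc n)) = \<xi> n"
    "\<phi> = (\<lambda>n. yon F (X n) (\<xi> n))" by (rule cocone_YoE[OF s F coc]) (rule that)
  let ?E = "germ_mod emb X f"
  let ?e = "\<lambda>n. germ emb X f (X n) n (Idm C (X n))"
  note cE = seq_colim_germ_mod[OF s i]
  note E = seq_colimD[OF cE]
  obtain \<theta> where t: "\<theta> \<in> NatTr C ?E F" "\<And>n. \<theta> (X n) (?e n) = \<xi> n"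
    using seq_colim_map[OF s cE F x(1,2)] by metis
  have "?coc ?E (\<lambda>n. yon ?E (X n) (?e n))" by (rule cocone_YoI[OF s E])
  from ex1_implies_ex[OF univ[OF E(1) this]] obtain \<rho> where r: "\<rho> \<in> NatTr C F ?E" "\<And>n. NatComp C (Yo C (X n)) \<rho> (\<phi> n) = yon ?E (X n) (?e n)"
    by blast
  have r': "\<rho> (X n) (\<xi> n) = ?e n" for n
    using r(2)[of n] NatComp_yon[OF F O x(1) r(1)] yon_eq_iff[OF E(1) O Nat_in[OF r(1) O x(1)] E(2)] x(3)
    by simp
  let ?c = "NatComp C F \<theta> \<rho>"
  have tr: "?c \<in> NatTr C F F" by (rule NatComp_in[OF r(1) t(1) F])
  have "NatComp C (Yo C (X n)) ?c (\<phi> n) = \<phi> n" for n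
    using NatComp_yon[OF F O x(1) tr] x r' t(2) O by simp
  moreover have "NatComp C (Yo C (X n)) (NatId C F) (\<phi> n) = \<phi> n" for n
    using NatComp_yon[OF F O x(1) NatId_in[OF F]] x O by simp
  ultimately have "?c = NatId C F"
    using univ[OF F coc] tr NatId_in[OF F] by blast
  then have inv: "\<theta> S (\<rho> S y) = y" if "S \<in> Ob C" "y \<in> El F S" for S y
    using NatComp_apply[of S y F \<theta> \<rho>] that by simp
  have "seq_colim X f F \<xi>"
    unfolding seq_colim_def
  proof (intro conjI allI impI ballI)
    fix S y assume S: "S \<in> Ob C" "y \<in> El F S"
    then have "\<rho> S y \<in> El ?E S" using Nat_in[OF r(1)] by blast
    then obtain n g where g: "arr S (X n) g" "\<rho> S y = Fm ?E S (X n) g (?e n)"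
      using seq_colim_gen[OF s cE S(1)] by metis
    then have "y = Fm F S (X n) g (\<xi> n)" using inv[OF S] Nat_act[OF t(1) g(1) E(2)] t(2) by simp
    with g show "\<exists>n g. arr S (X n) g \<and> y = Fm F S (X n) g (\<xi> n)" by blast
  next
    fix S n g g' assume g: "arr S (X n) g \<and> arr S (X n) g' \<and> Fm F S (X n) g (\<xi> n) = Fm F S (X n) g' (\<xi> n)"
    then have "Fm ?E S (X n) g (?e n) = Fm ?E S (X n) g' (?e n)"
      using Nat_act[OF r(1) _ x(1)] r' by metis
    then show "\<exists>m\<ge>n. push X f S n m g = push X f S n m g'"
      using seq_colim_eq[OF s cE] g by metis
  qed (use F x in auto)
  then show ?thesis using x(3) that by blast
qed

end

section \<open>Shifting modules\<close>

context category_with_shift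
begin

lemma ModSh_sel:
  "X \<in> Ob C \<Longrightarrow> Fo (ModSh C F) X = Fo F (ShI C X)"
  "arr X Y f \<Longrightarrow> Fm (ModSh C F) X Y f = Fm F (ShI C X) (ShI C Y) (ShMI C X Y f)"
  by (simp_all add: ModSh_def arr_def)

lemma Mods_extensional:
  assumes "F \<in> Mods C"
  shows "Fo F \<in> extensional (Ob C)" "arr X Y f \<Longrightarrow> Fm F X Y f \<in> extensional (El F Y)"
    "\<not> arr X Y f \<Longrightarrow> Fm F X Y f = undefined"
proof -
  have "Fo F \<in> extensional (Ob C) \<and> (\<forall>X Y f. if X \<in> Ob C \<and> Y \<in> Ob C \<and> f \<in> Mor C X Y
      then Fm F X Y f \<in> extensional (El F Y) else Fm F X Y f = undefined)"
    using assms unfolding Mods_def mem_Collect_eq by (elim conjE) (rule conjI)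
  then show "Fo F \<in> extensional (Ob C)" "arr X Y f \<Longrightarrow> Fm F X Y f \<in> extensional (El F Y)"
    "\<not> arr X Y f \<Longrightarrow> Fm F X Y f = undefined"
    unfolding arr_def by metis+
qed

text \<open>Restriction of a module along the additive endofunctor given by \<open>s\<close> and \<open>t\<close>.\<close>

lemma restricted_module_in:
  assumes F: "F \<in> Mods C"
    and G: "G = \<lparr>Fo = (\<lambda>X\<in>Ob C. Fo F (s X)), Fm = (\<lambda>X Y f. if X \<in> Ob C \<and> Y \<in> Ob C \<and> f \<in> Mor C X Y
      then Fm F (s X) (s Y) (t X Y f) else undefined)\<rparr>"
    and s: "\<And>X. X \<in> Ob C \<Longrightarrow> s X \<in> Ob C"
    and t: "\<And>X Y f. arr X Y f \<Longrightarrow> arr (s X) (s Y) (t X Y f)"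
    and id: "\<And>X. X \<in> Ob C \<Longrightarrow> t X X (Idm C X) = Idm C (s X)"
    and comp: "\<And>X Y Z f g. \<lbrakk>arr X Y f; arr Y Z g\<rbrakk>
      \<Longrightarrow> t X Z (Comp C X Y Z g f) = Comp C (s X) (s Y) (s Z) (t Y Z g) (t X Y f)"
    and add: "\<And>X Y f g. \<lbrakk>arr X Y f; arr X Y g\<rbrakk>
      \<Longrightarrow> t X Y (f \<oplus>\<^bsub>Hom C X Y\<^esub> g) = t X Y f \<oplus>\<^bsub>Hom C (s X) (s Y)\<^esub> t X Y g"
  shows "G \<in> Mods C"
proof -
  have o: "X \<in> Ob C \<Longrightarrow> Fo G X = Fo F (s X)"
    and m: "arr X Y f \<Longrightarrow> Fm G X Y f = Fm F (s X) (s Y) (t X Y f)" for X Y f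
    by (simp_all add: G arr_def)
  show ?thesis
  proof (rule ModsI)
    fix X Y f g y assume a: "arr X Y f" "arr X Y g" "y \<in> El G Y"
    then show "Fm G X Y (f \<oplus>\<^bsub>Hom C X Y\<^esub> g) y = Fm G X Y f y \<oplus>\<^bsub>Fo G X\<^esub> Fm G X Y g y"
      using act_add_arr[OF F t[OF a(1)] t[OF a(2)]] by (simp add: o m arrD add)
  next
    show "Fo G \<in> extensional (Ob C)" by (simp add: G)
    fix X Y f assume "\<not> arr X Y f"
    then show "Fm G X Y f = undefined" by (auto simp: G arr_def)
  next
    fix X Y f assume a: "arr X Y f"
    then show "Fm G X Y f \<in> extensional (El G Y)"
      using Mods_extensional(2)[OF F t[OF a]] by (simp add: o m arrD)
  next
    fix X Y Z f g z assume a: "arr X Y f" "arr Y Z g" "z \<in> El G Z"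
    then show "Fm G X Z (Comp C X Y Z g f) z = Fm G X Y f (Fm G Y Z g z)"
      using act_comp[OF F t[OF a(1)] t[OF a(2)]] arr_comp[OF a(1,2)] by (simp add: o m arrD comp)
  qed (use F s t id Mods_group[OF F] act_in[OF F] act_add[OF F] in \<open>simp_all add: o m arrD\<close>)
qed

lemma ModSh_in: "F \<in> Mods C \<Longrightarrow> ModSh C F \<in> Mods C"
  by (rule restricted_module_in[OF _ ModSh_def]) (simp_all add: ShMI_id ShMI_comp ShMI_add)

text \<open>
  The inverse of \<open>ModSh\<close>, up to equality and not only isomorphism; this is what describes the image of
  a class of modules under the shift of the completion.
\<close>

definition ModShI :: "('o, 'm, 'g) cmod \<Rightarrow> ('o, 'm, 'g) cmod"
  where "ModShI F = \<lparr>Fo = (\<lambda>X\<in>Ob C. Fo F (Sh C X)),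
     Fm = (\<lambda>X Y f. if X \<in> Ob C \<and> Y \<in> Ob C \<and> f \<in> Mor C X Y
       then Fm F (Sh C X) (Sh C Y) (ShM C X Y f) else undefined)\<rparr>"

lemma ModShI_sel:
  "X \<in> Ob C \<Longrightarrow> Fo (ModShI F) X = Fo F (Sh C X)"
  "arr X Y f \<Longrightarrow> Fm (ModShI F) X Y f = Fm F (Sh C X) (Sh C Y) (ShM C X Y f)"
  by (simp_all add: ModShI_def arr_def)

lemma ModShI_in: "F \<in> Mods C \<Longrightarrow> ModShI F \<in> Mods C"
  by (rule restricted_module_in[OF _ ModShI_def]) (simp_all add: shm_id ShM_comp shm_add arrD)

lemma ModSh_ModShI:
  assumes F: "F \<in> Mods C" shows "ModSh C (ModShI F) = F"
proof (rule cmod.equality)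
  show "Fo (ModSh C (ModShI F)) = Fo F"
    by (rule extensionalityI[OF _ Mods_extensional(1)[OF F]]) (simp_all add: ModSh_sel ModShI_sel ModSh_def[of C "ModShI F"])
  show "Fm (ModSh C (ModShI F)) = Fm F"
  proof (intro ext)
    fix X Y f y
    show "Fm (ModSh C (ModShI F)) X Y f y = Fm F X Y f y"
    proof (cases "arr X Y f")
      case True
      then show ?thesis by (simp add: ModSh_sel ModShI_sel(2)[OF arr_ShMI] arrD)
    next
      case False
      then show ?thesis using Mods_extensional(3)[OF F False] by (auto simp: ModSh_def arr_def)
    qed
  qed
qed simp

text \<open>
  Under the Yoneda lemma the shift of a map out of \<open>Y(T)\<close> corresponds to the same element, since
  \<open>(\<Sigma>F)(\<Sigma>T) = F(T)\<close>.
\<close>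

lemma YoSh_yon:
  assumes "F \<in> Mods C" "T \<in> Ob C"
  shows "YoSh C T (yon F T \<xi>) = yon (ModSh C F) (Sh C T) \<xi>"
  unfolding YoSh_def yon_def[of "ModSh C F"]
proof (intro restrict_ext)
  fix X g assume "X \<in> Ob C" "g \<in> Mor C X (Sh C T)"
  then have g: "arr X (Sh C T) g" using assms by (simp add: arr_def)
  show "yon F T \<xi> (ShI C X) (ShMI C X (Sh C T) g) = Fm (ModSh C F) X (Sh C T) g \<xi>"
    using arr_ShMI[OF g] assms g by (simp add: ModSh_sel)
qed

end

section \<open>Representability, vanishing and exactness\<close>

context additive_category
begin

definition represents :: "('o, 'm, 'g) cmod \<Rightarrow> 'o \<Rightarrow> 'g \<Rightarrow> bool"
  where "represents F Q \<xi> \<longleftrightarrow> F \<in> Mods C \<and> Q \<in> Ob C \<and> \<xi> \<in> El F Q \<and>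
    (\<forall>S\<in>Ob C. bij_betw (\<lambda>g. Fm F S Q g \<xi>) (Mor C S Q) (El F S))"

definition vanishes :: "('o, 'm, 'g) cmod \<Rightarrow> 'o \<Rightarrow> bool"
  where "vanishes F S \<longleftrightarrow> S \<in> Ob C \<and> (\<forall>y\<in>El F S. y = \<zero>\<^bsub>Fo F S\<^esub>)"

lemma representsI:
  assumes "F \<in> Mods C" "Q \<in> Ob C" "\<xi> \<in> El F Q"
    and "\<And>S g. \<lbrakk>arr S Q g; Fm F S Q g \<xi> = \<zero>\<^bsub>Fo F S\<^esub>\<rbrakk> \<Longrightarrow> g = \<zero>\<^bsub>Hom C S Q\<^esub>"
    and "\<And>S y. \<lbrakk>S \<in> Ob C; y \<in> El F S\<rbrakk> \<Longrightarrow> \<exists>g. arr S Q g \<and> y = Fm F S Q g \<xi>"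
  shows "represents F Q \<xi>"
  unfolding represents_def
proof (intro conjI ballI)
  fix S assume S: "S \<in> Ob C"
  interpret S: abelian_group "Fo F S" using Mods_group[OF assms(1) S] .
  interpret H: abelian_group "Hom C S Q" using hom_group[OF S assms(2)] .
  have inj: "g = h" if g: "g \<in> Mor C S Q" "h \<in> Mor C S Q" "Fm F S Q g \<xi> = Fm F S Q h \<xi>" for g h
  proof -
    have a: "arr S Q g" "arr S Q h" using g S assms(2) by (simp_all add: arr_def)
    have n: "arr S Q (\<ominus>\<^bsub>Hom C S Q\<^esub> h)" using a by simp
    have "Fm F S Q (g \<oplus>\<^bsub>Hom C S Q\<^esub> (\<ominus>\<^bsub>Hom C S Q\<^esub> h)) \<xi> = Fm F S Q (h \<oplus>\<^bsub>Hom C S Q\<^esub> (\<ominus>\<^bsub>Hom C S Q\<^esub> h)) \<xi>"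
      using act_add_arr[OF assms(1) a(1) n assms(3)] act_add_arr[OF assms(1) a(2) n assms(3)] g(3) by simp
    also have "\<dots> = \<zero>\<^bsub>Fo F S\<^esub>" using diff_self[OF a(2)] assms S by simp
    finally show ?thesis using assms(4)[OF arr_add[OF a(1) n]] diff_eq_zero[OF a] by blast
  qed
  show "bij_betw (\<lambda>g. Fm F S Q g \<xi>) (Mor C S Q) (El F S)"
    unfolding bij_betw_def inj_on_def
  proof (intro conjI ballI impI equalityI subsetI)
    fix y assume "y \<in> (\<lambda>g. Fm F S Q g \<xi>) ` Mor C S Q"
    then show "y \<in> El F S" using act_in[OF assms(1) _ assms(3)] S assms(2) by (auto simp: arr_def)
  next
    fix y assume "y \<in> El F S"
    then show "y \<in> (\<lambda>g. Fm F S Q g \<xi>) ` Mor C S Q" using assms(5)[OF S] by (auto simp: arr_def)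
  qed (rule inj)
qed (use assms in auto)

lemma represents_surj:
  assumes "represents F Q \<xi>" "S \<in> Ob C" "y \<in> El F S"
  obtains g where "arr S Q g" "y = Fm F S Q g \<xi>"
  using assms unfolding represents_def bij_betw_def by (auto simp: arr_def image_iff)

lemma represents_inj:
  "\<lbrakk>represents F Q \<xi>; arr S Q g; arr S Q h; Fm F S Q g \<xi> = Fm F S Q h \<xi>\<rbrakk> \<Longrightarrow> g = h"
  unfolding represents_def bij_betw_def inj_on_def arr_def by blast

lemma representsD: "represents F Q \<xi> \<Longrightarrow> F \<in> Mods C" "represents F Q \<xi> \<Longrightarrow> Q \<in> Ob C" "represents F Q \<xi> \<Longrightarrow> \<xi> \<in> El F Q"
  by (simp_all add: represents_def)

lemma represents_vanishes:
  assumes r: "represents F Q \<xi>" and S: "S \<in> Ob C" shows "vanishes F S \<longleftrightarrow> orth S Q"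
proof
  note D = representsD[OF r]
  assume v: "vanishes F S"
  show "orth S Q"
  proof (rule orthI[OF S D(2)])
    fix g assume g: "arr S Q g"
    then have "Fm F S Q g \<xi> = Fm F S Q \<zero>\<^bsub>Hom C S Q\<^esub> \<xi>"
      using v act_in[OF D(1) g D(3)] D S by (simp add: vanishes_def)
    then show "g = \<zero>\<^bsub>Hom C S Q\<^esub>" using represents_inj[OF r g arr_zero[OF S D(2)]] by blast
  qed
next
  note D = representsD[OF r]
  assume o: "orth S Q"
  show "vanishes F S"
    unfolding vanishes_def
  proof (intro conjI ballI S)
    fix y assume "y \<in> El F S"
    then obtain g where "arr S Q g" "y = Fm F S Q g \<xi>" using represents_surj[OF r S] by blast
    then show "y = \<zero>\<^bsub>Fo F S\<^esub>" using orthD[OF o, of g] D S act_zero_arr by metis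
  qed
qed

lemma seq_const: "Q \<in> Ob C \<Longrightarrow> seq (\<lambda>_. Q) (\<lambda>_. Idm C Q)"
  by (simp add: seq_def)

lemma represents_seq_colim:
  assumes r: "represents F Q \<xi>" shows "seq_colim (\<lambda>_. Q) (\<lambda>_. Idm C Q) F (\<lambda>_. \<xi>)"
  unfolding seq_colim_def
proof (intro conjI allI impI ballI)
  note D = representsD[OF r]
  show "Fm F Q Q (Idm C Q) \<xi> = \<xi>" using D by simp
  show "\<exists>n::nat. \<exists>g. arr S Q g \<and> y = Fm F S Q g \<xi>" if "S \<in> Ob C" "y \<in> El F S" for S y
    using represents_surj[OF r that] by blast
  fix S n g h assume g: "arr S Q g \<and> arr S Q h \<and> Fm F S Q g \<xi> = Fm F S Q h \<xi>"
  then have "g = h" using represents_inj[OF r] by blast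
  then show "\<exists>m\<ge>n. Comp C S Q Q (tr (\<lambda>_. Q) (\<lambda>_. Idm C Q) n m) g = Comp C S Q Q (tr (\<lambda>_. Q) (\<lambda>_. Idm C Q) n m) h"
    by blast
qed (use representsD[OF r] in auto)

lemma represents_isomorphic:
  assumes r: "represents F Q \<xi>" shows "mod_isomorphic C F (Yo C Q)"
proof -
  note D = representsD[OF r]
  define h where "h S y = (THE g. arr S Q g \<and> y = Fm F S Q g \<xi>)" for S y
  have h: "h S (Fm F S Q g \<xi>) = g" if "arr S Q g" for S g
    unfolding h_def using that represents_inj[OF r] by (intro the_equality) auto
  have rep: "arr S Q (h S y) \<and> Fm F S Q (h S y) \<xi> = y" if "S \<in> Ob C" "y \<in> El F S" for S y
    using represents_surj[OF r that] h by metis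
  let ?h = "\<lambda>S\<in>Ob C. \<lambda>y\<in>El F S. h S y"
  have hn: "?h \<in> NatTr C F (Yo C Q)"
  proof (rule NatTrI)
    fix S y assume "S \<in> Ob C" "y \<in> El F S"
    then show "h S y \<in> El (Yo C Q) S" using rep by (simp add: arr_def)
  next
    fix S y z assume S: "S \<in> Ob C" "y \<in> El F S" "z \<in> El F S"
    have "y \<oplus>\<^bsub>Fo F S\<^esub> z = Fm F S Q (h S y \<oplus>\<^bsub>Hom C S Q\<^esub> h S z) \<xi>"
      using rep[OF S(1,2)] rep[OF S(1,3)] act_add_arr[OF D(1) _ _ D(3)] by metis
    then show "h S (y \<oplus>\<^bsub>Fo F S\<^esub> z) = h S y \<oplus>\<^bsub>Fo (Yo C Q) S\<^esub> h S z"
      using h arr_add rep[OF S(1,2)] rep[OF S(1,3)] S(1) by simp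
  next
    fix S T a y assume a: "arr S T a" "y \<in> El F T"
    note ra = rep[OF arrD(2)[OF a(1)] a(2)]
    have "Fm F S T a y = Fm F S Q (Comp C S T Q (h T y) a) \<xi>"
      using ra act_comp[OF D(1) a(1) conjunct1[OF ra] D(3)] by simp
    then show "h S (Fm F S T a y) = Fm (Yo C Q) S T a (h T y)"
      using h arr_comp[OF a(1) conjunct1[OF ra]] ra a by (simp add: arrD)
  qed (use Mods_group[OF D(1)] Yo_group D(2) act_in[OF D(1)] in auto)
  note yn = yon_in[OF D]
  have c1: "NatComp C F (yon F Q \<xi>) ?h = NatId C F"
    unfolding NatComp_def NatId_def using rep by (intro restrict_ext) simp
  have "yon F Q \<xi> S g \<in> El F S \<and> ?h S (yon F Q \<xi> S g) = g" if "S \<in> Ob C" "g \<in> El (Yo C Q) S" for S g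
  proof -
    have g: "arr S Q g" using that D(2) by (simp add: arr_def)
    then show ?thesis using h act_in[OF D(1) g D(3)] that(1) by simp
  qed
  then have c2: "NatComp C (Yo C Q) ?h (yon F Q \<xi>) = NatId C (Yo C Q)"
    unfolding NatComp_def NatId_def by (intro restrict_ext) metis
  show ?thesis unfolding mod_isomorphic_def using hn yn c1 c2 by blast
qed

lemma Yo_image_vanishes:
  assumes i: "mod_isomorphic C P (Yo C W)" and o: "orth S W"
  shows "vanishes P S"
proof -
  have S: "S \<in> Ob C" "W \<in> Ob C" using o by (auto dest: orth_Ob)
  obtain \<eta> \<theta> where n: "\<eta> \<in> NatTr C P (Yo C W)" "\<theta> \<in> NatTr C (Yo C W) P" "NatComp C P \<theta> \<eta> = NatId C P"
    using i unfolding mod_isomorphic_def by blast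
  have "y = \<zero>\<^bsub>Fo P S\<^esub>" if y: "y \<in> El P S" for y
  proof -
    have "\<eta> S y \<in> Mor C S W" using Nat_in[OF n(1) S(1) y] S by simp
    then have "\<eta> S y = \<zero>\<^bsub>Fo (Yo C W) S\<^esub>" using orthD[OF o] S by (simp add: arr_def)
    moreover have "\<theta> S (\<eta> S y) = y" using n(3) NatComp_apply[OF S(1) y, of \<theta> \<eta>] S(1) y by simp
    ultimately show ?thesis using Nat_zero[OF n(2) S(1)] by simp
  qed
  then show ?thesis using S by (simp add: vanishes_def)
qed

lemma seq_colim_vanishes:
  assumes s: "seq X f" and c: "seq_colim X f F \<xi>" and o: "\<And>n. orth S (X n)" shows "vanishes F S"
  unfolding vanishes_def
proof (intro conjI ballI)
  show S: "S \<in> Ob C" by (rule orth_Ob(1)[OF o[of 0]])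
  fix y assume "y \<in> El F S"
  then obtain n g where "arr S (X n) g" "y = Fm F S (X n) g (\<xi> n)" using seq_colim_gen[OF s c S] by metis
  then show "y = \<zero>\<^bsub>Fo F S\<^esub>"
    using orthD[OF o[of n], of g] act_zero_arr[OF seq_colimD(1)[OF c] S seq_Ob[OF s] seq_colimD(2)[OF c]] by simp
qed

lemma tr_natural:
  assumes s: "seq X f" and t: "seq Y g" and u: "\<And>n. arr (X n) (Y n) (u n)"
    and c: "\<And>n. Comp C (X n) (Y n) (Y (Suc n)) (g (Suc n)) (u n)
      = Comp C (X n) (X (Suc n)) (Y (Suc n)) (u (Suc n)) (f (Suc n))"
    and le: "n \<le> m"
  shows "push Y g (X n) n m (u n) = Comp C (X n) (X m) (Y m) (u m) (tr X f n m)"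
  using le
proof (induction m rule: dec_induct)
  case base
  then show ?case using u by simp
next
  case (step m)
  have "Comp C (X n) (Y n) (Y (Suc m)) (tr Y g n (Suc m)) (u n)
     = Comp C (X n) (Y m) (Y (Suc m)) (g (Suc m)) (Comp C (X n) (X m) (Y m) (u m) (tr X f n m))"
    using step comp_assoc'[OF u tr_arr[OF t step(1)] seq_arr[OF t]] by (simp add: tr_Suc)
  also have "\<dots> = Comp C (X n) (X m) (Y (Suc m)) (Comp C (X m) (X (Suc m)) (Y (Suc m)) (u (Suc m)) (f (Suc m))) (tr X f n m)"
    using comp_assoc'[OF tr_arr[OF s step(1)] u seq_arr[OF t]] c by simp
  also have "\<dots> = Comp C (X n) (X (Suc m)) (Y (Suc m)) (u (Suc m)) (tr X f n (Suc m))"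
    using comp_assoc'[OF tr_arr[OF s step(1)] seq_arr[OF s] u] step(1) by (simp add: tr_Suc)
  finally show ?case .
qed

lemma seq_colim_map_of_seqs:
  assumes s: "seq X f" and c: "seq_colim X f F \<xi>" and t: "seq Y g" and G: "G \<in> Mods C"
    and h: "\<And>n. \<eta> n \<in> El G (Y n)" "\<And>n. Fm G (Y n) (Y (Suc n)) (g (Suc n)) (\<eta> (Suc n)) = \<eta> n"
    and u: "\<And>n. arr (X n) (Y n) (u n)"
    and cm: "\<And>n. Comp C (X n) (Y n) (Y (Suc n)) (g (Suc n)) (u n)
      = Comp C (X n) (X (Suc n)) (Y (Suc n)) (u (Suc n)) (f (Suc n))"
  obtains p where "p \<in> NatTr C F G"
    "\<And>n. NatComp C (Yo C (X n)) p (yon F (X n) (\<xi> n))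
      = NatComp C (Yo C (X n)) (yon G (Y n) (\<eta> n)) (YoM C (X n) (Y n) (u n))"
proof -
  note D = seq_colimD[OF c]
  let ?e = "\<lambda>n. Fm G (X n) (Y n) (u n) (\<eta> n)"
  have e: "?e n \<in> El G (X n)" for n by (rule act_in[OF G u h(1)])
  have e2: "Fm G (X n) (X (Suc n)) (f (Suc n)) (?e (Suc n)) = ?e n" for n
    using act_comp[OF G seq_arr[OF s] u h(1)] act_comp[OF G u seq_arr[OF t] h(1)] cm h(2) by metis
  obtain p where p: "p \<in> NatTr C F G" "\<And>n. p (X n) (\<xi> n) = ?e n"
    using seq_colim_map[where \<eta> = ?e, OF s c G e e2] by metis
  show ?thesis
  proof (rule that[OF p(1)])
    fix n
    show "NatComp C (Yo C (X n)) p (yon F (X n) (\<xi> n))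
      = NatComp C (Yo C (X n)) (yon G (Y n) (\<eta> n)) (YoM C (X n) (Y n) (u n))"
      using NatComp_yon[OF D(1) seq_Ob[OF s] D(2) p(1)] NatComp_yon_YoM[OF G u h(1)] p(2) by simp
  qed
qed

text \<open>
  Two sequences with the same colimit are isomorphic as ind-objects; in particular some transition
  map out of each term of one sequence factors through the other sequence.
\<close>

lemma tr_factors:
  assumes s: "seq X f" and c: "seq_colim X f F \<xi>" and t: "seq Y g" and d: "seq_colim Y g F \<eta>"
  obtains m k a b where "m \<ge> n" "m \<ge> N" "arr (X n) (Y k) a" "arr (Y k) (X m) b"
    "Comp C (X n) (Y k) (X m) b a = tr X f n m"
proof -
  note F = seq_colimD(1)[OF c] and x = seq_colimD(2)[OF c] and y = seq_colimD(2)[OF d]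
  note O = seq_Ob[OF s] and P = seq_Ob[OF t]
  obtain k a where a: "arr (X n) (Y k) a" "\<xi> n = Fm F (X n) (Y k) a (\<eta> k)"
    using seq_colim_gen[OF t d O x] by metis
  obtain l b where b: "l \<ge> n" "arr (Y k) (X l) b" "\<eta> k = Fm F (Y k) (X l) b (\<xi> l)"
    using seq_colim_gen[OF s c P y] by metis
  have ba: "arr (X n) (X l) (Comp C (X n) (Y k) (X l) b a)" using a b by simp
  have "Fm F (X n) (X l) (Comp C (X n) (Y k) (X l) b a) (\<xi> l) = Fm F (X n) (X l) (tr X f n l) (\<xi> l)"
    using act_comp[OF F a(1) b(2) x] a(2) b(3) seq_colim_tr[OF s c b(1)] by simp
  then obtain m where m: "m \<ge> l" "m \<ge> N" "push X f (X n) l m (Comp C (X n) (Y k) (X l) b a)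
      = push X f (X n) l m (tr X f n l)"
    using seq_colim_eq[OF s c ba tr_arr[OF s b(1)]] by metis
  then have "Comp C (X n) (Y k) (X m) (push X f (Y k) l m b) a = tr X f n m"
    using comp_assoc'[OF a(1) b(2) tr_arr[OF s m(1)]] tr_comp[OF s b(1) m(1)] by simp
  then show ?thesis using that[of m k a] m a b arr_comp[OF b(2) tr_arr[OF s m(1)]] by simp
qed

end

context category_with_shift
begin

lemma represents_ModShI:
  assumes r: "represents F (Sh C W) \<xi>" and W: "W \<in> Ob C" shows "represents (ModShI F) W \<xi>"
proof (rule representsI)
  note D = representsD[OF r]
  show "ModShI F \<in> Mods C" by (rule ModShI_in[OF D(1)])
  show "\<xi> \<in> El (ModShI F) W" using D W by (simp add: ModShI_sel)
  fix S g assume g: "arr S W g" "Fm (ModShI F) S W g \<xi> = \<zero>\<^bsub>Fo (ModShI F) S\<^esub>"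
  note S = arrD(1)[OF g(1)]
  have "Fm F (Sh C S) (Sh C W) (ShM C S W g) \<xi> = Fm F (Sh C S) (Sh C W) \<zero>\<^bsub>Hom C (Sh C S) (Sh C W)\<^esub> \<xi>"
    using g S D by (simp add: ModShI_sel)
  then have "ShM C S W g = ShM C S W \<zero>\<^bsub>Hom C S W\<^esub>"
    using represents_inj[OF r arr_ShM[OF g(1)] arr_zero] S W by simp
  then show "g = \<zero>\<^bsub>Hom C S W\<^esub>" using ShM_inj g S W by simp
next
  fix S y assume S: "S \<in> Ob C" "y \<in> El (ModShI F) S"
  then obtain g where g: "arr (Sh C S) (Sh C W) g" "y = Fm F (Sh C S) (Sh C W) g \<xi>"
    using represents_surj[OF r Sh_Ob[OF S(1)]] by (metis ModShI_sel(1))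
  then show "\<exists>g. arr S W g \<and> y = Fm (ModShI F) S W g \<xi>"
    using ShM_surj[OF g(1) S(1) W] by (metis ModShI_sel(2))
qed (rule W)

lemma seq_ShM: "seq X f \<Longrightarrow> seq (\<lambda>n. Sh C (X n)) (\<lambda>n. ShM C (X (n - 1)) (X n) (f n))"
  by (simp add: seq_def)

end

context triangulated_category
begin

text \<open>
  Exactness in the middle: a map \<open>S \<rightarrow> Y n\<close> becomes zero in some later \<open>Z m\<close>, hence lifts to \<open>X m\<close>, and
  the lift becomes zero at a still later stage.
\<close>

lemma colim_vanishes_middle:
  assumes s: "seq X a" "seq Y b" "seq Z c"
    and t: "\<And>n. (X n, Y n, Z n, u n, v n, w n) \<in> Tri C"
    and uc: "\<And>n. Comp C (X n) (Y n) (Y (Suc n)) (b (Suc n)) (u n) = Comp C (X n) (X (Suc n)) (Y (Suc n)) (u (Suc n)) (a (Suc n))"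
    and vc: "\<And>n. Comp C (Y n) (Z n) (Z (Suc n)) (c (Suc n)) (v n) = Comp C (Y n) (Y (Suc n)) (Z (Suc n)) (v (Suc n)) (b (Suc n))"
    and F: "seq_colim X a F \<xi>" "vanishes F S" and H: "seq_colim Z c H \<zeta>" "vanishes H S"
    and G: "seq_colim Y b G \<eta>"
  shows "vanishes G S"
  unfolding vanishes_def
proof (intro conjI ballI)
  show S: "S \<in> Ob C" using F(2) by (simp add: vanishes_def)
  fix y assume "y \<in> El G S"
  then obtain n g where g: "arr S (Y n) g" "y = Fm G S (Y n) g (\<eta> n)"
    using seq_colim_gen[OF s(2) G S] by metis
  have vg: "arr S (Z n) (Comp C S (Y n) (Z n) (v n) g)" using g tri_arr[OF t] by simp
  have "Fm H S (Z n) (Comp C S (Y n) (Z n) (v n) g) (\<zeta> n) = \<zero>\<^bsub>Fo H S\<^esub>"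
    using H(2) act_in[OF seq_colimD(1)[OF H(1)] vg seq_colimD(2)[OF H(1)]] by (simp add: vanishes_def)
  then obtain m where m: "m \<ge> n" "push Z c S n m (Comp C S (Y n) (Z n) (v n) g) = \<zero>\<^bsub>Hom C S (Z m)\<^esub>"
    using seq_colim_kill[OF s(3) H(1) vg] by metis
  let ?g = "push Y b S n m g"
  have ga: "arr S (Y m) ?g" using g(1) tr_arr[OF s(2) m(1)] by simp
  have "Comp C S (Y m) (Z m) (v m) ?g = \<zero>\<^bsub>Hom C S (Z m)\<^esub>"
    using m(2) tr_natural[OF s(2,3) tri_arr(2)[OF t] vc m(1)]
      comp_assoc'[OF g(1) tri_arr(2)[OF t] tr_arr[OF s(3) m(1)]]
      comp_assoc'[OF g(1) tr_arr[OF s(2) m(1)] tri_arr(2)[OF t]] by simp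
  then obtain h where h: "arr S (X m) h" "Comp C S (X m) (Y m) (u m) h = ?g"
    using factor_fiber[OF t ga] by blast
  have "Fm F S (X m) h (\<xi> m) = \<zero>\<^bsub>Fo F S\<^esub>"
    using F(2) act_in[OF seq_colimD(1)[OF F(1)] h(1) seq_colimD(2)[OF F(1)]] by (simp add: vanishes_def)
  then obtain l where l: "l \<ge> m" "push X a S m l h = \<zero>\<^bsub>Hom C S (X l)\<^esub>"
    using seq_colim_kill[OF s(1) F(1) h(1)] by metis
  have "push Y b S m l ?g = \<zero>\<^bsub>Hom C S (Y l)\<^esub>"
    using l(2) h tr_natural[OF s(1,2) tri_arr(1)[OF t] uc l(1)] tri_arr[OF t] S
      comp_assoc'[OF h(1) tri_arr(1)[OF t] tr_arr[OF s(2) l(1)]]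
      comp_assoc'[OF h(1) tr_arr[OF s(1) l(1)] tri_arr(1)[OF t]] by (metis comp_zero_right)
  then have "y = Fm G S (Y l) \<zero>\<^bsub>Hom C S (Y l)\<^esub> (\<eta> l)"
    using g seq_colim_push[OF s(2) G m(1) g(1)] seq_colim_push[OF s(2) G l(1) ga] by simp
  then show "y = \<zero>\<^bsub>Fo G S\<^esub>" using S seq_Ob[OF s(2)] seq_colimD[OF G] by simp
qed

text \<open>
  The orthogonality makes each \<open>Hom(S, X n) \<rightarrow> Hom(S, Y n)\<close> injective, and so \<open>F(S) \<rightarrow> G(S)\<close> is.
\<close>

lemma colim_vanishes_first:
  assumes s: "seq X a" "seq Y b"
    and t: "\<And>n. (X n, Y n, Z n, u n, v n, w n) \<in> Tri C"
    and uc: "\<And>n. Comp C (X n) (Y n) (Y (Suc n)) (b (Suc n)) (u n) = Comp C (X n) (X (Suc n)) (Y (Suc n)) (u (Suc n)) (a (Suc n))"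
    and F: "seq_colim X a F \<xi>" and G: "seq_colim Y b G \<eta>" "vanishes G S"
    and o: "\<And>n. orth (Sh C S) (Z n)"
  shows "vanishes F S"
  unfolding vanishes_def
proof (intro conjI ballI)
  show S: "S \<in> Ob C" using G(2) by (simp add: vanishes_def)
  fix y assume "y \<in> El F S"
  then obtain n g where g: "arr S (X n) g" "y = Fm F S (X n) g (\<xi> n)"
    using seq_colim_gen[OF s(1) F S] by metis
  have ug: "arr S (Y n) (Comp C S (X n) (Y n) (u n) g)" using g tri_arr[OF t] by simp
  have "Fm G S (Y n) (Comp C S (X n) (Y n) (u n) g) (\<eta> n) = \<zero>\<^bsub>Fo G S\<^esub>"
    using G(2) act_in[OF seq_colimD(1)[OF G(1)] ug seq_colimD(2)[OF G(1)]] by (simp add: vanishes_def)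
  then obtain m where m: "m \<ge> n" "push Y b S n m (Comp C S (X n) (Y n) (u n) g) = \<zero>\<^bsub>Hom C S (Y m)\<^esub>"
    using seq_colim_kill[OF s(2) G(1) ug] by metis
  let ?g = "push X a S n m g"
  have ga: "arr S (X m) ?g" using g(1) tr_arr[OF s(1) m(1)] by simp
  have "Comp C S (X m) (Y m) (u m) ?g = Comp C S (X m) (Y m) (u m) \<zero>\<^bsub>Hom C S (X m)\<^esub>"
    using m(2) tr_natural[OF s tri_arr(1)[OF t] uc m(1)] S tri_arr(1)[OF t]
      comp_assoc'[OF g(1) tri_arr(1)[OF t] tr_arr[OF s(2) m(1)]]
      comp_assoc'[OF g(1) tr_arr[OF s(1) m(1)] tri_arr(1)[OF t]] by simp
  then have "?g = \<zero>\<^bsub>Hom C S (X m)\<^esub>"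
    using cancel_fiber[OF t ga arr_zero _ o] S seq_Ob[OF s(1)] by blast
  then have "y = Fm F S (X m) \<zero>\<^bsub>Hom C S (X m)\<^esub> (\<xi> m)"
    using g seq_colim_push[OF s(1) F m(1) g(1)] by simp
  then show "y = \<zero>\<^bsub>Fo F S\<^esub>" using S seq_Ob[OF s(1)] seq_colimD[OF F] by simp
qed

text \<open>
  A sequential colimit of representable functors is cohomological, so the kernel of \<open>F(B) \<rightarrow> F(A)\<close> is
  the image of \<open>F(D)\<close>.
\<close>

lemma act_inj_if_cone_vanishes:
  assumes s: "seq X f" and c: "seq_colim X f F \<xi>" and t: "(A, B, D, z, j, k) \<in> Tri C"
    and v: "vanishes F D" and y: "y \<in> El F B" "y' \<in> El F B" "Fm F A B z y = Fm F A B z y'"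
  shows "y = y'"
proof -
  note F = seq_colimD(1)[OF c] and ta = tri_arr[OF t] and tO = tri_Ob[OF t]
  interpret B: abelian_group "Fo F B" using Mods_group[OF F tO(2)] .
  interpret A: abelian_group "Fo F A" using Mods_group[OF F tO(1)] .
  have ker: "x = \<zero>\<^bsub>Fo F B\<^esub>" if x: "x \<in> El F B" "Fm F A B z x = \<zero>\<^bsub>Fo F A\<^esub>" for x
  proof -
    obtain n g where g: "arr B (X n) g" "x = Fm F B (X n) g (\<xi> n)"
      using seq_colim_gen[OF s c tO(2) x(1)] by metis
    have gz: "arr A (X n) (Comp C A B (X n) g z)" using g ta by simp
    have "Fm F A (X n) (Comp C A B (X n) g z) (\<xi> n) = \<zero>\<^bsub>Fo F A\<^esub>"
      using act_comp[OF F ta(1) g(1) seq_colimD(2)[OF c]] g x by simp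
    then obtain m where m: "m \<ge> n" "push X f A n m (Comp C A B (X n) g z) = \<zero>\<^bsub>Hom C A (X m)\<^esub>"
      using seq_colim_kill[OF s c gz] by metis
    let ?g = "push X f B n m g"
    have ga: "arr B (X m) ?g" using g tr_arr[OF s m(1)] by simp
    have "Comp C A B (X m) ?g z = \<zero>\<^bsub>Hom C A (X m)\<^esub>"
      using comp_assoc'[OF ta(1) g(1) tr_arr[OF s m(1)]] m(2) by simp
    then obtain h where h: "arr D (X m) h" "Comp C B D (X m) h j = ?g" using factor_cone[OF t ga] by blast
    have "x = Fm F B D j (Fm F D (X m) h (\<xi> m))"
      using act_comp[OF F ta(2) h(1) seq_colimD(2)[OF c]] h(2) seq_colim_push[OF s c m(1) g(1)] g(2) by simp
    also have "Fm F D (X m) h (\<xi> m) = \<zero>\<^bsub>Fo F D\<^esub>"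
      using v act_in[OF F h(1) seq_colimD(2)[OF c]] by (simp add: vanishes_def)
    finally show ?thesis using F ta by simp
  qed
  have n: "\<ominus>\<^bsub>Fo F B\<^esub> y' \<in> El F B" using y by simp
  have "Fm F A B z (y \<oplus>\<^bsub>Fo F B\<^esub> (\<ominus>\<^bsub>Fo F B\<^esub> y')) = Fm F A B z (y' \<oplus>\<^bsub>Fo F B\<^esub> (\<ominus>\<^bsub>Fo F B\<^esub> y'))"
    using act_add[OF F ta(1) y(1) n] act_add[OF F ta(1) y(2) n] y(3) by simp
  also have "\<dots> = \<zero>\<^bsub>Fo F A\<^esub>" using y F ta by (simp add: B.r_neg)
  finally have "y \<oplus>\<^bsub>Fo F B\<^esub> (\<ominus>\<^bsub>Fo F B\<^esub> y') = \<zero>\<^bsub>Fo F B\<^esub>" using ker y by simp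
  then show ?thesis using y by (metis B.a_inv_closed B.minus_equality B.minus_minus)
qed

end

section \<open>Torsion pairs\<close>

context triangulated_category
begin

text \<open>
  A t-structure with the aisle moved by one: \<open>L\<close> is \<open>T\<^sup>\<le>\<^sup>-\<^sup>1\<close> and \<open>R\<close> is \<open>T\<^sup>\<ge>\<^sup>0\<close>. The proof uses this pair for
  the tilted aisle and its suspension for the tilted coaisle.
\<close>

definition torsion_pair :: "'o set \<Rightarrow> 'o set \<Rightarrow> bool"
  where "torsion_pair L R \<longleftrightarrow> full_subcategory C L \<and> full_subcategory C R \<and>
    (\<forall>U\<in>L. \<forall>V\<in>R. orth U V) \<and> Sh C ` L \<subseteq> L \<and>
    (\<forall>Z\<in>Ob C. \<exists>U\<in>L. \<exists>V\<in>R. \<exists>u v w. (U, Z, V, u, v, w) \<in> Tri C)"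

lemma torsion_pairD:
  assumes "torsion_pair L R"
  shows "full_subcategory C L" "full_subcategory C R" "\<lbrakk>U \<in> L; V \<in> R\<rbrakk> \<Longrightarrow> orth U V"
    "U \<in> L \<Longrightarrow> Sh C U \<in> L" "U \<in> L \<Longrightarrow> U \<in> Ob C" "V \<in> R \<Longrightarrow> V \<in> Ob C"
proof -
  have "full_subcategory C L \<and> full_subcategory C R \<and> (\<forall>U\<in>L. \<forall>V\<in>R. orth U V) \<and> Sh C ` L \<subseteq> L"
    using assms unfolding torsion_pair_def by (elim conjE) (intro conjI)
  then show f: "full_subcategory C L" "full_subcategory C R"
    and "\<lbrakk>U \<in> L; V \<in> R\<rbrakk> \<Longrightarrow> orth U V" "U \<in> L \<Longrightarrow> Sh C U \<in> L" by blast+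
  show "U \<in> L \<Longrightarrow> U \<in> Ob C" "V \<in> R \<Longrightarrow> V \<in> Ob C" using f unfolding full_subcategory_def by blast+
qed

lemma torsion_pairE:
  assumes "torsion_pair L R" "Z \<in> Ob C"
  obtains U V u v w where "U \<in> L" "V \<in> R" "(U, Z, V, u, v, w) \<in> Tri C"
proof -
  have "\<forall>Z\<in>Ob C. \<exists>U\<in>L. \<exists>V\<in>R. \<exists>u v w. (U, Z, V, u, v, w) \<in> Tri C"
    using assms(1) unfolding torsion_pair_def by (elim conjE)
  from bspec[OF this assms(2)] show ?thesis by (elim bexE exE) (rule that)
qed

lemma zero_ob_if_self_orth: "orth Z Z \<Longrightarrow> zero_ob C Z"
  using orthD[of Z Z "Idm C Z"] orth_Ob[of Z Z] by (simp add: zero_ob_iff)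

text \<open>
  The coaisle part \<open>V\<close> of such a \<open>Z\<close> lies between \<open>Z\<close> and \<open>\<Sigma>U\<close>, both of which admit only zero
  maps to it, so it is orthogonal to itself.
\<close>

lemma in_left_if_orth:
  assumes p: "torsion_pair L R" and Z: "Z \<in> Ob C" and o: "\<And>V. V \<in> R \<Longrightarrow> orth Z V"
  shows "Z \<in> L"
proof -
  note D = torsion_pairD[OF p]
  obtain U V u v w where t: "U \<in> L" "V \<in> R" "(U, Z, V, u, v, w) \<in> Tri C" using torsion_pairE[OF p Z] .
  have "orth V V" by (rule orth_cone_left[OF t(3) o[OF t(2)] D(3)[OF D(4)[OF t(1)] t(2)]])
  then have "is_iso C U Z u" using iso_if_cone_zero[OF t(3)] zero_ob_if_self_orth by blast
  then show ?thesis using full_subcategory_iso[OF D(1) t(1) _ Z] by blast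
qed

lemma in_right_if_orth:
  assumes p: "torsion_pair L R" and Z: "Z \<in> Ob C" and o: "\<And>U. U \<in> L \<Longrightarrow> orth U Z"
  shows "Z \<in> R"
proof -
  note D = torsion_pairD[OF p]
  obtain U V u v w where t: "U \<in> L" "V \<in> R" "(U, Z, V, u, v, w) \<in> Tri C" using torsion_pairE[OF p Z] .
  have "orth U U" by (rule orth_fiber_right[OF t(3) o[OF t(1)] D(3)[OF D(4)[OF t(1)] t(2)]])
  then have z: "zero_ob C U" by (rule zero_ob_if_self_orth)
  have "is_iso C Z V v" by (rule iso_if_fiber_zero[OF t(3) z])
  then obtain g where "arr Z V v" "arr V Z g" "Comp C Z V Z g v = Idm C Z" "Comp C V Z V v g = Idm C V"
    using is_isoE[OF _ Z D(6)[OF t(2)]] by blast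
  then have "is_iso C V Z g" by (blast intro: is_isoI)
  then show ?thesis using full_subcategory_iso[OF D(2) t(2) _ Z] by blast
qed

lemma full_subcategory_Sh:
  assumes U: "full_subcategory C U" shows "full_subcategory C (Sh C ` U)"
  unfolding full_subcategory_def
proof (intro conjI ballI impI)
  have Ob: "U \<subseteq> Ob C" using U by (simp add: full_subcategory_def)
  then show "Sh C ` U \<subseteq> Ob C" by auto
  fix X Y assume X: "X \<in> Sh C ` U" and Y: "Y \<in> Ob C" and i: "isomorphic C X Y"
  obtain X' where X': "X' \<in> U" "X' \<in> Ob C" "X = Sh C X'" using X Ob by blast
  obtain f where f: "is_iso C X Y f" using i by (auto simp: isomorphic_def)
  obtain g where g: "arr X Y f" "arr Y X g" "Comp C X Y X g f = Idm C X" "Comp C Y X Y f g = Idm C Y"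
    using is_isoE[OF f] X' Y Sh_Ob by metis
  have "is_iso C X' (ShI C Y) (ShMI C X Y f)"
  proof (rule is_isoI)
    show "arr X' (ShI C Y) (ShMI C X Y f)" using arr_ShMI[OF g(1)] X' by simp
    show "arr (ShI C Y) X' (ShMI C Y X g)" using arr_ShMI[OF g(2)] X' by simp
    show "Comp C X' (ShI C Y) X' (ShMI C Y X g) (ShMI C X Y f) = Idm C X'"
      using ShMI_comp[OF g(1,2)] g(3) ShMI_id[of X] X' by simp
    show "Comp C (ShI C Y) X' (ShI C Y) (ShMI C X Y f) (ShMI C Y X g) = Idm C (ShI C Y)"
      using ShMI_comp[OF g(2,1)] g(4) ShMI_id[of Y] X' Y by simp
  qed
  then have "ShI C Y \<in> U" using full_subcategory_iso[OF U X'(1)] Y by simp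
  then show "Y \<in> Sh C ` U" using Sh_ShI[OF Y] by (metis image_eqI)
qed

lemma torsion_pair_Sh:
  assumes p: "torsion_pair L R" shows "torsion_pair (Sh C ` L) (Sh C ` R)"
  unfolding torsion_pair_def
proof (intro conjI ballI)
  note D = torsion_pairD[OF p]
  show "full_subcategory C (Sh C ` L)" "full_subcategory C (Sh C ` R)" using D full_subcategory_Sh by blast+
  show "Sh C ` Sh C ` L \<subseteq> Sh C ` L" using D(4) by blast
  show "orth U V" if "U \<in> Sh C ` L" "V \<in> Sh C ` R" for U V
    using that D(3,5,6) orth_Sh_iff by blast
  fix Z assume Z: "Z \<in> Ob C"
  obtain U V u v w where t: "U \<in> L" "V \<in> R" "(U, ShI C Z, V, u, v, w) \<in> Tri C"
    using torsion_pairE[OF p ShI_Ob[OF Z]] .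
  show "\<exists>U\<in>Sh C ` L. \<exists>V\<in>Sh C ` R. \<exists>u v w. (U, Z, V, u, v, w) \<in> Tri C"
    using tri_rot[OF tri_rot[OF tri_rot[OF t(3)]]] t(1,2) unfolding Sh_ShI[OF Z] by blast
qed

lemma torsion_pair_zero:
  assumes p: "torsion_pair L R" and Z: "zero_ob C Z" shows "Z \<in> L"
  using in_left_if_orth[OF p zero_ob_Ob[OF Z]] zero_ob_orth(2)[OF Z] torsion_pairD(6)[OF p] by blast

lemma shifted_minus_one: "shifted C U (-1) = Sh C ` U"
  by (simp add: shifted_def ShP_def)

lemma t_structure_torsion_pair:
  assumes t: "t_structure C tle tge" shows "torsion_pair (Sh C ` tle) tge"
proof -
  have "full_subcategory C tle \<and> full_subcategory C tge \<and> Sh C ` tle \<subseteq> tle \<and>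
      (\<forall>X\<in>Sh C ` tle. \<forall>Y\<in>tge. hom_zero (Hom C X Y)) \<and> Ob C = star C (Sh C ` tle) tge"
    using t by (simp add: t_structure_def shifted_minus_one)
  then have f: "full_subcategory C tle" "full_subcategory C tge" "Sh C ` tle \<subseteq> tle"
    "\<And>X Y. \<lbrakk>X \<in> Sh C ` tle; Y \<in> tge\<rbrakk> \<Longrightarrow> hom_zero (Hom C X Y)"
    "Ob C = star C (Sh C ` tle) tge"
    by (elim conjE; blast)+
  note g = full_subcategory_Sh[OF f(1)]
  show ?thesis
    unfolding torsion_pair_def
  proof (intro conjI ballI)
    fix U V assume U: "U \<in> Sh C ` tle" and V: "V \<in> tge"
    have "U \<in> Ob C" "V \<in> Ob C" using U V f(2) g unfolding full_subcategory_def by blast+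
    then show "orth U V" using orth_iff_hom_zero f(4)[OF U V] by blast
  next
    fix Z assume "Z \<in> Ob C"
    then have "Z \<in> star C (Sh C ` tle) tge" using f(5) by simp
    then show "\<exists>U\<in>Sh C ` tle. \<exists>V\<in>tge. \<exists>u v w. (U, Z, V, u, v, w) \<in> Tri C"
      unfolding star_def mem_Collect_eq by (rule conjunct2)
  next
    show "Sh C ` Sh C ` tle \<subseteq> Sh C ` tle" by (rule image_mono[OF f(3)])
  qed (rule f g)+
qed

section \<open>Cauchy sequences\<close>

lemma good_metricD:
  assumes "good_metric C B"
  shows "B n \<subseteq> Ob C" "B (Suc n) \<subseteq> B n" "b \<in> B (Suc n) \<Longrightarrow> ShI C b \<in> B n" "b \<in> B (Suc n) \<Longrightarrow> Sh C b \<in> B n"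
    "\<exists>Z\<in>B n. zero_ob C Z"
proof -
  have "full_subcategory C (B n) \<and> (\<exists>Z\<in>B n. zero_ob C Z) \<and>
      ShI C ` B (Suc n) \<union> B (Suc n) \<union> Sh C ` B (Suc n) \<subseteq> B n"
    using assms unfolding good_metric_def by (elim allE conjE) (intro conjI)
  then show "B n \<subseteq> Ob C" "B (Suc n) \<subseteq> B n" "b \<in> B (Suc n) \<Longrightarrow> ShI C b \<in> B n" "b \<in> B (Suc n) \<Longrightarrow> Sh C b \<in> B n"
    "\<exists>Z\<in>B n. zero_ob C Z" unfolding full_subcategory_def by auto
qed

lemma good_metric_anti: "good_metric C B \<Longrightarrow> n \<le> m \<Longrightarrow> B m \<subseteq> B n"
  using good_metricD(2) by (metis lift_Suc_antimono_le)

text \<open>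
  By iteration, a metric that enters \<open>K\<close> also enters every suspension of \<open>K\<close>; this is how extendability
  controls cones.
\<close>

lemma good_metric_Sh:
  assumes g: "good_metric C B" and B: "B n \<subseteq> K" shows "B (Suc n) \<subseteq> Sh C ` K"
proof
  fix b assume b: "b \<in> B (Suc n)"
  then have "b = Sh C (ShI C b)" "ShI C b \<in> K" using good_metricD[OF g] B by (blast intro: Sh_ShI[symmetric])+
  then show "b \<in> Sh C ` K" by blast
qed

lemma cauchy_seq: "cauchy C B X f \<Longrightarrow> seq X f"
  unfolding cauchy_def seq_def arr_def by blast

text \<open>
  The definition asks for cones in \<open>B i\<close> with \<open>i \<ge> 1\<close> only; \<open>B 0\<close> is reached because the metric decreases.
\<close>

lemma cauchy_cones:
  assumes g: "good_metric C B" and c: "cauchy C B X f"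
  obtains n where "\<And>j. j \<ge> n \<Longrightarrow> \<exists>D\<in>B i. \<exists>p q. (X j, X (Suc j), D, f (Suc j), p, q) \<in> Tri C"
proof -
  have "\<exists>n\<ge>1. \<forall>j\<ge>n. cone_in C (X (j - 1)) (X j) (f j) (B (Suc i))"
    using c unfolding cauchy_def by (metis le_add1 plus_1_eq_Suc)
  then obtain n where n: "\<And>j. j \<ge> n \<Longrightarrow> cone_in C (X (j - 1)) (X j) (f j) (B (Suc i))" by blast
  have "\<exists>D\<in>B i. \<exists>p q. (X j, X (Suc j), D, f (Suc j), p, q) \<in> Tri C" if "j \<ge> n" for j
    using n[of "Suc j"] that good_metricD(2)[OF g, of i] by (auto simp: cone_in_def)
  then show ?thesis by (rule that)
qed

lemma cauchyI:
  assumes s: "seq X f"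
    and c: "\<And>i. \<exists>n. \<forall>j\<ge>n. \<exists>D\<in>B i. \<exists>p q. (X j, X (Suc j), D, f (Suc j), p, q) \<in> Tri C"
  shows "cauchy C B X f"
  unfolding cauchy_def
proof (intro conjI allI impI)
  show "X n \<in> Ob C" "f (Suc n) \<in> Mor C (X n) (X (Suc n))" for n using s by (simp_all add: seq_def arr_def)
  fix i
  obtain n where n: "\<forall>j\<ge>n. \<exists>D\<in>B i. \<exists>p q. (X j, X (Suc j), D, f (Suc j), p, q) \<in> Tri C" using c by blast
  have "cone_in C (X (j - 1)) (X j) (f j) (B i)" if "j \<ge> Suc n" for j
    using that n by (cases j) (auto simp: cone_in_def)
  then show "\<exists>n\<ge>1. \<forall>j\<ge>n. cone_in C (X (j - 1)) (X j) (f j) (B i)" by (intro exI[of _ "Suc n"]) simp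
qed

lemma tri_of_iso:
  assumes i: "is_iso C X Y f" and X: "X \<in> Ob C" "Y \<in> Ob C" and N: "zero_ob C N"
  shows "(X, Y, N, f, \<zero>\<^bsub>Hom C Y N\<^esub>, \<zero>\<^bsub>Hom C N (Sh C X)\<^esub>) \<in> Tri C"
proof -
  note N' = zero_ob_Ob[OF N]
  obtain g where f: "arr X Y f" using is_isoE[OF i X] .
  show ?thesis
    by (rule tri_iso[OF tri_id[OF X(1) N], of X Y N _ _ _ "Idm C X" f "Idm C N"])
      (use f i X N' in \<open>auto simp: tri_morphism_def id_iso id_in shm_id arrD(3)[OF arr_zero] arrD(3)\<close>)
qed

lemma cauchy_const:
  assumes g: "good_metric C B" and Q: "Q \<in> Ob C" shows "cauchy C B (\<lambda>_. Q) (\<lambda>_. Idm C Q)"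
  by (rule cauchyI[OF seq_const[OF Q]]) (use good_metricD(5)[OF g] tri_id[OF Q] in blast)

lemma cauchy_tail:
  assumes g: "good_metric C B" and c: "cauchy C B X f"
  shows "cauchy C B (\<lambda>n. X (N + n)) (\<lambda>n. f (N + n))"
proof (rule cauchyI)
  show "seq (\<lambda>n. X (N + n)) (\<lambda>n. f (N + n))" using cauchy_seq[OF c] by (simp add: seq_def)
  fix i
  obtain n where n: "\<And>j. j \<ge> n \<Longrightarrow> \<exists>D\<in>B i. \<exists>p q. (X j, X (Suc j), D, f (Suc j), p, q) \<in> Tri C"
    by (rule cauchy_cones[OF g c, where i = i]) (rule that)
  then show "\<exists>n. \<forall>j\<ge>n. \<exists>D\<in>B i. \<exists>p q. (X (N + j), X (N + Suc j), D, f (N + Suc j), p, q) \<in> Tri C"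
    by (intro exI[of _ n]) simp
qed

lemma tr_tail: "n \<le> m \<Longrightarrow> tr (\<lambda>n. X (N + n)) (\<lambda>n. f (N + n)) n m = tr X f (N + n) (N + m)"
  by (induction m rule: dec_induct) (simp_all add: tr_Suc)

lemma seq_colim_tail:
  assumes s: "seq X f" and c: "seq_colim X f F \<xi>"
  shows "seq_colim (\<lambda>n. X (N + n)) (\<lambda>n. f (N + n)) F (\<lambda>n. \<xi> (N + n))"
  unfolding seq_colim_def
proof (intro conjI allI impI ballI)
  fix S y assume S: "S \<in> Ob C" "y \<in> El F S"
  obtain n g where "n \<ge> N" "arr S (X n) g" "y = Fm F S (X n) g (\<xi> n)" using seq_colim_gen[OF s c S] .
  then show "\<exists>n g. arr S (X (N + n)) g \<and> y = Fm F S (X (N + n)) g (\<xi> (N + n))"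
    by (metis le_add_diff_inverse)
next
  fix S n g g' assume g: "arr S (X (N + n)) g \<and> arr S (X (N + n)) g' \<and>
    Fm F S (X (N + n)) g (\<xi> (N + n)) = Fm F S (X (N + n)) g' (\<xi> (N + n))"
  then obtain m where m: "m \<ge> N + n" "Comp C S (X (N + n)) (X m) (tr X f (N + n) m) g
      = Comp C S (X (N + n)) (X m) (tr X f (N + n) m) g'" using seq_colim_eq[OF s c] by metis
  then have "m - N \<ge> n" "N + (m - N) = m" by auto
  then show "\<exists>m\<ge>n. Comp C S (X (N + n)) (X (N + m)) (tr (\<lambda>n. X (N + n)) (\<lambda>n. f (N + n)) n m) g
      = Comp C S (X (N + n)) (X (N + m)) (tr (\<lambda>n. X (N + n)) (\<lambda>n. f (N + n)) n m) g'"
    using m(2) by (intro exI[of _ "m - N"]) (simp add: tr_tail)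
qed (use seq_colimD[OF c] in simp_all)

text \<open>
  At each step the obstruction is a map \<open>\<Sigma>\<^sup>-\<^sup>1D \<rightarrow> V\<close> from the desuspended cone.
\<close>

lemma extend_along_tr:
  assumes s: "seq X f"
    and c: "\<And>j. j \<ge> N \<Longrightarrow> \<exists>D\<in>K. \<exists>p q. (X j, X (Suc j), D, f (Suc j), p, q) \<in> Tri C"
    and o: "\<And>D. D \<in> K \<Longrightarrow> orth D (Sh C V)"
    and n: "N \<le> n" "n \<le> m" and q: "arr (X n) V q"
  obtains q' where "arr (X m) V q'" "Comp C (X n) (X m) V q' (tr X f n m) = q"
proof -
  have "\<exists>q'. arr (X m) V q' \<and> Comp C (X n) (X m) V q' (tr X f n m) = q"
    using n(2)
  proof (induction m rule: dec_induct)
    case base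
    then show ?case using q by auto
  next
    case (step m)
    then obtain q' where q': "arr (X m) V q'" "Comp C (X n) (X m) V q' (tr X f n m) = q" by blast
    obtain D p r where D: "D \<in> K" "(X m, X (Suc m), D, f (Suc m), p, r) \<in> Tri C"
      using c[of m] n(1) step(1) by auto
    obtain h where h: "arr (X (Suc m)) V h" "Comp C (X m) (X (Suc m)) V h (f (Suc m)) = q'"
      using extend_first[OF D(2) q'(1) o[OF D(1)]] .
    then show ?case using comp_assoc'[OF tr_arr[OF s step(1)] seq_arr[OF s] h(1)] q'(2) step(1)
      by (auto simp: tr_Suc)
  qed
  then show ?thesis using that by blast
qed

section \<open>Truncation and Cauchy sequences\<close>

text \<open>
  The orthogonality of the terms of one sequence passes to the late terms of any other sequence with
  the same colimit: a map from a late term extends to all later terms, hence factors through the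
  first sequence.
\<close>

lemma orth_late_terms:
  assumes s: "seq X f" "seq_colim X f F \<xi>" and t: "seq Y g" "seq_colim Y g F \<eta>"
    and c: "\<And>j. j \<ge> N \<Longrightarrow> \<exists>D\<in>K. \<exists>p q. (X j, X (Suc j), D, f (Suc j), p, q) \<in> Tri C"
    and o: "\<And>D. D \<in> K \<Longrightarrow> orth D (Sh C V)" and y: "\<And>k. orth (Y k) V" and n: "N \<le> n"
  shows "orth (X n) V"
proof (rule orthI)
  show "X n \<in> Ob C" "V \<in> Ob C" using seq_Ob[OF s(1)] orth_Ob(2)[OF y] by blast+
  fix q assume q: "arr (X n) V q"
  obtain m k a b where m: "m \<ge> n" "arr (X n) (Y k) a" "arr (Y k) (X m) b" "Comp C (X n) (Y k) (X m) b a = tr X f n m"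
    using tr_factors[OF s t] by metis
  obtain q' where q': "arr (X m) V q'" "Comp C (X n) (X m) V q' (tr X f n m) = q"
    using extend_along_tr[OF s(1) c o n m(1) q] .
  have "q = Comp C (X n) (Y k) V (Comp C (Y k) (X m) V q' b) a"
    using comp_assoc'[OF m(2,3) q'(1)] m(4) q'(2) by simp
  also have "Comp C (Y k) (X m) V q' b = \<zero>\<^bsub>Hom C (Y k) V\<^esub>" using orthD[OF y] m(3) q'(1) by simp
  finally show "q = \<zero>\<^bsub>Hom C (X n) V\<^esub>" using m(2) \<open>V \<in> Ob C\<close> by simp
qed

text \<open>
  If the colimit vanishes on the aisle, it is represented by the coaisle part \<open>Q\<close> of any late term.
  The element of \<open>F(E)\<close> given by \<open>E \<rightarrow> Y n\<close> is zero, so this map dies at a later stage \<open>m\<close> and the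
  transition map factors as \<open>Y n \<rightarrow> Q \<rightarrow> Y m\<close>; the second map is the universal element.
  The map \<open>g \<mapsto> F(g)(\<xi>)\<close> is injective because \<open>Y n \<rightarrow> Q\<close> extends to all later terms, which gives a
  retraction of \<open>Q\<close> from each of them. It is surjective because \<open>F\<close> vanishes on the cones of the late
  maps, so that an element of \<open>F(Y k)\<close> is determined by its restriction to \<open>Y n\<close>.
\<close>

lemma represented_by_truncation:
  assumes p: "torsion_pair L R" and s: "seq Y f" "seq_colim Y f F \<eta>"
    and c: "\<And>j. j \<ge> N \<Longrightarrow> \<exists>D\<in>Sh C ` L. \<exists>p q. (Y j, Y (Suc j), D, f (Suc j), p, q) \<in> Tri C"
    and v: "\<And>E. E \<in> L \<Longrightarrow> vanishes F E" and n: "N \<le> n"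
    and t: "E \<in> L" "Q \<in> R" "(E, Y n, Q, e, q, r) \<in> Tri C"
  obtains \<xi> where "represents F Q \<xi>"
proof -
  note D = torsion_pairD[OF p] and F = seq_colimD(1)[OF s(2)] and y = seq_colimD(2)[OF s(2)]
  note A = tri_arr[OF t(3)] and O = tri_Ob[OF t(3)]
  have o: "orth K (Sh C Q)" if "K \<in> Sh C ` L" for K using that D(3,5,6) t(2) orth_Sh_iff by blast
  have oE: "orth (Sh C E) Q" using D(3,4) t(1,2) by blast
  have "Fm F E (Y n) e (\<eta> n) = \<zero>\<^bsub>Fo F E\<^esub>"
    using v[OF t(1)] act_in[OF F A(1) y] by (simp add: vanishes_def)
  then obtain m where m: "m \<ge> n" "push Y f E n m e = \<zero>\<^bsub>Hom C E (Y m)\<^esub>"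
    using seq_colim_kill[OF s A(1)] by metis
  obtain h where h: "arr Q (Y m) h" "Comp C (Y n) Q (Y m) h q = tr Y f n m"
    using factor_cone[OF t(3) tr_arr[OF s(1) m(1)] m(2)] .
  define \<xi> where "\<xi> = Fm F Q (Y m) h (\<eta> m)"
  have \<xi>: "\<xi> \<in> El F Q" unfolding \<xi>_def by (rule act_in[OF F h(1) y])
  have act: "Fm F S Q g \<xi> = Fm F S (Y m) (Comp C S Q (Y m) h g) (\<eta> m)" if "arr S Q g" for S g
    unfolding \<xi>_def using act_comp[OF F that h(1) y] by simp
  have "represents F Q \<xi>"
  proof (rule representsI[OF F O(3) \<xi>])
    fix S g assume g: "arr S Q g" "Fm F S Q g \<xi> = \<zero>\<^bsub>Fo F S\<^esub>"
    have hg: "arr S (Y m) (Comp C S Q (Y m) h g)" using g h by simp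
    obtain l where l: "l \<ge> m" "push Y f S m l (Comp C S Q (Y m) h g) = \<zero>\<^bsub>Hom C S (Y l)\<^esub>"
      using seq_colim_kill[OF s hg] g act by metis
    note tl = tr_arr[OF s(1) l(1)]
    obtain q' where q': "arr (Y l) Q q'" "Comp C (Y n) (Y l) Q q' (tr Y f n l) = q"
      using extend_along_tr[OF s(1) c o n _ A(2)] m(1) l(1) by (metis le_trans)
    \<comment> \<open>\<open>Q \<rightarrow> Y m \<rightarrow> Y l \<rightarrow> Q\<close>, a map under \<open>Y n\<close>, hence the identity\<close>
    let ?r = "Comp C Q (Y l) Q q' (push Y f Q m l h)"
    have th: "arr Q (Y l) (push Y f Q m l h)" using h tl by simp
    have "Comp C (Y n) Q Q ?r q = Comp C (Y n) (Y l) Q q' (push Y f (Y n) m l (tr Y f n m))"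
      using comp_assoc'[OF A(2) th q'(1)] comp_assoc'[OF A(2) h(1) tl] h(2) by simp
    then have "Comp C (Y n) Q Q ?r q = Comp C (Y n) Q Q (Idm C Q) q"
      using tr_comp[OF s(1) m(1) l(1)] q'(2) A(2) by simp
    then have "?r = Idm C Q"
      using cancel_second[OF t(3) _ _ _ oE, of ?r "Idm C Q"] th q'(1) O by simp
    then have "g = Comp C S Q Q ?r g" using g by simp
    also have "\<dots> = Comp C S (Y l) Q q' (push Y f S m l (Comp C S Q (Y m) h g))"
      using comp_assoc'[OF g(1) th q'(1)] comp_assoc'[OF g(1) h(1) tl] by simp
    finally show "g = \<zero>\<^bsub>Hom C S Q\<^esub>" using l(2) q'(1) g(1) by (simp add: arrD)
  next
    fix S y' assume S: "S \<in> Ob C" "y' \<in> El F S"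
    obtain k g where g: "k \<ge> m" "arr S (Y k) g" "y' = Fm F S (Y k) g (\<eta> k)" using seq_colim_gen[OF s S] .
    have nk: "n \<le> k" using g(1) m(1) by simp
    obtain q' where q': "arr (Y k) Q q'" "Comp C (Y n) (Y k) Q q' (tr Y f n k) = q"
      using extend_along_tr[OF s(1) c o n nk A(2)] .
    note tk = tr_arr[OF s(1) g(1)]
    have hq: "arr (Y k) (Y m) (Comp C (Y k) Q (Y m) h q')" using h q' by simp
    \<comment> \<open>\<open>Y k \<rightarrow> Q \<rightarrow> Y m \<rightarrow> Y k\<close> agrees with the identity on \<open>Y n\<close>, hence also in \<open>F(Y k)\<close>\<close>
    let ?r = "push Y f (Y k) m k (Comp C (Y k) Q (Y m) h q')"
    have r: "arr (Y k) (Y k) ?r" using hq tk by simp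
    have inj: "a = b" if "a \<in> El F (Y j)" "b \<in> El F (Y j)" "n \<le> j"
        "Fm F (Y n) (Y j) (tr Y f n j) a = Fm F (Y n) (Y j) (tr Y f n j) b" for a b j
      using that(3,1,2,4)
    proof (induction j arbitrary: a b rule: dec_induct)
      case base
      then show ?case using F seq_Ob[OF s(1)] by simp
    next
      case (step j)
      obtain K u w where K: "K \<in> Sh C ` L" "(Y j, Y (Suc j), K, f (Suc j), u, w) \<in> Tri C"
        using c[of j] n step(1) by auto
      have "vanishes F K" using K(1) v D(4) by blast
      moreover have "Fm F (Y j) (Y (Suc j)) (f (Suc j)) a = Fm F (Y j) (Y (Suc j)) (f (Suc j)) b"
        using step(3)[OF act_in[OF F seq_arr[OF s(1)]] act_in[OF F seq_arr[OF s(1)]]] step(1,4,5,6)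
          act_comp[OF F tr_arr[OF s(1) step(1)] seq_arr[OF s(1)]] by (simp add: tr_Suc)
      ultimately show ?case using act_inj_if_cone_vanishes[OF s K(2) _ step(4,5)] by blast
    qed
    have "Comp C (Y n) (Y k) (Y k) ?r (tr Y f n k) = tr Y f n k"
      using comp_assoc'[OF tr_arr[OF s(1) nk] hq tk] comp_assoc'[OF tr_arr[OF s(1) nk] q'(1) h(1)]
        q'(2) h(2) tr_comp[OF s(1) m(1) g(1)] by simp
    then have "Fm F (Y n) (Y k) (tr Y f n k) (Fm F (Y k) (Y k) ?r (\<eta> k)) = Fm F (Y n) (Y k) (tr Y f n k) (\<eta> k)"
      using act_comp[OF F tr_arr[OF s(1) nk] r y] by simp
    then have "Fm F (Y k) (Y k) ?r (\<eta> k) = \<eta> k" using inj[OF act_in[OF F r y] y nk] by blast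
    moreover have "Fm F (Y k) (Y k) ?r (\<eta> k) = Fm F (Y k) Q q' \<xi>"
      using seq_colim_push[OF s g(1) hq] act[OF q'(1)] by simp
    ultimately have "y' = Fm F S Q (Comp C S (Y k) Q q' g) \<xi>"
      using g(3) act_comp[OF F g(2) q'(1) \<xi>] by simp
    then show "\<exists>g. arr S Q g \<and> y' = Fm F S Q g \<xi>" using arr_comp[OF g(2) q'(1)] by blast
  qed
  then show ?thesis by (rule that)
qed

text \<open>
  Once the cones lie in \<open>\<Sigma>L\<close>, the coaisle parts no longer change, so their cones are zero, and the aisle
  parts inherit the cones of the sequence.
\<close>

lemma cauchy_truncation:
  assumes g: "good_metric C B" and p: "torsion_pair L R" and B: "B i \<subseteq> Sh C ` L"
    and c: "cauchy C B Z z" and U: "\<And>n. U n \<in> L" and V: "\<And>n. V n \<in> R"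
    and t: "\<And>n. (U n, Z n, V n, u n, v n, w n) \<in> Tri C"
  obtains a b where "cauchy_triangles C B U Z V a z b u v w"
proof -
  note s = cauchy_seq[OF c] and D = torsion_pairD[OF p]
  have "\<exists>a b. tri_morphism C (U n, Z n, V n, u n, v n, w n)
      (U (Suc n), Z (Suc n), V (Suc n), u (Suc n), v (Suc n), w (Suc n)) a (z (Suc n)) b" for n
    using truncation_morphism[OF t t seq_arr[OF s] D(3)[OF U V]] by metis
  then obtain a' b' where m': "\<And>n. tri_morphism C (U n, Z n, V n, u n, v n, w n)
      (U (Suc n), Z (Suc n), V (Suc n), u (Suc n), v (Suc n), w (Suc n)) (a' n) (z (Suc n)) (b' n)"
    by metis
  define a b where "a n = a' (n - 1)" and "b n = b' (n - 1)" for n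
  have m: "tri_morphism C (U n, Z n, V n, u n, v n, w n)
      (U (Suc n), Z (Suc n), V (Suc n), u (Suc n), v (Suc n), w (Suc n)) (a (Suc n)) (z (Suc n)) (b (Suc n))" for n
    using m' by (simp add: a_def b_def)
  have sU: "seq U a" and sV: "seq V b"
    using m tri_Ob[OF t] by (auto simp: seq_def arr_def tri_morphism_def)
  have key: "\<exists>n. \<forall>j\<ge>n. is_iso C (V j) (V (Suc j)) (b (Suc j)) \<and>
      (\<exists>K\<in>B k. \<exists>p q. (U j, U (Suc j), K, a (Suc j), p, q) \<in> Tri C)" for k
  proof -
    obtain n where n: "\<And>j. j \<ge> n \<Longrightarrow> \<exists>K\<in>B (max i k). \<exists>p q. (Z j, Z (Suc j), K, z (Suc j), p, q) \<in> Tri C"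
      by (rule cauchy_cones[OF g c, where i = "max i k"]) (rule that)
    show ?thesis
    proof (intro exI[of _ n] allI impI)
      fix j assume "n \<le> j"
      then obtain K x y where K: "K \<in> B (max i k)" "(Z j, Z (Suc j), K, z (Suc j), x, y) \<in> Tri C"
        using n by blast
      have KL: "K \<in> Sh C ` L" and Kk: "K \<in> B k"
        using K(1) good_metric_anti[OF g, of i "max i k"] good_metric_anti[OF g, of k "max i k"] B by auto
      have o: "orth K (Sh C (V j))" "orth K (V (Suc j))" "orth (U (Suc j)) (V j)"
        "orth (Sh C (U j)) (V j)" "orth (Sh C (U (Suc j))) (V (Suc j))" "orth (Sh C (U j)) (V (Suc j))"
      proof -
        obtain K' where K': "K' \<in> L" "K = Sh C K'" using KL by blast
        show "orth K (Sh C (V j))"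
          unfolding K'(2) orth_Sh_iff[OF D(5)[OF K'(1)] D(6)[OF V]] by (rule D(3)[OF K'(1) V])
        show "orth K (V (Suc j))" unfolding K'(2) by (rule D(3)[OF D(4)[OF K'(1)] V])
        show "orth (Sh C (U j)) (V j)" "orth (Sh C (U (Suc j))) (V (Suc j))" "orth (Sh C (U j)) (V (Suc j))"
          by (rule D(3)[OF D(4)[OF U] V])+
      qed (rule D(3)[OF U V])
      have i: "is_iso C (V j) (V (Suc j)) (b (Suc j))"
        by (rule truncation_iso[OF K(2) t t m o(1-5)])
      obtain r q where "(U j, U (Suc j), K, a (Suc j), r, q) \<in> Tri C"
        using cone_of_first_component[OF K(2) t t m i o(6)] .
      then show "is_iso C (V j) (V (Suc j)) (b (Suc j)) \<and>
          (\<exists>K\<in>B k. \<exists>p q. (U j, U (Suc j), K, a (Suc j), p, q) \<in> Tri C)" using i Kk by blast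
    qed
  qed
  have "cauchy C B U a"
    by (rule cauchyI[OF sU]) (use key in blast)
  moreover have "cauchy C B V b"
  proof (rule cauchyI[OF sV])
    fix k
    obtain N where N: "N \<in> B k" "zero_ob C N" using good_metricD(5)[OF g] by blast
    obtain n where "\<forall>j\<ge>n. is_iso C (V j) (V (Suc j)) (b (Suc j))" using key by blast
    then show "\<exists>n. \<forall>j\<ge>n. \<exists>D\<in>B k. \<exists>p q. (V j, V (Suc j), D, b (Suc j), p, q) \<in> Tri C"
      using tri_of_iso[OF _ seq_Ob[OF sV] seq_Ob[OF sV] N(2)] N(1) by blast
  qed
  ultimately show ?thesis using c t m by (intro that[of a b]) (simp add: cauchy_triangles_def)
qed

lemma cauchy_trianglesD:
  assumes "cauchy_triangles C B X Y Z a b c u v w"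
  shows "cauchy C B X a" "cauchy C B Y b" "cauchy C B Z c" "(X n, Y n, Z n, u n, v n, w n) \<in> Tri C"
    "Comp C (X n) (Y n) (Y (Suc n)) (b (Suc n)) (u n) = Comp C (X n) (X (Suc n)) (Y (Suc n)) (u (Suc n)) (a (Suc n))"
    "Comp C (Y n) (Z n) (Z (Suc n)) (c (Suc n)) (v n) = Comp C (Y n) (Y (Suc n)) (Z (Suc n)) (v (Suc n)) (b (Suc n))"
    "Comp C (Z n) (Sh C (X n)) (Sh C (X (Suc n))) (ShM C (X n) (X (Suc n)) (a (Suc n))) (w n)
      = Comp C (Z n) (Z (Suc n)) (Sh C (X (Suc n))) (w (Suc n)) (c (Suc n))"
  using assms by (auto simp: cauchy_triangles_def tri_morphism_def)

section \<open>Membership in the completion and its triangles\<close>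

lemma LL_I: "\<lbrakk>cauchy C B X f; \<And>n. X n \<in> U; seq_colim X f F \<xi>\<rbrakk> \<Longrightarrow> F \<in> LL C B U"
  unfolding LL_def using Yo_colimitI[OF cauchy_seq] seq_colimD(1) by blast

lemma LL_E:
  fixes F :: "('o, 'm, 'g) cmod"
  assumes "F \<in> LL C B U" and i: "inj (emb :: nat \<times> 'm \<Rightarrow> 'g)"
  obtains X f \<xi> where "cauchy C B X f" "\<And>n. X n \<in> U" "seq_colim X f F \<xi>"
proof -
  obtain X f \<phi> where X: "cauchy C B X f" "\<forall>n. X n \<in> U" "Yo_colimit C X f F \<phi>"
    using assms(1) unfolding LL_def by blast
  obtain \<xi> where "seq_colim X f F \<xi>" using Yo_colimitE[OF cauchy_seq[OF X(1)] i X(3)] .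
  then show ?thesis using X that by blast
qed

lemma LL_represents:
  assumes g: "good_metric C B" and r: "represents F Q \<xi>" and Q: "Q \<in> U" shows "F \<in> LL C B U"
  using LL_I[OF cauchy_const[OF g representsD(2)[OF r]] Q represents_seq_colim[OF r]] .

lemma ShP_Ob: "X \<in> Ob C \<Longrightarrow> ShP C j X \<in> Ob C"
proof -
  assume X: "X \<in> Ob C"
  have "(Sh C ^^ n) X \<in> Ob C" "(ShI C ^^ n) X \<in> Ob C" for n by (induction n) (simp_all add: X)
  then show ?thesis by (simp add: ShP_def)
qed

lemma CC_iff:
  assumes g: "good_metric C B"
  shows "F \<in> CC C B \<longleftrightarrow> F \<in> Mods C \<and> (\<forall>j. \<exists>i. \<forall>b\<in>B i. vanishes F (ShP C j b))"
proof -
  have "hom_zero (NatHom C (Yo C (ShP C j b)) F) \<longleftrightarrow> vanishes F (ShP C j b)" if "F \<in> Mods C" "b \<in> B i" for j b i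
  proof -
    have b: "ShP C j b \<in> Ob C" using ShP_Ob good_metricD(1)[OF g] that(2) by blast
    have "\<zero>\<^bsub>Fo F (ShP C j b)\<^esub> \<in> El F (ShP C j b)" by (rule zero_in[OF that(1) b])
    then show ?thesis unfolding hom_zero_Yo[OF that(1) b] vanishes_def using b by auto
  qed
  then show ?thesis unfolding CC_def by blast
qed

text \<open>
  Desuspensions are paid for by passing to a deeper member of the metric.
\<close>

lemma metric_shift_in_aisle:
  assumes g: "good_metric C B" and B: "B i \<subseteq> L" and L: "Sh C ` L \<subseteq> L"
  obtains k where "\<And>b. b \<in> B k \<Longrightarrow> ShP C j b \<in> L"
proof -
  have up: "(Sh C ^^ n) b \<in> L" if "b \<in> B i" for b n using that B L by (induction n) auto
  have dn: "(ShI C ^^ n) b \<in> L" if "b \<in> B (i + n)" for b n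
    using that
  proof (induction n arbitrary: b)
    case 0
    then show ?case using B by auto
  next
    case (Suc n)
    then show ?case using good_metricD(3)[OF g, of b "i + n"] by (simp add: funpow_swap1)
  qed
  show ?thesis
  proof (cases "0 \<le> j")
    case True
    then show ?thesis using that[of i] up by (simp add: ShP_def)
  next
    case False
    then show ?thesis using that[of "i + nat (- j)"] dn by (simp add: ShP_def)
  qed
qed

lemma CC_if_vanishes:
  assumes g: "good_metric C B" and B: "B i \<subseteq> L" and L: "Sh C ` L \<subseteq> L"
    and F: "F \<in> Mods C" "\<And>S. S \<in> L \<Longrightarrow> vanishes F S"
  shows "F \<in> CC C B"
  unfolding CC_iff[OF g]
proof (intro conjI allI F(1))
  fix j obtain k where "\<And>b. b \<in> B k \<Longrightarrow> ShP C j b \<in> L" using metric_shift_in_aisle[OF g B L] by metis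
  then show "\<exists>i. \<forall>b\<in>B i. vanishes F (ShP C j b)" using F(2) by blast
qed

lemma CC_first:
  assumes g: "good_metric C B" and B: "B i \<subseteq> L" and L: "Sh C ` L \<subseteq> L"
    and F: "F \<in> CC C B" and A: "A \<in> Mods C" "\<And>S. \<lbrakk>S \<in> L; vanishes F S\<rbrakk> \<Longrightarrow> vanishes A S"
  shows "A \<in> CC C B"
  unfolding CC_iff[OF g]
proof (intro conjI allI A(1))
  fix j
  obtain k where k: "\<And>b. b \<in> B k \<Longrightarrow> ShP C j b \<in> L" using metric_shift_in_aisle[OF g B L] by metis
  obtain l where l: "\<And>b. b \<in> B l \<Longrightarrow> vanishes F (ShP C j b)" using F unfolding CC_iff[OF g] by blast
  have "vanishes A (ShP C j b)" if "b \<in> B (max k l)" for b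
    using that A(2) k l good_metric_anti[OF g, of k "max k l"] good_metric_anti[OF g, of l "max k l"] by (metis max.cobounded1 max.cobounded2 subsetD)
  then show "\<exists>i. \<forall>b\<in>B i. vanishes A (ShP C j b)" by blast
qed

text \<open>
  The maps of the triangle are induced on colimits; the last one uses that \<open>\<Sigma>F\<close> receives the shifted
  cocone.
\<close>

lemma GTri_I:
  assumes g: "good_metric C B" and ct: "cauchy_triangles C B X Y Z a b c u v w"
    and F: "seq_colim X a F \<xi>" "F \<in> CC C B" and G: "seq_colim Y b G \<eta>" "G \<in> CC C B"
    and H: "seq_colim Z c H \<zeta>" "H \<in> CC C B"
  obtains p q r where "(F, G, H, p, q, r) \<in> GTri C B"
proof -
  note D = cauchy_trianglesD[OF ct]
  note s = cauchy_seq[OF D(1)] cauchy_seq[OF D(2)] cauchy_seq[OF D(3)]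
  note cF = seq_colimD[OF F(1)] and cG = seq_colimD[OF G(1)] and cH = seq_colimD[OF H(1)]
  have GG: "F \<in> GG C B (Ob C)" "G \<in> GG C B (Ob C)" "H \<in> GG C B (Ob C)"
    unfolding GG_def using LL_I[OF D(1) seq_Ob[OF s(1)] F(1)] LL_I[OF D(2) seq_Ob[OF s(2)] G(1)]
      LL_I[OF D(3) seq_Ob[OF s(3)] H(1)] F(2) G(2) H(2) by blast+
  obtain p where p: "p \<in> NatTr C F G" "\<And>n. NatComp C (Yo C (X n)) p (yon F (X n) (\<xi> n))
      = NatComp C (Yo C (X n)) (yon G (Y n) (\<eta> n)) (YoM C (X n) (Y n) (u n))"
    by (rule seq_colim_map_of_seqs[where u = u, OF s(1) F(1) s(2) cG tri_arr(1)[OF D(4)] D(5)]) (rule that)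
  obtain q where q: "q \<in> NatTr C G H" "\<And>n. NatComp C (Yo C (Y n)) q (yon G (Y n) (\<eta> n))
      = NatComp C (Yo C (Y n)) (yon H (Z n) (\<zeta> n)) (YoM C (Y n) (Z n) (v n))"
    by (rule seq_colim_map_of_seqs[where u = v, OF s(2) G(1) s(3) cH tri_arr(2)[OF D(4)] D(6)]) (rule that)
  have e: "\<xi> n \<in> El (ModSh C F) (Sh C (X n))" for n
    using cF(2) seq_Ob[OF s(1)] by (simp add: ModSh_sel)
  have e2: "Fm (ModSh C F) (Sh C (X n)) (Sh C (X (Suc n))) (ShM C (X (Suc n - 1)) (X (Suc n)) (a (Suc n))) (\<xi> (Suc n)) = \<xi> n" for n
    using cF(3) seq_Ob[OF s(1)] seq_arr[OF s(1)] by (simp add: ModSh_sel)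
  obtain r where r: "r \<in> NatTr C H (ModSh C F)" "\<And>n. NatComp C (Yo C (Z n)) r (yon H (Z n) (\<zeta> n))
      = NatComp C (Yo C (Z n)) (yon (ModSh C F) (Sh C (X n)) (\<xi> n)) (YoM C (Z n) (Sh C (X n)) (w n))"
    by (rule seq_colim_map_of_seqs[where u = w, OF s(3) H(1) seq_ShM[OF s(1)] ModSh_in[OF cF(1)] e e2 tri_arr(3)[OF D(4)]])
      (simp add: D(7), rule that)
  have "(F, G, H, p, q, r) \<in> GTri C B"
    unfolding GTri_def mem_Collect_eq prod.case
    apply (intro conjI GG p(1) q(1) r(1))
    apply (intro exI conjI allI)
    apply (rule ct)
    apply (rule Yo_colimitI[OF s(1) F(1)] Yo_colimitI[OF s(2) G(1)] Yo_colimitI[OF s(3) H(1)] p(2) q(2))+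
    using r(2) YoSh_yon[OF cF(1) seq_Ob[OF s(1)]] by simp
  then show ?thesis by (rule that)
qed

lemma GTri_E:
  fixes F :: "('o, 'm, 'g) cmod"
  assumes "(F, G, H, p, q, r) \<in> GTri C B" and i: "inj (emb :: nat \<times> 'm \<Rightarrow> 'g)"
  obtains X Y Z a b c u v w \<xi> \<eta> \<zeta> where "cauchy_triangles C B X Y Z a b c u v w"
    "seq_colim X a F \<xi>" "seq_colim Y b G \<eta>" "seq_colim Z c H \<zeta>"
    "F \<in> GG C B (Ob C)" "G \<in> GG C B (Ob C)" "H \<in> GG C B (Ob C)"
proof -
  obtain X Y Z a b c u v w \<phi> \<psi> \<chi> where ct: "cauchy_triangles C B X Y Z a b c u v w"
    and col: "Yo_colimit C X a F \<phi>" "Yo_colimit C Y b G \<psi>" "Yo_colimit C Z c H \<chi>"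
    and GG: "F \<in> GG C B (Ob C)" "G \<in> GG C B (Ob C)" "H \<in> GG C B (Ob C)"
    using assms(1) unfolding GTri_def mem_Collect_eq prod.case by (elim conjE exE) blast
  note D = cauchy_trianglesD[OF ct]
  obtain \<xi> where x: "seq_colim X a F \<xi>" using Yo_colimitE[OF cauchy_seq[OF D(1)] i col(1)] .
  obtain \<eta> where y: "seq_colim Y b G \<eta>" using Yo_colimitE[OF cauchy_seq[OF D(2)] i col(2)] .
  obtain \<zeta> where z: "seq_colim Z c H \<zeta>" using Yo_colimitE[OF cauchy_seq[OF D(3)] i col(3)] .
  show ?thesis by (rule that[OF ct x y z GG])
qed

end

section \<open>Tilts of the completed t-structure\<close>

context additive_category
begin

lemma NatZero_in:
  assumes "F \<in> Mods C" "G \<in> Mods C" shows "(\<lambda>X\<in>Ob C. \<lambda>x\<in>El F X. \<zero>\<^bsub>Fo G X\<^esub>) \<in> NatTr C F G"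
proof (rule NatTrI)
  fix X assume X: "X \<in> Ob C"
  interpret abelian_group "Fo G X" using Mods_group[OF assms(2) X] .
  show "\<zero>\<^bsub>Fo G X\<^esub> = \<zero>\<^bsub>Fo G X\<^esub> \<oplus>\<^bsub>Fo G X\<^esub> \<zero>\<^bsub>Fo G X\<^esub>" by simp
qed (use assms Mods_group act_in in \<open>auto simp: arrD\<close>)

end

locale tilting_data = triangulated_category C for C :: "('o, 'm, 'x) tricat" +
  fixes B :: "nat \<Rightarrow> 'o set" and tle tge X :: "'o set" and emb :: "nat \<times> 'm \<Rightarrow> 'g"
  assumes metric: "good_metric C B" and t_str: "t_structure C tle tge"
    and torsion: "torsion_class C (heart tle tge) X" and ext: "extendable B tle" and emb: "inj emb"
begin

lemma aisle: "torsion_pair (Sh C ` tle) tge"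
  by (rule t_structure_torsion_pair[OF t_str])

lemmas aisleD = torsion_pairD[OF aisle]

lemma aisle_shift: "torsion_pair (Sh C ` Sh C ` tle) (Sh C ` tge)"
  by (rule torsion_pair_Sh[OF aisle])

lemma tle_Sh: "S \<in> tle \<Longrightarrow> Sh C S \<in> tle" and tge_Sh: "V \<in> tge \<Longrightarrow> V \<in> Sh C ` tge"
  and tle_Ob: "S \<in> tle \<Longrightarrow> S \<in> Ob C" and tge_Ob: "V \<in> tge \<Longrightarrow> V \<in> Ob C"
proof -
  have "full_subcategory C tle" "full_subcategory C tge" "Sh C ` tle \<subseteq> tle" "tge \<subseteq> Sh C ` tge"
    using t_str by (simp_all add: t_structure_def shifted_minus_one)
  moreover from this(1,2) have "tle \<subseteq> Ob C" "tge \<subseteq> Ob C" unfolding full_subcategory_def by blast+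
  ultimately show "S \<in> tle \<Longrightarrow> Sh C S \<in> tle" "V \<in> tge \<Longrightarrow> V \<in> Sh C ` tge" "S \<in> tle \<Longrightarrow> S \<in> Ob C"
    "V \<in> tge \<Longrightarrow> V \<in> Ob C" by blast+
qed

text \<open>
  The two depths are those at which cones become invisible to the t-structure and to its suspension.
\<close>

lemma metric_in_aisle: obtains i where "B i \<subseteq> Sh C ` Sh C ` tle" "B (Suc i) \<subseteq> Sh C ` Sh C ` Sh C ` tle"
proof -
  obtain n where "B n \<subseteq> tle" using ext by (auto simp: extendable_def)
  then have "B (Suc (Suc n)) \<subseteq> Sh C ` Sh C ` tle" by (intro good_metric_Sh[OF metric])
  then show ?thesis using that good_metric_Sh[OF metric] by blast
qed

lemma aisle_Sh_closed: "Sh C ` Sh C ` tle \<subseteq> Sh C ` tle"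
  using tle_Sh by blast

lemma torsion_heart: "x \<in> X \<Longrightarrow> x \<in> tle" "x \<in> X \<Longrightarrow> x \<in> tge"
  using torsion by (auto simp: torsion_class_def heart_def)

lemma perpD:
  assumes "W \<in> perp C X (heart tle tge)"
  shows "W \<in> tle" "W \<in> tge" "x \<in> X \<Longrightarrow> orth x W"
proof -
  show W: "W \<in> tle" "W \<in> tge" using assms by (auto simp: perp_def heart_def)
  show "x \<in> X \<Longrightarrow> orth x W"
    using assms orth_iff_hom_zero[OF tge_Ob[OF torsion_heart(2)] tge_Ob[OF W(2)]] by (auto simp: perp_def)
qed

lemma orth_deep: "\<lbrakk>D \<in> Sh C ` Sh C ` tle; V \<in> tge\<rbrakk> \<Longrightarrow> orth D (Sh C V)"
  by (rule torsion_pairD(3)[OF aisle_shift]) auto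

text \<open>
  The second family of objects \<open>W\<close> is \<open>T\<^sup>\<ge>\<^sup>1\<close>: orthogonality to it puts the coaisle part \<open>V\<close> of \<open>Z\<close> into the
  heart. The torsion-free quotient \<open>y\<close> of \<open>V\<close> lies in the first family, so the map \<open>V \<rightarrow> y\<close> is zero and
  \<open>V\<close> is isomorphic to its torsion part.
\<close>

lemma in_tilt_le:
  assumes Z: "Z \<in> Ob C" and o1: "\<And>W. W \<in> perp C X (heart tle tge) \<Longrightarrow> orth Z W"
    and o2: "\<And>W. \<lbrakk>W \<in> tge; Sh C W \<in> tge\<rbrakk> \<Longrightarrow> orth Z W"
  shows "Z \<in> tilt_le C tle X"
proof -
  obtain U V u v w where t: "U \<in> Sh C ` tle" "V \<in> tge" "(U, Z, V, u, v, w) \<in> Tri C"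
    using torsion_pairE[OF aisle Z] .
  note A = tri_arr[OF t(3)] and VO = tge_Ob[OF t(2)]
  have "Sh C V \<in> Sh C ` tle"
  proof (rule in_left_if_orth[OF aisle Sh_Ob[OF VO]])
    fix W assume W: "W \<in> tge"
    then obtain W' where W': "W' \<in> tge" "W = Sh C W'" using tge_Sh by blast
    have "orth V W'"
      by (rule orth_cone_left[OF t(3) o2]) (use W W' aisleD(3)[OF aisleD(4)[OF t(1)] W'(1)] in auto)
    then show "orth (Sh C V) W" using W' orth_Sh_iff[OF VO tge_Ob[OF W'(1)]] by simp
  qed
  then obtain V' where "V' \<in> tle" "Sh C V = Sh C V'" by blast
  then have "V \<in> tle" using ShI_Sh VO tle_Ob by metis
  then have Vh: "V \<in> heart tle tge" using t(2) by (simp add: heart_def)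
  obtain x y f g where x: "x \<in> X" "y \<in> perp C X (heart tle tge)" "short_exact C (heart tle tge) x V y f g"
    using torsion Vh unfolding torsion_class_def by blast
  note yt = perpD(1,2)[OF x(2)] and xt = torsion_heart[OF x(1)]
  have yO: "y \<in> Ob C" and xO: "x \<in> Ob C" using yt xt tge_Ob by blast+
  have f: "arr x V f" and g: "arr V y g" using x(3) VO xO yO by (simp_all add: short_exact_def arr_def)
  have ker: "\<And>W h. \<lbrakk>W \<in> heart tle tge; arr W V h; Comp C W V y g h = \<zero>\<^bsub>Hom C W y\<^esub>\<rbrakk>
      \<Longrightarrow> \<exists>!h'. h' \<in> Mor C W x \<and> Comp C W x V f h' = h"
    and cok: "\<And>W h. \<lbrakk>W \<in> heart tle tge; arr V W h; Comp C x V W h f = \<zero>\<^bsub>Hom C x W\<^esub>\<rbrakk>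
      \<Longrightarrow> \<exists>!h'. h' \<in> Mor C y W \<and> Comp C V y W h' g = h"
    and gf: "Comp C x V y g f = \<zero>\<^bsub>Hom C x y\<^esub>"
    using x(3) by (simp_all add: short_exact_def is_kernel_def is_cokernel_def arr_def)
  have hy: "y \<in> heart tle tge" and hx: "x \<in> heart tle tge" using yt xt by (simp_all add: heart_def)
  have "orth V y"
    by (rule orth_cone_left[OF t(3) o1[OF x(2)] aisleD(3)[OF aisleD(4)[OF t(1)] yt(2)]])
  then have g0: "g = \<zero>\<^bsub>Hom C V y\<^esub>" using orthD g by blast
  obtain s where s: "arr V x s" "Comp C V x V f s = Idm C V"
    using ker[OF Vh arr_id[OF VO]] g0 VO xO yO comp_zero_left[OF arr_id[OF VO] yO] unfolding arr_def by blast
  have "\<exists>!h'. h' \<in> Mor C x x \<and> Comp C x x V f h' = f" using ker[OF hx f gf] .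
  moreover have "Comp C x x V f (Comp C x V x s f) = f" using comp_assoc'[OF f s(1) f] s(2) f by simp
  moreover have "Comp C x V x s f \<in> Mor C x x" using arr_comp[OF f s(1)] by (simp add: arr_def)
  moreover have "Idm C x \<in> Mor C x x" "Comp C x x V f (Idm C x) = f" using id_in[OF xO] f by simp_all
  ultimately have "Comp C x V x s f = Idm C x" by blast
  then have "is_iso C x V f" by (rule is_isoI[OF f s(1) _ s(2)])
  then have "V \<in> X" using full_subcategory_iso[OF _ x(1) _ VO] torsion by (auto simp: torsion_class_def)
  then show ?thesis unfolding tilt_le_def star_def shifted_minus_one using t Z by blast
qed

text \<open>
  The aisle part \<open>U\<close> of \<open>Q\<close> lies in \<open>\<Sigma>T\<^sup>0\<close> because \<open>Q\<close> lies in \<open>T\<^sup>\<ge>\<^sup>-\<^sup>1\<close>. Maps from \<open>\<Sigma>x\<close> do not distinguish \<open>U\<close>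
  from \<open>Q\<close>, so \<open>\<Sigma>\<^sup>-\<^sup>1U\<close> is torsion free.
\<close>

lemma in_tilt_ge:
  assumes Q: "Q \<in> Sh C ` tge" and o: "\<And>x. x \<in> X \<Longrightarrow> orth (Sh C x) Q"
  shows "Q \<in> tilt_ge C tle tge X"
proof -
  have QO: "Q \<in> Ob C" using Q tge_Ob Sh_Ob by blast
  obtain U V u v w where t: "U \<in> Sh C ` tle" "V \<in> tge" "(U, Q, V, u, v, w) \<in> Tri C"
    using torsion_pairE[OF aisle QO] .
  obtain W where W: "W \<in> tle" "U = Sh C W" using t(1) by blast
  note WO = tle_Ob[OF W(1)]
  have W2: "W \<in> tge"
  proof (rule in_right_if_orth[OF aisle WO])
    fix S assume S: "S \<in> Sh C ` tle"
    have "orth (Sh C S) Q" by (rule torsion_pairD(3)[OF aisle_shift _ Q]) (use S in blast)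
    then have "orth (Sh C S) U"
      using orth_fiber_right[OF t(3)] aisleD(3)[OF aisleD(4)[OF aisleD(4)[OF S]] t(2)] by blast
    then show "orth S W" using W(2) orth_Sh_iff[OF aisleD(5)[OF S] WO] by simp
  qed
  have "orth x W" if x: "x \<in> X" for x
  proof -
    have S: "Sh C x \<in> Sh C ` tle" using torsion_heart(1)[OF x] by blast
    have "orth (Sh C x) U" by (rule orth_fiber_right[OF t(3) o[OF x] aisleD(3)[OF aisleD(4)[OF S] t(2)]])
    then show ?thesis using W(2) orth_Sh_iff[OF tge_Ob[OF torsion_heart(2)[OF x]] WO] by simp
  qed
  then have "W \<in> perp C X (heart tle tge)"
    using W W2 orth_iff_hom_zero[OF tge_Ob[OF torsion_heart(2)] WO] by (simp add: perp_def heart_def)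
  then show ?thesis unfolding tilt_ge_def star_def using t W QO by blast
qed

lemma GG_I: "\<lbrakk>F \<in> LL C B U; F \<in> CC C B\<rbrakk> \<Longrightarrow> F \<in> GG C B U" and GG_D: "F \<in> GG C B U \<Longrightarrow> F \<in> LL C B U" "F \<in> GG C B U \<Longrightarrow> F \<in> CC C B"
  by (simp_all add: GG_def)

text \<open>
  The colimit of the coaisle parts vanishes on the aisle, where the members of the metric
  eventually lie, so it belongs to \<open>CC C B\<close>; the colimit of the aisle parts inherits this from \<open>F\<close>,
  into which it embeds on the aisle.
\<close>

lemma truncation_triangle:
  fixes F :: "('o, 'm, 'g) cmod"
  assumes c: "cauchy C B Z z" and F: "seq_colim Z z F \<zeta>" "F \<in> CC C B"
    and U: "\<And>n. U n \<in> Sh C ` tle" and V: "\<And>n. V n \<in> tge"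
    and t: "\<And>n. (U n, Z n, V n, u n, v n, w n) \<in> Tri C"
  obtains a b A D \<alpha> \<delta> p q r where "cauchy C B U a" "cauchy C B V b" "seq_colim U a (A :: ('o, 'm, 'g) cmod) \<alpha>"
    "seq_colim V b D \<delta>" "A \<in> CC C B" "D \<in> CC C B" "(A, F, D, p, q, r) \<in> GTri C B"
proof -
  obtain i where i: "B i \<subseteq> Sh C ` Sh C ` tle" using metric_in_aisle by metis
  have i': "B i \<subseteq> Sh C ` tle" using i aisle_Sh_closed by blast
  obtain a b where ct: "cauchy_triangles C B U Z V a z b u v w"
    by (rule cauchy_truncation[OF metric aisle i c U V t]) (rule that)
  note D = cauchy_trianglesD[OF ct]
  note s = cauchy_seq[OF D(1)] cauchy_seq[OF D(2)] cauchy_seq[OF D(3)]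
  note A = seq_colim_germ_mod[OF s(1) emb] and H = seq_colim_germ_mod[OF s(3) emb]
  let ?A = "germ_mod emb U a" and ?D = "germ_mod emb V b"
  have cA: "?A \<in> CC C B"
  proof (rule CC_first[OF metric i' aisle_Sh_closed F(2) seq_colimD(1)[OF A]])
    fix S assume S: "S \<in> Sh C ` tle" "vanishes F S"
    show "vanishes ?A S"
      by (rule colim_vanishes_first[OF s(1,2) D(4,5) A F(1) S(2)]) (rule aisleD(3)[OF aisleD(4)[OF S(1)] V])
  qed
  have cD: "?D \<in> CC C B"
    by (rule CC_if_vanishes[OF metric i' aisle_Sh_closed seq_colimD(1)[OF H]])
      (rule seq_colim_vanishes[OF s(3) H], rule aisleD(3)[OF _ V])
  obtain p q r where "(?A, F, ?D, p, q, r) \<in> GTri C B"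
    using GTri_I[OF metric ct A cA F H cD] .
  then show ?thesis by (rule that[OF D(1) D(3) A H cA cD])
qed

lemma tilt_le_subset: "(GG C B (tilt_le C tle X) :: ('o, 'm, 'g) cmod set) \<subseteq> G_tilt_le C B tle X"
proof
  fix F :: "('o, 'm, 'g) cmod" assume F: "F \<in> GG C B (tilt_le C tle X)"
  obtain Z z \<zeta> where Z: "cauchy C B Z z" "\<And>n. Z n \<in> tilt_le C tle X" "seq_colim Z z F \<zeta>"
    by (rule LL_E[OF GG_D(1)[OF F] emb]) (rule that)
  have "\<exists>U\<in>Sh C ` tle. \<exists>V\<in>X. \<exists>u v w. (U, Z n, V, u, v, w) \<in> Tri C" for n
    using Z(2)[of n] unfolding tilt_le_def star_def shifted_minus_one by simp
  then obtain U V u v w where t: "\<And>n. U n \<in> Sh C ` tle" "\<And>n. V n \<in> X" "\<And>n. (U n, Z n, V n, u n, v n, w n) \<in> Tri C"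
    by metis
  obtain a b and A D :: "('o, 'm, 'g) cmod" and \<alpha> \<delta> p q r where A: "cauchy C B U a" "cauchy C B V b" "seq_colim U a A \<alpha>"
    "seq_colim V b D \<delta>" "A \<in> CC C B" "D \<in> CC C B" "(A, F, D, p, q, r) \<in> GTri C B"
    by (rule truncation_triangle[OF Z(1,3) GG_D(2)[OF F] t(1) torsion_heart(2)[OF t(2)] t(3)]) (rule that)
  have "A \<in> GG C B (Sh C ` tle)" "D \<in> GG C B X"
    using LL_I[OF A(1) t(1) A(3)] LL_I[OF A(2) t(2) A(4)] A(5,6) GG_I by blast+
  moreover have "F \<in> GG C B (Ob C)"
    using LL_I[OF Z(1) seq_Ob[OF cauchy_seq[OF Z(1)]] Z(3)] GG_D(2)[OF F] by (rule GG_I)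
  ultimately show "F \<in> G_tilt_le C B tle X"
    unfolding G_tilt_le_def star_def completion_def shifted_minus_one using A(7)
    by (simp, intro bexI exI)
qed

text \<open>
  The orthogonality that characterises the tilted aisle is transferred from the sequences \<open>P\<close> and \<open>Q\<close>
  with terms in the aisle and in \<open>X\<close> to the outer terms of the triangles, and then to the middle.
\<close>

lemma tilt_le_supset: "(G_tilt_le C B tle X :: ('o, 'm, 'g) cmod set) \<subseteq> GG C B (tilt_le C tle X)"
proof
  fix F :: "('o, 'm, 'g) cmod" assume "F \<in> G_tilt_le C B tle X"
  then obtain A D :: "('o, 'm, 'g) cmod" and p q r
    where A: "A \<in> GG C B (Sh C ` tle)" "D \<in> GG C B X" "(A, F, D, p, q, r) \<in> GTri C B"
    unfolding G_tilt_le_def star_def completion_def shifted_minus_one by auto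
  obtain X' Y' Z' a b c u v w \<xi> \<eta> \<zeta> where ct: "cauchy_triangles C B X' Y' Z' a b c u v w"
    and col: "seq_colim X' a A \<xi>" "seq_colim Y' b F \<eta>" "seq_colim Z' c D \<zeta>" and FG: "F \<in> GG C B (Ob C)"
    by (rule GTri_E[OF A(3) emb]) (rule that)
  note ctD = cauchy_trianglesD[OF ct]
  note s = cauchy_seq[OF ctD(1)] cauchy_seq[OF ctD(2)] cauchy_seq[OF ctD(3)]
  obtain P e \<pi> where P: "cauchy C B P e" "\<And>n. P n \<in> Sh C ` tle" "seq_colim P e A \<pi>"
    by (rule LL_E[OF GG_D(1)[OF A(1)] emb]) (rule that)
  obtain Q h \<kappa> where Q: "cauchy C B Q h" "\<And>n. Q n \<in> X" "seq_colim Q h D \<kappa>"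
    by (rule LL_E[OF GG_D(1)[OF A(2)] emb]) (rule that)
  obtain i where i: "B i \<subseteq> Sh C ` Sh C ` tle" using metric_in_aisle by metis
  obtain n1 where n1: "\<And>j. j \<ge> n1 \<Longrightarrow> \<exists>D\<in>B i. \<exists>p q. (X' j, X' (Suc j), D, a (Suc j), p, q) \<in> Tri C"
    by (rule cauchy_cones[OF metric ctD(1), where i = i]) (rule that)
  obtain n2 where n2: "\<And>j. j \<ge> n2 \<Longrightarrow> \<exists>D\<in>B i. \<exists>p q. (Z' j, Z' (Suc j), D, c (Suc j), p, q) \<in> Tri C"
    by (rule cauchy_cones[OF metric ctD(3), where i = i]) (rule that)
  have oB: "orth D (Sh C V)" if "D \<in> B i" "V \<in> tge" for D V
    by (rule orth_deep[OF subsetD[OF i that(1)] that(2)])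
  let ?N = "max n1 n2"
  have Y: "Y' (?N + n) \<in> tilt_le C tle X" for n
  proof -
    let ?n = "?N + n"
    have le: "n1 \<le> ?n" "n2 \<le> ?n"
      using trans_le_add1[OF max.cobounded1[of n1 n2]] trans_le_add1[OF max.cobounded2[of n2 n1]] by blast+
    have oX: "orth (X' ?n) V" if V: "V \<in> tge" for V
      by (rule orth_late_terms[OF s(1) col(1) cauchy_seq[OF P(1)] P(3) n1 oB[OF _ V] aisleD(3)[OF P(2) V] le(1)])
    have oZ: "orth (Z' ?n) V" if V: "V \<in> tge" and "\<And>x. x \<in> X \<Longrightarrow> orth x V" for V
      by (rule orth_late_terms[OF s(3) col(3) cauchy_seq[OF Q(1)] Q(3) n2 oB[OF _ V] that(2)[OF Q(2)] le(2)])
    have oY: "orth (Y' ?n) V" if "V \<in> tge" "\<And>x. x \<in> X \<Longrightarrow> orth x V" for V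
      by (rule orth_mid_left[OF ctD(4) oX[OF that(1)] oZ[OF that]])
    show ?thesis
    proof (rule in_tilt_le[OF seq_Ob[OF s(2)]])
      fix W assume "W \<in> perp C X (heart tle tge)"
      then show "orth (Y' ?n) W" using oY perpD by blast
    next
      fix W assume W: "W \<in> tge" "Sh C W \<in> tge"
      have "orth x W" if x: "x \<in> X" for x
        using aisleD(3)[OF imageI[OF torsion_heart(1)[OF x]] W(2)]
          orth_Sh_iff[OF tge_Ob[OF torsion_heart(2)[OF x]] tge_Ob[OF W(1)]] by blast
      then show "orth (Y' ?n) W" by (rule oY[OF W(1)])
    qed
  qed
  show "F \<in> GG C B (tilt_le C tle X)"
    by (rule GG_I[OF LL_I[OF cauchy_tail[OF metric ctD(2)] Y seq_colim_tail[OF s(2) col(2)]] GG_D(2)[OF FG]])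
qed

text \<open>
  The aisle parts of the terms are suspensions \<open>\<Sigma>W n\<close> of torsion-free objects. Their colimit \<open>A\<close> vanishes
  on \<open>\<Sigma>T\<^sup>\<le>\<^sup>-\<^sup>1\<close>, so a single \<open>\<Sigma>W N\<close> represents it, and its desuspension is represented by \<open>W N\<close>.
\<close>

lemma tilt_ge_subset: "(GG C B (tilt_ge C tle tge X) :: ('o, 'm, 'g) cmod set) \<subseteq> G_tilt_ge C B tle tge X"
proof
  fix F :: "('o, 'm, 'g) cmod" assume F: "F \<in> GG C B (tilt_ge C tle tge X)"
  obtain Z z \<zeta> where Z: "cauchy C B Z z" "\<And>n. Z n \<in> tilt_ge C tle tge X" "seq_colim Z z F \<zeta>"
    by (rule LL_E[OF GG_D(1)[OF F] emb]) (rule that)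
  have "\<exists>W\<in>perp C X (heart tle tge). \<exists>V\<in>tge. \<exists>u v w. (Sh C W, Z n, V, u, v, w) \<in> Tri C" for n
    using Z(2)[of n] unfolding tilt_ge_def star_def by simp
  then obtain W V u v w where t: "\<And>n. W n \<in> perp C X (heart tle tge)" "\<And>n. V n \<in> tge"
    "\<And>n. (Sh C (W n), Z n, V n, u n, v n, w n) \<in> Tri C" by metis
  have U: "Sh C (W n) \<in> Sh C ` tle" for n using perpD(1)[OF t(1)] by blast
  obtain a b and A D :: "('o, 'm, 'g) cmod" and \<alpha> \<delta> p q r where A: "cauchy C B (\<lambda>n. Sh C (W n)) a" "cauchy C B V b"
    "seq_colim (\<lambda>n. Sh C (W n)) a A \<alpha>" "seq_colim V b D \<delta>" "A \<in> CC C B" "D \<in> CC C B" "(A, F, D, p, q, r) \<in> GTri C B"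
    by (rule truncation_triangle[OF Z(1,3) GG_D(2)[OF F] U t(2,3)]) (rule that)
  note sA = cauchy_seq[OF A(1)]
  note WO = tge_Ob[OF perpD(2)[OF t(1)]]
  have Am: "A \<in> Mods C" by (rule seq_colimD(1)[OF A(3)])
  obtain i where i: "B i \<subseteq> Sh C ` Sh C ` Sh C ` tle" using metric_in_aisle by metis
  obtain N where N: "\<And>j. j \<ge> N \<Longrightarrow> \<exists>D\<in>B i. \<exists>p q. (Sh C (W j), Sh C (W (Suc j)), D, a (Suc j), p, q) \<in> Tri C"
    by (rule cauchy_cones[OF metric A(1), where i = i]) (rule that)
  have N': "\<exists>D\<in>Sh C ` Sh C ` Sh C ` tle. \<exists>p q. (Sh C (W j), Sh C (W (Suc j)), D, a (Suc j), p, q) \<in> Tri C"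
    if "j \<ge> N" for j using N[OF that] by (elim bexE) (rule bexI[OF _ subsetD[OF i]])
  have van: "vanishes A E" if "E \<in> Sh C ` Sh C ` tle" for E
    by (rule seq_colim_vanishes[OF sA A(3)]) (rule orth_deep[OF that perpD(2)[OF t(1)]])
  obtain O' where O': "zero_ob C O'" using ex_zero_ob by blast
  have WN: "Sh C (W N) \<in> Sh C ` tge" using perpD(2)[OF t(1)] by blast
  \<comment> \<open>\<open>\<Sigma>W N\<close> is its own coaisle part, with zero aisle part\<close>
  obtain \<xi> where r: "represents A (Sh C (W N)) \<xi>"
    using represented_by_truncation[OF aisle_shift sA A(3) N' van order_refl
        torsion_pair_zero[OF aisle_shift O'] WN tri_zero_left[OF O' Sh_Ob[OF WO]]] by metis
  let ?P = "ModShI A"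
  have rP: "represents ?P (W N) \<xi>" by (rule represents_ModShI[OF r WO])
  have vP: "vanishes ?P x" if "x \<in> X" for x
    using represents_vanishes[OF rP tge_Ob[OF torsion_heart(2)[OF that]]] perpD(3)[OF t(1) that] by blast
  \<comment> \<open>a map out of \<open>Q\<close> is determined by elements of the zero groups \<open>P(Y n)\<close>\<close>
  have "hom_zero (NatHom C Q ?P)" if QG: "Q \<in> GG C B X" for Q :: "('o, 'm, 'g) cmod"
  proof -
    obtain Y h \<kappa> where Y: "cauchy C B Y h" "\<And>n. Y n \<in> X" "seq_colim Y h Q \<kappa>"
      by (rule LL_E[OF GG_D(1)[OF QG] emb]) (rule that)
    note sY = cauchy_seq[OF Y(1)]
    have z: "(\<lambda>X\<in>Ob C. \<lambda>x\<in>El Q X. \<zero>\<^bsub>Fo ?P X\<^esub>) \<in> NatTr C Q ?P" (is "?z \<in> _")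
      by (rule NatZero_in[OF seq_colimD(1)[OF Y(3)] ModShI_in[OF Am]])
    have "\<theta> = ?z" if th: "\<theta> \<in> NatTr C Q ?P" for \<theta>
    proof (rule seq_colim_map_unique[OF sY Y(3) th z])
      fix n
      have "\<theta> (Y n) (\<kappa> n) = \<zero>\<^bsub>Fo ?P (Y n)\<^esub>"
        using vP[OF Y(2)] Nat_in[OF th seq_Ob[OF sY] seq_colimD(2)[OF Y(3)]] by (simp add: vanishes_def)
      then show "\<theta> (Y n) (\<kappa> n) = ?z (Y n) (\<kappa> n)"
        using seq_Ob[OF sY] seq_colimD(2)[OF Y(3)] by simp
    qed
    then have "NatTr C Q ?P = {?z}" using z by blast
    then show ?thesis by (simp only: hom_zero_def NatHom_sel)
  qed
  moreover have "?P \<in> Yo_image C (heart tle tge)"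
    unfolding Yo_image_def heart_def using represents_isomorphic[OF rP] ModShI_in[OF Am] perpD(1,2)[OF t(1)] by blast
  ultimately have P: "?P \<in> perp (completion C B) (GG C B X) (Yo_image C (heart tle tge))"
    by (simp add: perp_def completion_def)
  have "A = Sh (completion C B) ?P" by (simp add: completion_def ModSh_ModShI[OF Am])
  then have AP: "A \<in> Sh (completion C B) ` perp (completion C B) (GG C B X) (Yo_image C (heart tle tge))"
    using P by (rule image_eqI)
  have "D \<in> GG C B tge" by (rule GG_I[OF LL_I[OF A(2) t(2) A(4)] A(6)])
  moreover have "F \<in> Ob (completion C B)"
    using GG_I[OF LL_I[OF Z(1) seq_Ob[OF cauchy_seq[OF Z(1)]] Z(3)] GG_D(2)[OF F]] by (simp add: completion_def)
  moreover have "(A, F, D, p, q, r) \<in> Tri (completion C B)" using A(7) by (simp add: completion_def)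
  ultimately show "F \<in> G_tilt_ge C B tle tge X"
    unfolding G_tilt_ge_def star_def using AP by blast
qed

text \<open>
  Vanishing of \<open>F\<close> on \<open>\<Sigma>T\<^sup>\<le>\<^sup>-\<^sup>1\<close> and on \<open>\<Sigma>X\<close> is read off from the outer terms of the triangle, and gives a
  representing object in the tilted coaisle. The desuspension \<open>P\<close> of the first term vanishes on an
  object \<open>x\<close> of \<open>X\<close> by the Yoneda lemma, as \<open>Y(x)\<close> belongs to the completion of \<open>X\<close>.
\<close>

lemma tilt_ge_supset: "(G_tilt_ge C B tle tge X :: ('o, 'm, 'g) cmod set) \<subseteq> GG C B (tilt_ge C tle tge X)"
proof
  fix F :: "('o, 'm, 'g) cmod" assume "F \<in> G_tilt_ge C B tle tge X"
  then obtain A D :: "('o, 'm, 'g) cmod" and p q r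
    where A': "A \<in> Sh (completion C B) ` perp (completion C B) (GG C B X) (Yo_image C (heart tle tge))"
      "D \<in> GG C B tge" "(A, F, D, p, q, r) \<in> Tri (completion C B)"
    unfolding G_tilt_ge_def star_def by blast
  then obtain P where P: "P \<in> perp (completion C B) (GG C B X) (Yo_image C (heart tle tge))" "A = ModSh C P"
    by (auto simp: completion_def)
  have tri: "(A, F, D, p, q, r) \<in> GTri C B" using A'(3) by (simp add: completion_def)
  obtain W where W: "W \<in> heart tle tge" "mod_isomorphic C P (Yo C W)" and Pm: "P \<in> Mods C"
    using P(1) by (auto simp: perp_def Yo_image_def)
  have perpP: "hom_zero (NatHom C Q P)" if "Q \<in> GG C B X" for Q :: "('o, 'm, 'g) cmod"
    using P(1) that by (simp add: perp_def completion_def)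
  obtain X' Y' Z' a b c u v w \<xi> \<eta> \<zeta> where ct: "cauchy_triangles C B X' Y' Z' a b c u v w"
    and col: "seq_colim X' a A \<xi>" "seq_colim Y' b F \<eta>" "seq_colim Z' c D \<zeta>" and FG: "F \<in> GG C B (Ob C)"
    by (rule GTri_E[OF tri emb]) (rule that)
  note ctD = cauchy_trianglesD[OF ct]
  note s = cauchy_seq[OF ctD(1)] cauchy_seq[OF ctD(2)] cauchy_seq[OF ctD(3)]
  obtain i where i: "B i \<subseteq> Sh C ` Sh C ` tle" "B (Suc i) \<subseteq> Sh C ` Sh C ` Sh C ` tle" using metric_in_aisle .
  have vA: "vanishes A (Sh C S)" if "vanishes P S" for S
    using that by (simp add: P(2) vanishes_def ModSh_sel)
  have vP1: "vanishes P S" if "S \<in> Sh C ` tle" for S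
    by (rule Yo_image_vanishes[OF W(2) aisleD(3)[OF that]]) (use W(1) in \<open>simp add: heart_def\<close>)
  have vP2: "vanishes P x" if x: "x \<in> X" for x
    unfolding vanishes_def
  proof (intro conjI ballI)
    show xO: "x \<in> Ob C" by (rule tge_Ob[OF torsion_heart(2)[OF x]])
    fix y assume y: "y \<in> El P x"
    note sc = seq_const[OF xO]
    let ?Q = "germ_mod emb (\<lambda>_. x) (\<lambda>_. Idm C x)"
    let ?e = "\<lambda>n. germ emb (\<lambda>_. x) (\<lambda>_. Idm C x) x n (Idm C x)"
    note Q = seq_colim_germ_mod[OF sc emb]
    have "?Q \<in> CC C B"
    proof (rule CC_if_vanishes[OF metric _ aisle_Sh_closed seq_colimD(1)[OF Q]])
      show "B i \<subseteq> Sh C ` tle" using i(1) aisle_Sh_closed by blast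
      fix S assume "S \<in> Sh C ` tle"
      then show "vanishes ?Q S" by (intro seq_colim_vanishes[OF sc Q] aisleD(3) torsion_heart(2)[OF x])
    qed
    then have "?Q \<in> GG C B X" by (rule GG_I[OF LL_I[OF cauchy_const[OF metric xO] x Q]])
    then have hz: "NatTr C ?Q P = {\<lambda>X\<in>Ob C. \<lambda>x\<in>El ?Q X. \<zero>\<^bsub>Fo P X\<^esub>}"
      using perpP unfolding hom_zero_def NatHom_sel by blast
    obtain \<theta> where th: "\<theta> \<in> NatTr C ?Q P" "\<And>n. \<theta> x (?e n) = y"
      by (rule seq_colim_map[where \<eta> = "\<lambda>_. y", OF sc Q Pm y]) (simp add: Pm xO y, rule that)
    have "\<theta> x (?e 0) = \<zero>\<^bsub>Fo P x\<^esub>" using th(1) hz xO seq_colimD(2)[OF Q, of 0] by simp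
    then show "y = \<zero>\<^bsub>Fo P x\<^esub>" using th(2) by simp
  qed
  obtain Q h \<kappa> where Q: "cauchy C B Q h" "\<And>n. Q n \<in> tge" "seq_colim Q h D \<kappa>"
    by (rule LL_E[OF GG_D(1)[OF A'(2)] emb]) (rule that)
  have vD: "vanishes D S" if "S \<in> Sh C ` tle" for S
    by (rule seq_colim_vanishes[OF cauchy_seq[OF Q(1)] Q(3) aisleD(3)[OF that Q(2)]])
  have vF: "vanishes F S" if "vanishes A S" "S \<in> Sh C ` tle" for S
    by (rule colim_vanishes_middle[OF s ctD(4,5,6) col(1) that(1) col(3) vD[OF that(2)] col(2)])
  have vF1: "vanishes F E" if "E \<in> Sh C ` Sh C ` tle" for E
    using that vF[OF vA[OF vP1]] aisle_Sh_closed by blast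
  have vF2: "vanishes F (Sh C x)" if "x \<in> X" for x
    using vF[OF vA[OF vP2[OF that]]] torsion_heart(1)[OF that] by blast
  obtain N where N: "\<And>j. j \<ge> N \<Longrightarrow> \<exists>D\<in>B (Suc i). \<exists>p q. (Y' j, Y' (Suc j), D, b (Suc j), p, q) \<in> Tri C"
    by (rule cauchy_cones[OF metric ctD(2), where i = "Suc i"]) (rule that)
  have N': "\<exists>D\<in>Sh C ` Sh C ` Sh C ` tle. \<exists>p q. (Y' j, Y' (Suc j), D, b (Suc j), p, q) \<in> Tri C"
    if "j \<ge> N" for j using N[OF that] by (elim bexE) (rule bexI[OF _ subsetD[OF i(2)]])
  obtain E V e f g where t: "E \<in> Sh C ` Sh C ` tle" "V \<in> Sh C ` tge" "(E, Y' N, V, e, f, g) \<in> Tri C"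
    using torsion_pairE[OF aisle_shift seq_Ob[OF s(2)]] .
  obtain \<rho> where r: "represents F V \<rho>"
    using represented_by_truncation[OF aisle_shift s(2) col(2) N' vF1 order_refl t] by metis
  have "V \<in> tilt_ge C tle tge X"
    by (rule in_tilt_ge[OF t(2)]) (use vF2 represents_vanishes[OF r] in \<open>blast intro: Sh_Ob tge_Ob torsion_heart(2)\<close>)
  then show "F \<in> GG C B (tilt_ge C tle tge X)"
    using LL_represents[OF metric r] GG_D(2)[OF FG] by (intro GG_I)
qed

end

theorem theorem1p1:
  fixes K :: "('k, 'z) ring_scheme"
    and T :: "('o, 'm, 'k) lin_tricat"
    and B :: "nat \<Rightarrow> 'o set"
    and tle tge X :: "'o set"
    and emb :: "nat \<times> 'm \<Rightarrow> 'g"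
  assumes "linear_triangulated_category K T"
    and "good_metric T B"
    and "t_structure T tle tge"
    and "torsion_class T (heart tle tge) X"
    and "extendable B tle"
    and "inj emb"
  shows "(GG T B (tilt_le T tle X) :: ('o, 'm, 'g) cmod set) = G_tilt_le T B tle X
    \<and> (GG T B (tilt_ge T tle tge X) :: ('o, 'm, 'g) cmod set) = G_tilt_ge T B tle tge X"
proof -
  interpret tilting_data T B tle tge X emb
    using assms by (simp add: tilting_data_def tilting_data_axioms_def linear_triangulated_category_def)
  show ?thesis
    using tilt_le_subset tilt_le_supset tilt_ge_subset tilt_ge_supset by (intro conjI subset_antisym)
qed

end
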